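(* Let $f,g:\mathcal{C}\to\mathcal{D}$ be two non $1$-contracting $\omega$-functors between $\omega$-categories and let $n$ be a natural number. Suppose that $f(x)=g(x)$ for every $x$ of dimension strictly lower than $n$, and that for every $n$-dimensional $x$, $f(x)$ and $g(x)$ are two homotopic $n$-morphisms of $\mathcal{D}$. Then for every $p\le n$ and every $\alpha\in\{-,+\}$, $f$ and $g$ yield linear maps $H_p^\alpha(f),H_p^\alpha(g):H_p^\alpha(\mathcal{C})\to H_p^\alpha(\mathcal{D})$, and moreover $H_p^\alpha(f)=H_p^\alpha(g)$.
   Context: An $\omega$-category is a set $A$ with maps $s_n=d_n^-$ and $t_n=d_n^+$ from $A$ to $A$ ($n\ge 0$) and partial binary operations $*_n$ ($n\ge 0$), where $x*_n y$ is defined exactly when $t_n x=s_n y$, such that for all $\alpha,\beta\in\{-,+\}$: (1) $d_m^\beta d_n^\alpha x=d_m^\beta x$ if $m<n$ and $d_m^\beta d_n^\alpha x=d_n^\alpha x$ if $m\ge n$; (2) $s_nx*_nx=x*_nt_nx=x$; (3) if $x*_ny$ is defined then $s_n(x*_ny)=s_nx$, $t_n(x*_ny)=t_ny$, and $d_m^\alpha(x*_ny)=d_m^\alpha x*_nd_m^\alpha y$ for $m\neq n$; (4) $(x*_ny)*_nz=x*_n(y*_nz)$ when both sides exist; (5) $(x*_ny)*_m(z*_nw)=(x*_mz)*_n(y*_mw)$ for $m\neq n$ when both sides make sense; (6) for every $x$ there is $n$ with $s_nx=t_nx=x$; the least such $n$ is the dimension $\dim(x)$. An $\omega$-functor preserves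 all $s_n,t_n,*_n$; $\omega Cat$ is the resulting category. $\mathcal{C}_n$ is the set of $n$-dimensional elements ($n$-morphisms) of $\mathcal{C}$; $\mathbb{Z}S$ is the free abelian group on $S$. Standing assumption: in $\mathcal{C}$ and $\mathcal{D}$, $s_nx$ and $t_nx$ are $n$-dimensional whenever $x$ is $(n+1)$-dimensional ($n\ge0$). An $\omega$-functor $f$ is non $1$-contracting if $f(x)$ is $1$-dimensional for every $1$-dimensional $x$. Two $n$-morphisms $x,y$ of $\mathcal{D}$ ($n\ge1$) are homotopic if there is $z\in\mathbb{Z}\mathcal{D}_{n+1}$ with $s_nz-t_nz=x-y$; two $0$-morphisms are said to be homotopic when they are equal. The $\omega$-category $I^n$ of the $n$-cube: let $\Lambda^n$ be the set of words $k_1\dots k_n$ in the alphabet $\{-,0,+\}$ (faces of the $n$-cube), the dimension being the number of zeros. For $x\in\Lambda^n$ of dimension $i$ and $y\in\Lambda^i$, let $r_y(x)$ be obtained by replacing the $\ell$-th zero of $x$ by $y(\ell)$ for all $\ell$. Write $b_y(x)=r_y(x)$ if $y(\ell)\ne0$ implies $y(\ell)=(-)^\ell$ (sign $-$ for $\ell$ odd, $+$ for $\ell$ even), and $e_y(x)=r_y(x)$ if $y(\ell)\neq0$ implies $y(\ell)=(-)^{\ell+1}$. For $X\subset\Lambda^n$ let $R(X)$ be the smallest subset containing $X$ and stable under all the operations $x\mapsto b_y(x)$, $x\mapsto e_y(x)$. $I^n$ is the unique $\omega$-category whose elements are subsets of $\Lambda^n$ of the form $R(X)$, including all $R(\{x\})$,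 $x\in\Lambda^n$; such that every element is a composite of elements $R(\{x\})$; for $x$ of dimension $p\ge1$, $s_{p-1}R(\{x\})=R(\{b_y(x):\dim y=p-1\})$ and $t_{p-1}R(\{x\})=R(\{e_y(x):\dim y=p-1\})$; and whenever $t_pR(X)=s_pR(Y)$, $R(X)*_pR(Y)=R(X\cup Y)$. It is freely generated by the faces of the $n$-cube. For $x\in\omega Cat(I^n,\mathcal{C})$ write $x(k_1\dots k_n)=x(R(\{k_1\dots k_n\}))$. Cubical singular nerve: the sets $\omega Cat(I^n,\mathcal{C})$ form a cubical set with $\partial_i^\alpha(x)(k_1\dots k_{n-1})=x(k_1\dots k_{i-1}\,\alpha\,k_i\dots k_{n-1})$ and $\epsilon_i(x)(k_1\dots k_{n+1})=x(k_1\dots\widehat{k_i}\dots k_{n+1})$. An element is degenerate if it lies in the image of some $\epsilon_i$. Corner homologies: for $\alpha\in\{-,+\}$, $\omega Cat(I^n,\mathcal{C})^\alpha$ is the set of $x\in\omega Cat(I^n,\mathcal{C})$ which are non degenerate and all of whose iterated faces $\partial^\alpha_{i_1}\cdots\partial^\alpha_{i_p}(x)$ are non degenerate. With $\partial^\alpha=\sum_i(-1)^{i+1}\partial_i^\alpha$, set $H_*^\alpha(\mathcal{C})=H_*(\mathbb{Z}\omega Cat(I^*,\mathcal{C})^\alpha,\partial^\alpha)$, functorial for non $1$-contracting $\omega$-functors by composition. *)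

theory Defs
  imports "HOL-Algebra.Free_Abelian_Groups"
begin

section \<open>Strict globular omega-categories\<close>

datatype sign = Minus | Plus

text \<open>\<open>bd C Minus n\<close> is the source map $s_n = d_n^-$ and \<open>bd C Plus n\<close> the target map
  $t_n = d_n^+$.  The operations are total in the record; their values off \<open>elems C\<close>, and the value
  of \<open>cmp C n x y\<close> for non-composable \<open>x\<close>, \<open>y\<close>, carry no meaning.\<close>

record 'a ocat =
  elems :: "'a set"
  bd :: "sign \<Rightarrow> nat \<Rightarrow> 'a \<Rightarrow> 'a"
  cmp :: "nat \<Rightarrow> 'a \<Rightarrow> 'a \<Rightarrow> 'a"

definition composable :: "'a ocat \<Rightarrow> nat \<Rightarrow> 'a \<Rightarrow> 'a \<Rightarrow> bool" where
  "composable C n x y \<longleftrightarrow> x \<in> elems C \<and> y \<in> elems C \<and> bd C Plus n x = bd C Minus n y"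

locale omega_category =
  fixes C :: "'a ocat"
  assumes bd_closed: "x \<in> elems C \<Longrightarrow> bd C \<alpha> n x \<in> elems C"
    and cmp_closed: "composable C n x y \<Longrightarrow> cmp C n x y \<in> elems C"
    and bd_bd_less: "x \<in> elems C \<Longrightarrow> m < n \<Longrightarrow> bd C \<beta> m (bd C \<alpha> n x) = bd C \<beta> m x"
    and bd_bd_ge: "x \<in> elems C \<Longrightarrow> n \<le> m \<Longrightarrow> bd C \<beta> m (bd C \<alpha> n x) = bd C \<alpha> n x"
    and cmp_source: "x \<in> elems C \<Longrightarrow> cmp C n (bd C Minus n x) x = x"
    and cmp_target: "x \<in> elems C \<Longrightarrow> cmp C n x (bd C Plus n x) = x"
    and source_cmp: "composable C n x y \<Longrightarrow> bd C Minus n (cmp C n x y) = bd C Minus n x"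
    and target_cmp: "composable C n x y \<Longrightarrow> bd C Plus n (cmp C n x y) = bd C Plus n y"
    and bd_cmp: "composable C n x y \<Longrightarrow> m \<noteq> n \<Longrightarrow>
      bd C \<alpha> m (cmp C n x y) = cmp C n (bd C \<alpha> m x) (bd C \<alpha> m y)"
    and assoc: "composable C n x y \<Longrightarrow> composable C n (cmp C n x y) z \<Longrightarrow>
      composable C n y z \<Longrightarrow> composable C n x (cmp C n y z) \<Longrightarrow>
      cmp C n (cmp C n x y) z = cmp C n x (cmp C n y z)"
    and interchange: "m \<noteq> n \<Longrightarrow>
      composable C n x y \<Longrightarrow> composable C n z w \<Longrightarrow>
      composable C m (cmp C n x y) (cmp C n z w) \<Longrightarrow>
      composable C m x z \<Longrightarrow> composable C m y w \<Longrightarrow>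
      composable C n (cmp C m x z) (cmp C m y w) \<Longrightarrow>
      cmp C m (cmp C n x y) (cmp C n z w) = cmp C n (cmp C m x z) (cmp C m y w)"
    and finite_dim: "x \<in> elems C \<Longrightarrow> \<exists>n. bd C Minus n x = x \<and> bd C Plus n x = x"

definition odim :: "'a ocat \<Rightarrow> 'a \<Rightarrow> nat" where
  "odim C x = (LEAST n. bd C Minus n x = x \<and> bd C Plus n x = x)"

definition n_morphisms :: "'a ocat \<Rightarrow> nat \<Rightarrow> 'a set" where
  "n_morphisms C n = {x \<in> elems C. odim C x = n}"

text \<open>The standing assumption on the omega-categories under consideration.\<close>

definition dim_regular :: "'a ocat \<Rightarrow> bool" where
  "dim_regular C \<longleftrightarrow>
     (\<forall>n. \<forall>x \<in> n_morphisms C (Suc n). \<forall>\<alpha>. bd C \<alpha> n x \<in> n_morphisms C n)"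

definition omega_functor :: "'a ocat \<Rightarrow> 'b ocat \<Rightarrow> ('a \<Rightarrow> 'b) \<Rightarrow> bool" where
  "omega_functor C D f \<longleftrightarrow>
     (\<forall>x \<in> elems C. f x \<in> elems D) \<and>
     (\<forall>x \<in> elems C. \<forall>\<alpha> n. f (bd C \<alpha> n x) = bd D \<alpha> n (f x)) \<and>
     (\<forall>n x y. composable C n x y \<longrightarrow> f (cmp C n x y) = cmp D n (f x) (f y))"

definition non_1_contracting :: "'a ocat \<Rightarrow> 'b ocat \<Rightarrow> ('a \<Rightarrow> 'b) \<Rightarrow> bool" where
  "non_1_contracting C D f \<longleftrightarrow> (\<forall>x \<in> n_morphisms C 1. f x \<in> n_morphisms D 1)"

definition homotopic_morphisms :: "'b ocat \<Rightarrow> nat \<Rightarrow> 'b \<Rightarrow> 'b \<Rightarrow> bool" where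
  "homotopic_morphisms D n x y \<longleftrightarrow>
     x \<in> n_morphisms D n \<and> y \<in> n_morphisms D n \<and>
     (if n = 0 then x = y
      else \<exists>z. z \<in> carrier (free_Abelian_group (n_morphisms D (n + 1))) \<and>
             frag_extend (\<lambda>u. frag_of (bd D Minus n u)) z
             - frag_extend (\<lambda>u. frag_of (bd D Plus n u)) z
             = frag_of x - frag_of y)"

inductive_set composites :: "'a ocat \<Rightarrow> 'a set \<Rightarrow> 'a set"
  for C :: "'a ocat" and G :: "'a set" where
    generator: "x \<in> G \<Longrightarrow> x \<in> composites C G"
  | composite: "x \<in> composites C G \<Longrightarrow> y \<in> composites C G \<Longrightarrow> composable C n x y \<Longrightarrow>
      cmp C n x y \<in> composites C G"


section \<open>The omega-category of the n-cube\<close>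

datatype letter = Zero | Sgn sign

definition words :: "nat \<Rightarrow> letter list set" where
  "words n = {k. length k = n}"

definition wdim :: "letter list \<Rightarrow> nat" where
  "wdim k = count_list k Zero"

text \<open>\<open>subst_zeros x y\<close> is $r_y(x)$: the \<open>l\<close>-th zero of \<open>x\<close> is replaced by the \<open>l\<close>-th letter of \<open>y\<close>.
  It is only used when \<open>length y = wdim x\<close>.\<close>

fun subst_zeros :: "letter list \<Rightarrow> letter list \<Rightarrow> letter list" where
  "subst_zeros [] y = []"
| "subst_zeros (Sgn a # x) y = Sgn a # subst_zeros x y"
| "subst_zeros (Zero # x) [] = Zero # subst_zeros x []"
| "subst_zeros (Zero # x) (c # y) = c # subst_zeros x y"

text \<open>The sign $(-)^l$.\<close>

definition alt_sign :: "nat \<Rightarrow> sign" where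
  "alt_sign l = (if odd l then Minus else Plus)"

text \<open>\<open>admissible Minus y\<close> is the condition for $b_y$ to be defined and \<open>admissible Plus y\<close> the one
  for $e_y$; letters are numbered from 1 there, whereas \<open>!\<close> counts from 0.\<close>

definition admissible :: "sign \<Rightarrow> letter list \<Rightarrow> bool" where
  "admissible \<alpha> y \<longleftrightarrow>
     (\<forall>l \<in> {1..length y}. y ! (l - 1) \<noteq> Zero \<longrightarrow>
        y ! (l - 1) = Sgn (case \<alpha> of Minus \<Rightarrow> alt_sign l | Plus \<Rightarrow> alt_sign (l + 1)))"

inductive_set R :: "letter list set \<Rightarrow> letter list set"
  for X :: "letter list set" where
    base: "x \<in> X \<Longrightarrow> x \<in> R X"
  | face: "x \<in> R X \<Longrightarrow> length y = wdim x \<Longrightarrow> admissible \<alpha> y \<Longrightarrow> subst_zeros x y \<in> R X"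

text \<open>The faces $b_y(x)$ (for \<open>Minus\<close>) or $e_y(x)$ (for \<open>Plus\<close>) with $\dim y = q$.\<close>

definition faces_of_dim :: "sign \<Rightarrow> nat \<Rightarrow> letter list \<Rightarrow> letter list set" where
  "faces_of_dim \<alpha> q x =
     {subst_zeros x y | y. length y = wdim x \<and> admissible \<alpha> y \<and> wdim y = q}"

text \<open>The characterization of $I^n$.  A face of the cube of dimension \<open>p\<close> is a \<open>p\<close>-morphism; this is
  part of the convention that $I^n$ is generated by the faces of the cube and is made explicit.\<close>

definition is_cube_ocat :: "nat \<Rightarrow> letter list set ocat \<Rightarrow> bool" where
  "is_cube_ocat n I \<longleftrightarrow>
     omega_category I \<and>
     elems I \<subseteq> R ` Pow (words n) \<and>
     (\<forall>x \<in> words n. R {x} \<in> n_morphisms I (wdim x)) \<and>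
     elems I = composites I {R {x} | x. x \<in> words n} \<and>
     (\<forall>x \<in> words n. wdim x \<ge> 1 \<longrightarrow>
        (\<forall>\<alpha>. bd I \<alpha> (wdim x - 1) (R {x}) = R (faces_of_dim \<alpha> (wdim x - 1) x))) \<and>
     (\<forall>X Y p. X \<subseteq> words n \<longrightarrow> Y \<subseteq> words n \<longrightarrow> composable I p (R X) (R Y) \<longrightarrow>
        cmp I p (R X) (R Y) = R (X \<union> Y))"

text \<open>\<open>is_cube_ocat n\<close> determines the elements, the maps \<open>bd\<close> on elements and the composites of
  composable elements; only the meaningless values of \<open>bd\<close> and \<open>cmp\<close> depend on the choice made by
  \<open>SOME\<close>, and nothing below refers to them.\<close>

definition cube :: "nat \<Rightarrow> letter list set ocat" where
  "cube n = (SOME I. is_cube_ocat n I)"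


section \<open>The cubical singular nerve\<close>

text \<open>$\omega Cat(I^n,\mathcal{C})$; functors are made extensional so that equal functors are equal
  functions.\<close>

definition cubes :: "'a ocat \<Rightarrow> nat \<Rightarrow> (letter list set \<Rightarrow> 'a) set" where
  "cubes C n = {x \<in> extensional (elems (cube n)). omega_functor (cube n) C x}"

definition insert_letter :: "nat \<Rightarrow> letter \<Rightarrow> letter list \<Rightarrow> letter list" where
  "insert_letter i c k = take (i - 1) k @ c # drop (i - 1) k"

definition delete_letter :: "nat \<Rightarrow> letter list \<Rightarrow> letter list" where
  "delete_letter i k = take (i - 1) k @ drop i k"

text \<open>\<open>face_map C n i \<alpha>\<close> is $\partial_i^\alpha$ from the \<open>n\<close>-cubes to the \<open>(n - 1)\<close>-cubes and
  \<open>degen_map C n i\<close> is $\epsilon_i$ from the \<open>n\<close>-cubes to the \<open>(n + 1)\<close>-cubes of \<open>C\<close>.  As $I^n$ is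
  generated by the faces of the cube, a cube is determined by its values on the \<open>R {k}\<close>.\<close>

definition face_map ::
    "'a ocat \<Rightarrow> nat \<Rightarrow> nat \<Rightarrow> sign \<Rightarrow> (letter list set \<Rightarrow> 'a) \<Rightarrow> letter list set \<Rightarrow> 'a" where
  "face_map C n i \<alpha> x =
     (THE y. y \<in> cubes C (n - 1) \<and>
        (\<forall>k \<in> words (n - 1). y (R {k}) = x (R {insert_letter i (Sgn \<alpha>) k})))"

definition degen_map ::
    "'a ocat \<Rightarrow> nat \<Rightarrow> nat \<Rightarrow> (letter list set \<Rightarrow> 'a) \<Rightarrow> letter list set \<Rightarrow> 'a" where
  "degen_map C n i x =
     (THE y. y \<in> cubes C (n + 1) \<and>
        (\<forall>k \<in> words (n + 1). y (R {k}) = x (R {delete_letter i k})))"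

definition degenerate :: "'a ocat \<Rightarrow> nat \<Rightarrow> (letter list set \<Rightarrow> 'a) \<Rightarrow> bool" where
  "degenerate C n x \<longleftrightarrow>
     (\<exists>i \<in> {1..n}. x \<in> degen_map C (n - 1) i ` cubes C (n - 1))"

text \<open>\<open>iterated_face C \<alpha> n x m y\<close>: the \<open>m\<close>-cube \<open>y\<close> is
  $\partial^\alpha_{i_1}\cdots\partial^\alpha_{i_p}(x)$ for some $p\ge 0$, where \<open>x\<close> is an \<open>n\<close>-cube.\<close>

inductive iterated_face ::
    "'a ocat \<Rightarrow> sign \<Rightarrow> nat \<Rightarrow> (letter list set \<Rightarrow> 'a) \<Rightarrow> nat \<Rightarrow> (letter list set \<Rightarrow> 'a) \<Rightarrow> bool"
  for C :: "'a ocat" and \<alpha> :: sign and n :: nat and x :: "letter list set \<Rightarrow> 'a" where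
    refl: "iterated_face C \<alpha> n x n x"
  | step: "iterated_face C \<alpha> n x m y \<Longrightarrow> i \<in> {1..m} \<Longrightarrow>
      iterated_face C \<alpha> n x (m - 1) (face_map C m i \<alpha> y)"

definition corner_cubes :: "'a ocat \<Rightarrow> sign \<Rightarrow> nat \<Rightarrow> (letter list set \<Rightarrow> 'a) set" where
  "corner_cubes C \<alpha> n =
     {x \<in> cubes C n. \<forall>m y. iterated_face C \<alpha> n x m y \<longrightarrow> \<not> degenerate C m y}"


section \<open>Corner homologies\<close>

definition corner_chain_group ::
    "'a ocat \<Rightarrow> sign \<Rightarrow> nat \<Rightarrow> ((letter list set \<Rightarrow> 'a) \<Rightarrow>\<^sub>0 int) monoid" where
  "corner_chain_group C \<alpha> n = free_Abelian_group (corner_cubes C \<alpha> n)"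

text \<open>The differential on \<open>n\<close>-chains; it vanishes for \<open>n = 0\<close>, the sum being empty.\<close>

definition corner_boundary ::
    "'a ocat \<Rightarrow> sign \<Rightarrow> nat \<Rightarrow> ((letter list set \<Rightarrow> 'a) \<Rightarrow>\<^sub>0 int) \<Rightarrow> ((letter list set \<Rightarrow> 'a) \<Rightarrow>\<^sub>0 int)"
  where
  "corner_boundary C \<alpha> n =
     frag_extend (\<lambda>x. \<Sum>i = 1..n. frag_cmul ((- 1) ^ (i + 1)) (frag_of (face_map C n i \<alpha> x)))"

definition corner_cycles where
  "corner_cycles C \<alpha> n = {c \<in> carrier (corner_chain_group C \<alpha> n). corner_boundary C \<alpha> n c = 0}"

definition corner_boundaries where
  "corner_boundaries C \<alpha> n =
     corner_boundary C \<alpha> (n + 1) ` carrier (corner_chain_group C \<alpha> (n + 1))"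

definition corner_cycle_group where
  "corner_cycle_group C \<alpha> n = subgroup_generated (corner_chain_group C \<alpha> n) (corner_cycles C \<alpha> n)"

definition corner_homology ::
    "'a ocat \<Rightarrow> sign \<Rightarrow> nat \<Rightarrow> ((letter list set \<Rightarrow> 'a) \<Rightarrow>\<^sub>0 int) set monoid" where
  "corner_homology C \<alpha> n = corner_cycle_group C \<alpha> n Mod corner_boundaries C \<alpha> n"

text \<open>The linear extension to \<open>n\<close>-chains of the composition of \<open>n\<close>-cubes with \<open>f\<close>.\<close>

definition chain_map ::
    "nat \<Rightarrow> ('a \<Rightarrow> 'b) \<Rightarrow> ((letter list set \<Rightarrow> 'a) \<Rightarrow>\<^sub>0 int) \<Rightarrow> ((letter list set \<Rightarrow> 'b) \<Rightarrow>\<^sub>0 int)" where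
  "chain_map n f = frag_extend (\<lambda>x. frag_of (compose (elems (cube n)) f x))"

text \<open>The map induced by \<open>f\<close> on homology classes, which are cosets of boundaries: a class \<open>Z\<close> is sent
  to the union of the classes of the images of its representatives.  This union lies in the carrier
  of the homology group of \<open>D\<close> only if all these images are cycles and have the same class, so
  membership of this map in \<open>hom\<close> includes its well-definedness.\<close>

definition corner_homology_map ::
    "'b ocat \<Rightarrow> sign \<Rightarrow> nat \<Rightarrow> ('a \<Rightarrow> 'b) \<Rightarrow>
     ((letter list set \<Rightarrow> 'a) \<Rightarrow>\<^sub>0 int) set \<Rightarrow> ((letter list set \<Rightarrow> 'b) \<Rightarrow>\<^sub>0 int) set" where
  "corner_homology_map D \<alpha> n f Z =
     (\<Union>c \<in> Z. corner_boundaries D \<alpha> n #>\<^bsub>corner_cycle_group D \<alpha> n\<^esub> chain_map n f c)"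

end

theory Submission
  imports Defs
begin

text \<open>
  Existence of $I^n$, without which \<open>cube n\<close> would be an arbitrary value of \<open>SOME\<close>.  A cell of the
  cube is represented by a table giving, for each sign and each dimension, an integral chain of faces;
  the omega-category operations on tables are defined degree by degree and satisfy the axioms formally.
  The atoms generate a family closed under sources and targets because the boundary of a cylinder is an iterated composite of smaller cylinders.
  A composite of atoms is determined by the set of faces below its support: among the faces
  in that set with given zeros, its source and target parts are the least and the greatest one.

  Homotopy.  Cubes agreeing with $f \circ x$ off the interior are determined by their interior cell, so
  for an $(n+1)$-morphism $u$ it suffices to compare the cubes with interiors $s_n u$ and $t_n u$.  Start
  from the connection that repeats the face of sign $\alpha$ in the first two directions, put $u$ in its
  interior and $s_n u$, $t_n u$ in these two faces: the boundary of the result differs from the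
  boundary of the connection itself by the difference of the two cubes.
\<close>

section \<open>Words and faces\<close>

text \<open>The corner complex is manageable because nondegeneracy of all iterated faces is a
  condition on edges alone: a cube belongs to the complex exactly when none of its edges at the
  corner of sign \<alpha> is sent to an element of dimension 0. Hence non 1-contracting functors act
  on the complex, and replacing an interior by a morphism of positive dimension stays inside it. New
  cubes come from altering a given functor in the interior and possibly on one more face. This is
  safe for two reasons: a composite in I^n without identity factor neither is the whole cube nor has
  it as a factor, and two factors composed in direction p share only faces of dimension at most p.
  Both are shown by projecting a face onto the top cell of a smaller cube. The obstacle in the
  homotopy step is that the chain z is formal: its terms need not have the lower boundaries of f(x),
  so that no cube with such an interior need exist. These terms are sent to 0, which is consistent
  because s_n u and t_n u always have the same boundaries below n.\<close>

fun opp :: "sign \<Rightarrow> sign" where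
  "opp Minus = Plus"
| "opp Plus = Minus"

lemma opp_opp [simp]: "opp (opp \<alpha>) = \<alpha>"
  by (cases \<alpha>) auto

lemma opp_neq [simp]: "opp \<alpha> \<noteq> \<alpha>" "\<alpha> \<noteq> opp \<alpha>"
  by (cases \<alpha>; simp)+

lemma neq_iff_opp: "\<alpha> \<noteq> \<beta> \<longleftrightarrow> \<alpha> = opp \<beta>"
  by (cases \<alpha>; cases \<beta>) auto

lemma wdim_simps [simp]:
  "wdim [] = 0" "wdim (Zero # k) = Suc (wdim k)" "wdim (Sgn a # k) = wdim k"
  by (auto simp: wdim_def)

lemma wdim_append [simp]: "wdim (k @ l) = wdim k + wdim l"
  by (simp add: wdim_def)

lemma wdim_le_length: "wdim k \<le> length k"
  by (simp add: wdim_def count_le_length)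

lemma wdim_eq_length: "wdim k = length k \<Longrightarrow> k = replicate (length k) Zero"
proof (induction k)
  case (Cons c k)
  then show ?case using wdim_le_length [of k] by (cases c) auto
qed auto

lemma wdim_replicate [simp]: "wdim (replicate n Zero) = n"
  by (induction n) auto

definition is_face :: "letter list \<Rightarrow> letter list \<Rightarrow> bool" where
  "is_face = list_all2 (\<lambda>a b. b = Zero \<or> a = b)"

lemma is_face_simps [simp]:
  "is_face [] k \<longleftrightarrow> k = []" "is_face w [] \<longleftrightarrow> w = []"
  "is_face (a # w) (b # k) \<longleftrightarrow> (b = Zero \<or> a = b) \<and> is_face w k"
  by (auto simp: is_face_def)

lemma is_face_length: "is_face w k \<Longrightarrow> length w = length k"
  by (simp add: is_face_def list_all2_lengthD)

lemma is_face_refl [simp]: "is_face k k"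
  by (induction k) auto

lemma is_face_trans: "is_face u v \<Longrightarrow> is_face v w \<Longrightarrow> is_face u w"
  unfolding is_face_def by (rule list_all2_trans [of "\<lambda>a b. b = Zero \<or> a = b"]) auto

lemma is_face_Cons: "is_face w (b # k) \<longleftrightarrow> (\<exists>a w'. w = a # w' \<and> (b = Zero \<or> a = b) \<and> is_face w' k)"
  by (cases w) auto

lemma is_face_wdim: "is_face w k \<Longrightarrow> wdim w \<le> wdim k"
proof (induction k arbitrary: w)
  case (Cons c k)
  then obtain a w' where "w = a # w'" "c = Zero \<or> a = c" "is_face w' k" by (auto simp: is_face_Cons)
  with Cons.IH [of w'] show ?case by (cases a; cases c) auto
qed auto

lemma is_face_wdim_eq: "is_face w k \<Longrightarrow> wdim w = wdim k \<Longrightarrow> w = k"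
proof (induction k arbitrary: w)
  case (Cons c k)
  then obtain a w' where w: "w = a # w'" "c = Zero \<or> a = c" "is_face w' k" by (auto simp: is_face_Cons)
  with Cons.IH [of w'] Cons.prems is_face_wdim [of w' k] show ?case by (cases a; cases c) auto
qed auto

lemma is_face_replicate [simp]: "is_face w (replicate n Zero) \<longleftrightarrow> length w = n"
  by (induction n arbitrary: w) (auto simp: is_face_Cons length_Suc_conv)

definition face_closure :: "letter list set \<Rightarrow> letter list set" where
  "face_closure X = {w. \<exists>k \<in> X. is_face w k}"

lemma face_closure_Un: "face_closure (X \<union> Y) = face_closure X \<union> face_closure Y"
  by (auto simp: face_closure_def)

lemma face_closure_mono: "X \<subseteq> Y \<Longrightarrow> face_closure X \<subseteq> face_closure Y"
  by (auto simp: face_closure_def)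

lemma face_closure_superset: "X \<subseteq> face_closure X"
  unfolding face_closure_def using is_face_refl by blast

lemma face_closure_idem [simp]: "face_closure (face_closure X) = face_closure X"
  unfolding face_closure_def using is_face_refl is_face_trans by blast

lemma face_closure_subset: "face_closure X \<subseteq> face_closure Y \<longleftrightarrow> (\<forall>w\<in>X. \<exists>k\<in>Y. is_face w k)"
  unfolding face_closure_def using is_face_refl is_face_trans by blast

lemma mem_face_closure_singleton [simp]: "w \<in> face_closure {k} \<longleftrightarrow> is_face w k"
  by (auto simp: face_closure_def)

text \<open>The faces b_y or e_y of codimension one. Passing a zero exchanges the two signs: this is
  the alternation (-)^l in recursive form.\<close>

fun facets :: "sign \<Rightarrow> letter list \<Rightarrow> letter list set" where
  "facets \<alpha> [] = {}"
| "facets \<alpha> (Zero # k) = insert (Sgn \<alpha> # k) ((#) Zero ` facets (opp \<alpha>) k)"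
| "facets \<alpha> (Sgn c # k) = (#) (Sgn c) ` facets \<alpha> k"

lemma facets_wdim: "w \<in> facets \<alpha> k \<Longrightarrow> Suc (wdim w) = wdim k"
  by (induction \<alpha> k arbitrary: w rule: facets.induct) auto

lemma facets_is_face: "w \<in> facets \<alpha> k \<Longrightarrow> is_face w k"
  by (induction \<alpha> k arbitrary: w rule: facets.induct) auto

lemma is_face_facet:
  assumes "is_face w k" "w \<noteq> k"
  obtains \<alpha> v where "v \<in> facets \<alpha> k" "is_face w v"
proof -
  have "\<exists>\<alpha>. \<exists>v\<in>facets \<alpha> k. is_face w v"
    using assms
  proof (induction k arbitrary: w)
    case (Cons c k)
    then obtain a w' where w: "w = a # w'" "c = Zero \<or> a = c" "is_face w' k" by (auto simp: is_face_Cons)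
    show ?case
    proof (cases "w' = k")
      case True
      with w Cons.prems show ?thesis
        by (cases a) auto
    next
      case False
      then obtain \<alpha> v where v: "v \<in> facets \<alpha> k" "is_face w' v" using Cons.IH w by blast
      show ?thesis
      proof (cases c)
        case Zero
        with v w have "Zero # v \<in> facets (opp \<alpha>) (c # k)" "is_face w (Zero # v)" by auto
        then show ?thesis by blast
      next
        case (Sgn s)
        with v w have "Sgn s # v \<in> facets \<alpha> (c # k)" "is_face w (Sgn s # v)" by auto
        then show ?thesis by blast
      qed
    qed
  qed auto
  then show ?thesis using that by blast
qed

lemma alt_sign_Suc [simp]: "alt_sign (Suc l) = opp (alt_sign l)"
  by (auto simp: alt_sign_def)

lemma admissible_Nil [simp]: "admissible \<alpha> []"
  by (simp add: admissible_def)

text \<open>Dropping the first letter shifts every position by one, which exchanges the conditions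
  for b_y and e_y.\<close>

lemma admissible_Cons [simp]:
  "admissible \<alpha> (c # y) \<longleftrightarrow> (c = Zero \<or> c = Sgn \<alpha>) \<and> admissible (opp \<alpha>) y"
proof -
  have adm: "admissible \<alpha> y \<longleftrightarrow>
     (\<forall>l < length y. y ! l \<noteq> Zero \<longrightarrow> y ! l = Sgn (case \<alpha> of Minus \<Rightarrow> opp (alt_sign l) | Plus \<Rightarrow> alt_sign l))"
    for \<alpha> y
  proof -
    have "{1..length y} = Suc ` {..<length y}"
      by (auto simp: image_iff Bex_def) presburger
    then show ?thesis
      unfolding admissible_def by (auto split: sign.splits)
  qed
  have all_Suc: "(\<forall>l < Suc n. P l) \<longleftrightarrow> P 0 \<and> (\<forall>l < n. P (Suc l))" for n P
    by (metis less_Suc_eq_0_disj)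
  show ?thesis
    unfolding adm by (cases \<alpha>) (auto simp: all_Suc, auto simp: alt_sign_def)
qed

lemma subst_zeros_is_face: "length y = wdim x \<Longrightarrow> is_face (subst_zeros x y) x"
  by (induction x y rule: subst_zeros.induct) auto

lemma subst_zeros_replicate: "subst_zeros x (replicate (wdim x) Zero) = x"
proof (induction x)
  case (Cons c x)
  then show ?case by (cases c) auto
qed auto

lemma faces_of_dim_facets:
  assumes "1 \<le> wdim x"
  shows "faces_of_dim \<alpha> (wdim x - 1) x = facets \<alpha> x"
proof -
  have "{subst_zeros x y | y. length y = wdim x \<and> admissible \<alpha> y \<and> Suc (wdim y) = wdim x} = facets \<alpha> x"
  proof (induction \<alpha> x rule: facets.induct)
    case (1 \<alpha>)
    then show ?case by auto
  next
    case (2 \<alpha> k)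
    let ?A = "{subst_zeros k y | y. length y = wdim k \<and> admissible (opp \<alpha>) y \<and> Suc (wdim y) = wdim k}"
    have "\<exists>y. Sgn \<alpha> # k = subst_zeros (Zero # k) y \<and> length y = Suc (wdim k) \<and> admissible \<alpha> y \<and> wdim y = wdim k"
    proof -
      have "admissible \<beta> (replicate m Zero)" for \<beta> m
        by (induction m arbitrary: \<beta>) auto
      then show ?thesis
        using subst_zeros_replicate [of k] by (intro exI [of _ "Sgn \<alpha> # replicate (wdim k) Zero"]) auto
    qed
    moreover have "\<exists>y. Zero # subst_zeros k y' = subst_zeros (Zero # k) y \<and> length y = Suc (wdim k) \<and> admissible \<alpha> y \<and> wdim y = wdim k"
      if "length y' = wdim k" "admissible (opp \<alpha>) y'" "Suc (wdim y') = wdim k" for y'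
      using that by (intro exI [of _ "Zero # y'"]) auto
    moreover have "subst_zeros (Zero # k) y = Sgn \<alpha> # k \<or> subst_zeros (Zero # k) y \<in> (#) Zero ` ?A"
      if y: "length y = Suc (wdim k)" "admissible \<alpha> y" "wdim y = wdim k" for y
    proof -
      obtain c y' where y': "y = c # y'" using y by (cases y) auto
      show ?thesis
      proof (cases c)
        case Zero
        then show ?thesis using y y' by auto
      next
        case (Sgn s)
        \<comment> \<open>A sign in front uses up the only letter of \<open>y\<close> that is not
          \<open>Zero\<close>.\<close>
        then have "y' = replicate (wdim k) Zero" using y y' wdim_eq_length [of y'] by auto
        then show ?thesis using y y' Sgn subst_zeros_replicate [of k] by auto
      qed
    qed
    ultimately have "{subst_zeros (Zero # k) y | y. length y = Suc (wdim k) \<and> admissible \<alpha> y \<and> wdim y = wdim k}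
        = insert (Sgn \<alpha> # k) ((#) Zero ` ?A)"
      by blast
    then show ?case using 2 by simp
  next
    case (3 \<alpha> c k)
    then show ?case by auto
  qed
  moreover have "wdim y = wdim x - 1 \<longleftrightarrow> Suc (wdim y) = wdim x" for y
    using assms by auto
  ultimately show ?thesis by (simp add: faces_of_dim_def)
qed

text \<open>Each operation alone allows only alternating signs, but every proper face lies in a
  facet of one of the two signs, so by induction on the dimension the closure contains all
  faces.\<close>

lemma R_eq_face_closure: "R X = face_closure X"
proof
  show "R X \<subseteq> face_closure X"
  proof
    fix w assume "w \<in> R X"
    then show "w \<in> face_closure X"
    proof induction
      case (face x y \<alpha>)
      then show ?case using subst_zeros_is_face is_face_trans by (fastforce simp: face_closure_def)
    qed (use face_closure_superset in blast)
  qed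
  have "w \<in> R X" if "k \<in> R X" "is_face w k" for w k
    using that
  proof (induction "wdim k" arbitrary: k rule: less_induct)
    case less
    show ?case
    proof (cases "w = k")
      case False
      with less obtain \<alpha> v where v: "v \<in> facets \<alpha> k" "is_face w v" using is_face_facet by blast
      then have "1 \<le> wdim k" using facets_wdim by fastforce
      with v obtain y where "v = subst_zeros k y" "length y = wdim k" "admissible \<alpha> y"
        using faces_of_dim_facets [of k \<alpha>] by (auto simp: faces_of_dim_def)
      then have "v \<in> R X" using less.prems R.face by blast
      then show ?thesis using less.hyps [of v] v facets_wdim [OF v(1)] by auto
    qed (use less in simp)
  qed
  then show "face_closure X \<subseteq> R X"
    by (auto simp: face_closure_def intro: R.base)
qed

section \<open>Tables\<close>

text \<open>The component of a table in degree \<open>q\<close> consists of its values on the words with \<open>q\<close> zeros.\<close>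

type_synonym table = "sign \<Rightarrow> letter list \<Rightarrow> int"

text \<open>\<open>tbd\<close> and \<open>tcmp\<close> are the operations of Steiner's
  omega-category of an augmented directed complex, on arbitrary double sequences of chains;
  \<open>tcmp p x y\<close> is x minus the common p-boundary plus y.\<close>

definition tbd :: "sign \<Rightarrow> nat \<Rightarrow> table \<Rightarrow> table" where
  "tbd \<alpha> p x = (\<lambda>\<beta> w. if wdim w < p then x \<beta> w else if wdim w = p then x \<alpha> w else 0)"

definition tcmp :: "nat \<Rightarrow> table \<Rightarrow> table \<Rightarrow> table" where
  "tcmp p x y = (\<lambda>\<beta> w. if wdim w < p then x \<beta> w
     else if wdim w = p then (case \<beta> of Minus \<Rightarrow> x Minus w | Plus \<Rightarrow> y Plus w)
     else x \<beta> w + y \<beta> w)"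

abbreviation tcomposable :: "nat \<Rightarrow> table \<Rightarrow> table \<Rightarrow> bool" where
  "tcomposable p x y \<equiv> tbd Plus p x = tbd Minus p y"

lemma tcomposable_iff:
  "tcomposable p x y \<longleftrightarrow>
     (\<forall>\<beta> w. wdim w < p \<longrightarrow> x \<beta> w = y \<beta> w) \<and> (\<forall>w. wdim w = p \<longrightarrow> x Plus w = y Minus w)"
proof
  assume eq: "tcomposable p x y"
  show "(\<forall>\<beta> w. wdim w < p \<longrightarrow> x \<beta> w = y \<beta> w) \<and> (\<forall>w. wdim w = p \<longrightarrow> x Plus w = y Minus w)"
  proof (intro conjI allI impI)
    fix \<beta> w assume "wdim w < p"
    then show "x \<beta> w = y \<beta> w" using fun_cong [OF fun_cong [OF eq], of \<beta> w] by (auto simp: tbd_def)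
  next
    fix w assume "wdim w = p"
    then show "x Plus w = y Minus w" using fun_cong [OF fun_cong [OF eq], of Plus w] by (auto simp: tbd_def)
  qed
qed (auto simp: tbd_def fun_eq_iff)

lemma tbd_cmp:
  "m \<noteq> p \<Longrightarrow> tbd \<alpha> m (tcmp p x y) = tcmp p (tbd \<alpha> m x) (tbd \<alpha> m y)"
  by (auto simp: tbd_def tcmp_def fun_eq_iff split: sign.splits)

lemma tbd_tbd: "tbd \<beta> m (tbd \<alpha> p x) = (if m < p then tbd \<beta> m x else tbd \<alpha> p x)"
  by (auto simp: tbd_def fun_eq_iff)

lemma tbd_Minus_cmp: "tbd Minus p (tcmp p x y) = tbd Minus p x"
  by (auto simp: tbd_def tcmp_def fun_eq_iff)

lemma tbd_Plus_cmp: "tcomposable p x y \<Longrightarrow> tbd Plus p (tcmp p x y) = tbd Plus p y"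
  by (auto simp: tcomposable_iff) (auto simp: tbd_def tcmp_def fun_eq_iff)

text \<open>Cells of the cube with one more coordinate in front: \<open>sgnT a x\<close> is the copy of \<open>x\<close> at the end \<open>a\<close>
  and \<open>zeroT x\<close> the cylinder on \<open>x\<close>, where the new zero shifts the parities of all later ones.  The
  source and the target of a cylinder are built from one end by composing with the cylinders on the
  boundaries of \<open>x\<close> in increasing dimension; \<open>side \<alpha> p x\<close> is the \<open>p\<close>-th stage.\<close>

definition sgnT :: "sign \<Rightarrow> table \<Rightarrow> table" where
  "sgnT a x = (\<lambda>\<beta> w. case w of Sgn c # w' \<Rightarrow> if c = a then x \<beta> w' else 0 | _ \<Rightarrow> 0)"

definition zeroT :: "table \<Rightarrow> table" where
  "zeroT x = (\<lambda>\<beta> w. case w of [] \<Rightarrow> 0 | Zero # w' \<Rightarrow> x (opp \<beta>) w'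
     | Sgn c # w' \<Rightarrow> if c = \<beta> then x \<beta> w' else 0)"

definition side :: "sign \<Rightarrow> nat \<Rightarrow> table \<Rightarrow> table" where
  "side \<alpha> p x = (\<lambda>\<beta> w. if wdim w < p then zeroT x \<beta> w
     else if wdim w = p then
       (case w of [] \<Rightarrow> 0 | Zero # w' \<Rightarrow> x (opp \<alpha>) w' | Sgn c # w' \<Rightarrow> if c = \<alpha> then x \<beta> w' else 0)
     else sgnT \<alpha> x \<beta> w)"

lemma table_eqI:
  assumes "\<And>\<beta>. x \<beta> [] = y \<beta> []" "\<And>\<beta> w. x \<beta> (Zero # w) = y \<beta> (Zero # w)"
    "\<And>\<beta> c w. x \<beta> (Sgn c # w) = y \<beta> (Sgn c # w)"
  shows "x = (y :: table)"
proof (intro ext)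
  fix \<beta> w
  show "x \<beta> w = y \<beta> w"
  proof (cases w)
    case (Cons c w')
    then show ?thesis using assms by (cases c) auto
  qed (use assms in auto)
qed

lemma sgnT_simps [simp]:
  "sgnT a x \<beta> [] = 0" "sgnT a x \<beta> (Zero # w) = 0"
  "sgnT a x \<beta> (Sgn c # w) = (if c = a then x \<beta> w else 0)"
  by (auto simp: sgnT_def)

lemma zeroT_simps [simp]:
  "zeroT x \<beta> [] = 0" "zeroT x \<beta> (Zero # w) = x (opp \<beta>) w"
  "zeroT x \<beta> (Sgn c # w) = (if c = \<beta> then x \<beta> w else 0)"
  by (auto simp: zeroT_def)

lemma sgnT_tbd: "sgnT a (tbd \<alpha> p x) = tbd \<alpha> p (sgnT a x)"
  by (rule table_eqI) (auto simp: tbd_def)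

lemma sgnT_tcmp: "sgnT a (tcmp p x y) = tcmp p (sgnT a x) (sgnT a y)"
  by (rule table_eqI) (auto simp: tcmp_def split: sign.splits)

lemma side_0: "side \<alpha> 0 x = sgnT \<alpha> x"
  by (rule table_eqI) (auto simp: side_def)

text \<open>The next stage attaches the cylinder on the p-boundary of the sign opposite to that of
  the end, because the new zero in front swaps the signs of everything behind it.\<close>

lemma side_Minus_Suc:
  "tcomposable p (side Minus p x) (zeroT (tbd Plus p x))"
  "tcmp p (side Minus p x) (zeroT (tbd Plus p x)) = side Minus (Suc p) x"
   apply (rule table_eqI; auto simp: side_def tbd_def)
  apply (rule table_eqI; auto simp: side_def tbd_def tcmp_def split: sign.splits)
  done

lemma side_Plus_Suc:
  "tcomposable p (zeroT (tbd Minus p x)) (side Plus p x)"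
  "tcmp p (zeroT (tbd Minus p x)) (side Plus p x) = side Plus (Suc p) x"
   apply (rule table_eqI; auto simp: side_def tbd_def)
  apply (rule table_eqI; auto simp: side_def tbd_def tcmp_def split: sign.splits)
  done

text \<open>The key formula: a boundary of a cylinder is a stage of \<open>side\<close>, hence one
  end composed with cylinders on boundaries of lower dimension.\<close>

lemma tbd_zeroT: "tbd \<alpha> p (zeroT x) = side \<alpha> p (tbd \<alpha> p x)"
  by (rule table_eqI) (auto simp: side_def tbd_def)

text \<open>The pattern is that of two adjacent squares: their cylinders cannot be composed
  directly, so each is first extended in direction p by a side of the other, and the two results are
  composed in direction p+1.\<close>

lemma zeroT_tcmp:
  assumes "tcomposable p y z"
  shows "tcomposable p (side Minus p (tbd Minus (Suc p) y)) (zeroT z)"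
    and "tcomposable p (zeroT y) (side Plus p (tbd Plus (Suc p) z))"
    and "tcomposable (Suc p) (tcmp p (side Minus p (tbd Minus (Suc p) y)) (zeroT z))
           (tcmp p (zeroT y) (side Plus p (tbd Plus (Suc p) z)))"
    and "zeroT (tcmp p y z) = tcmp (Suc p) (tcmp p (side Minus p (tbd Minus (Suc p) y)) (zeroT z))
           (tcmp p (zeroT y) (side Plus p (tbd Plus (Suc p) z)))"
proof -
  have yz: "\<And>\<beta> w. wdim w < p \<Longrightarrow> y \<beta> w = z \<beta> w" "\<And>w. wdim w = p \<Longrightarrow> y Plus w = z Minus w"
    using assms by (auto simp: tcomposable_iff)
  show "tcomposable p (side Minus p (tbd Minus (Suc p) y)) (zeroT z)"
    by (rule table_eqI; auto simp: yz side_def tbd_def)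
  show "tcomposable p (zeroT y) (side Plus p (tbd Plus (Suc p) z))"
    by (rule table_eqI; auto simp: yz side_def tbd_def)
  show "tcomposable (Suc p) (tcmp p (side Minus p (tbd Minus (Suc p) y)) (zeroT z))
           (tcmp p (zeroT y) (side Plus p (tbd Plus (Suc p) z)))"
    by (rule table_eqI; auto simp: yz side_def tbd_def tcmp_def split: sign.splits)
  show "zeroT (tcmp p y z) = tcmp (Suc p) (tcmp p (side Minus p (tbd Minus (Suc p) y)) (zeroT z))
           (tcmp p (zeroT y) (side Plus p (tbd Plus (Suc p) z)))"
    by (rule table_eqI; auto simp: yz side_def tbd_def tcmp_def split: sign.splits)
qed

section \<open>Cells of the cube: closure under cylinders and boundaries\<close>

primrec atom :: "letter list \<Rightarrow> table" where
  "atom [] = (\<lambda>\<beta> w. if w = [] then 1 else 0)"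
| "atom (c # k) = (case c of Zero \<Rightarrow> zeroT (atom k) | Sgn a \<Rightarrow> sgnT a (atom k))"

lemma atom_simps [simp]:
  "atom (Zero # k) = zeroT (atom k)" "atom (Sgn a # k) = sgnT a (atom k)"
  by auto

declare atom.simps(2) [simp del]

text \<open>The bound \<open>d\<close> on the dimension of the atoms is recorded because cylinders
  are treated by induction on it.\<close>

inductive_set cells :: "nat \<Rightarrow> nat \<Rightarrow> table set" for n d where
  atom: "k \<in> words n \<Longrightarrow> wdim k \<le> d \<Longrightarrow> atom k \<in> cells n d"
| comp: "x \<in> cells n d \<Longrightarrow> y \<in> cells n d \<Longrightarrow> tcomposable p x y \<Longrightarrow> tcmp p x y \<in> cells n d"

lemma cells_mono: "x \<in> cells n d \<Longrightarrow> d \<le> e \<Longrightarrow> x \<in> cells n e"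
  by (induction rule: cells.induct) (auto intro: cells.intros)

lemma words_simps [simp]: "[] \<in> words n \<longleftrightarrow> n = 0" "c # k \<in> words (Suc n) \<longleftrightarrow> k \<in> words n"
  by (auto simp: words_def)

lemma words_Suc_cases:
  assumes "k \<in> words (Suc n)" obtains c k' where "k = c # k'" "k' \<in> words n"
  using assms by (cases k) (auto simp: words_def)

lemma atom_above: "wdim k < wdim w \<Longrightarrow> atom k \<beta> w = 0"
proof (induction k arbitrary: \<beta> w)
  case (Cons c k)
  show ?case
  proof (cases w)
    case w: (Cons b w')
    then show ?thesis using Cons by (cases c; cases b) auto
  qed (use Cons in \<open>cases c; simp\<close>)
qed auto

lemma atom_top: "wdim w = wdim k \<Longrightarrow> atom k \<beta> w = (if w = k then 1 else 0)"
proof (induction k arbitrary: \<beta> w)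
  case (Cons c k)
  show ?case
  proof (cases w)
    case w: (Cons b w')
    then show ?thesis using Cons atom_above [of k w'] by (cases c; cases b) auto
  qed (use Cons in \<open>cases c; simp\<close>)
next
  case Nil
  then show ?case by (auto simp: wdim_def)
qed

lemma tbd_atom: "wdim k \<le> p \<Longrightarrow> tbd \<alpha> p (atom k) = atom k"
  by (auto simp: tbd_def fun_eq_iff atom_above atom_top le_eq_less_or_eq)

lemma cells_above: "x \<in> cells n d \<Longrightarrow> d < wdim w \<Longrightarrow> x \<beta> w = 0"
  by (induction rule: cells.induct) (auto simp: atom_above tcmp_def split: sign.splits)

lemma cells_top: "x \<in> cells n d \<Longrightarrow> d \<le> wdim w \<Longrightarrow> x Minus w = x Plus w"
proof (induction rule: cells.induct)
  case (atom k)
  then show ?case using atom_above [of k w] atom_top [of w k] by (cases "wdim k < wdim w") auto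
next
  case (comp x y p)
  then show ?case by (auto simp: tcmp_def tcomposable_iff)
qed

lemma cells_top': "x \<in> cells n d \<Longrightarrow> d \<le> wdim w \<Longrightarrow> x \<alpha> w = x \<beta> w"
  using cells_top [of x n d w] by (cases \<alpha>; cases \<beta>) auto

lemma cells_tbd_ge: "x \<in> cells n d \<Longrightarrow> d \<le> p \<Longrightarrow> tbd \<alpha> p x = x"
  by (auto simp: tbd_def fun_eq_iff cells_above cells_top')

lemma cells_tcmp_ge: "x \<in> cells n d \<Longrightarrow> y \<in> cells n d \<Longrightarrow> d \<le> p \<Longrightarrow> tcomposable p x y \<Longrightarrow> tcmp p x y = x"
  unfolding tcomposable_iff
  by (auto simp: tcmp_def fun_eq_iff cells_above split: sign.splits) (metis cells_top)+

lemma sgnT_cells: "x \<in> cells n d \<Longrightarrow> sgnT a x \<in> cells (Suc n) d"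
proof (induction rule: cells.induct)
  case (atom k)
  then show ?case using cells.atom [of "Sgn a # k" "Suc n" d] by auto
next
  case (comp x y p)
  then show ?case by (simp add: sgnT_tcmp) (metis cells.comp sgnT_tbd)
qed

lemma side_cells:
  assumes "x \<in> cells n d" "p \<le> d" "\<And>j \<beta>. j < p \<Longrightarrow> zeroT (tbd \<beta> j x) \<in> cells (Suc n) d"
  shows "side \<alpha> p x \<in> cells (Suc n) d"
  using assms(2,3)
proof (induction p)
  case 0
  then show ?case using assms sgnT_cells by (simp add: side_0)
next
  case (Suc p)
  then have "side \<alpha> p x \<in> cells (Suc n) d" "zeroT (tbd \<beta> p x) \<in> cells (Suc n) d" for \<beta> by auto
  then show ?case
    using side_Minus_Suc [of p x] side_Plus_Suc [of p x] cells.comp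
    by (cases \<alpha>) metis+
qed

text \<open>Closure of the cells of the n-cube under boundaries is a hypothesis because the two
  closure properties depend on each other; the induction on \<open>n\<close> that ties them together
  is that of \<open>tbd_cells\<close>.\<close>

lemma zeroT_cells:
  assumes bd: "\<And>x d j \<beta>. x \<in> cells n d \<Longrightarrow> tbd \<beta> j x \<in> cells n (min d j)"
    and "x \<in> cells n d"
  shows "zeroT x \<in> cells (Suc n) (Suc d)"
  using assms(2)
proof (induction d arbitrary: x rule: less_induct)
  case (less d)
  show ?case
    using less.prems
  proof (induction rule: cells.induct)
    case (atom k)
    then show ?case using cells.atom [of "Zero # k" "Suc n" "Suc d"] by auto
  next
    case (comp y z p)
    show ?case
    proof (cases "d \<le> p")
      \<comment> \<open>In a direction at or above \<open>d\<close> the composite equals its first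
        factor. This leaves p < d, where the cylinders on boundaries of dimension less than p fall
        under the outer induction hypothesis.\<close>
      case True
      then show ?thesis using comp cells_tcmp_ge by metis
    next
      case False
      have zb: "zeroT (tbd \<beta> j u) \<in> cells (Suc n) (Suc d)" if "j < p" "u \<in> cells n d" for u j \<beta>
      proof -
        have "tbd \<beta> j u \<in> cells n j" using bd [OF that(2), of \<beta> j] False that by (simp add: min_def split: if_splits)
        then have "zeroT (tbd \<beta> j u) \<in> cells (Suc n) (Suc j)" using less.IH False that by simp
        then show ?thesis by (rule cells_mono) (use False that in simp)
      qed
      have "side \<alpha> p (tbd \<beta> (Suc p) u) \<in> cells (Suc n) (Suc d)" if "u \<in> cells n d" for u \<alpha> \<beta>
      proof (rule side_cells)
        show "tbd \<beta> (Suc p) u \<in> cells n (Suc d)"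
          using bd [OF that, of \<beta> "Suc p"] by (rule cells_mono) auto
      next
        fix j \<gamma> assume "j < p"
        then show "zeroT (tbd \<gamma> j (tbd \<beta> (Suc p) u)) \<in> cells (Suc n) (Suc d)"
          using zb that by (simp add: tbd_tbd)
      qed (use False in auto)
      note s = this
      have "tcmp p (side Minus p (tbd Minus (Suc p) y)) (zeroT z) \<in> cells (Suc n) (Suc d)"
        "tcmp p (zeroT y) (side Plus p (tbd Plus (Suc p) z)) \<in> cells (Suc n) (Suc d)"
        using zeroT_tcmp(1,2) [OF comp(3)] comp s by (auto intro: cells.comp)
      then show ?thesis
        unfolding zeroT_tcmp(4) [OF comp(3)] by (rule cells.comp) (rule zeroT_tcmp(3) [OF comp(3)])
    qed
  qed
qed

lemma tbd_cells_tcmp: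
  assumes "tbd \<alpha> p x \<in> cells n d" "tbd \<alpha> p y \<in> cells n d" "tcomposable q x y"
  shows "tbd \<alpha> p (tcmp q x y) \<in> cells n d"
proof (cases "q = p")
  case True
  then show ?thesis using assms by (cases \<alpha>) (auto simp: tbd_Plus_cmp tbd_Minus_cmp)
next
  case False
  have "tcomposable q (tbd \<alpha> p x) (tbd \<alpha> p y)"
    using assms(3) False unfolding tcomposable_iff by (auto simp: tbd_def)
  then show ?thesis using assms False by (simp add: tbd_cmp cells.comp)
qed

text \<open>A front sign only copies the boundary of the tail, and a front zero is handled by
  \<open>tbd_zeroT\<close>. The bound \<open>min d p\<close>, rather than \<open>d\<close>, is what
  lets the induction on dimension for cylinders descend.\<close>

lemma tbd_cells: "x \<in> cells n d \<Longrightarrow> tbd \<alpha> p x \<in> cells n (min d p)"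
proof (induction n arbitrary: x d \<alpha> p)
  case 0
  then show ?case
  proof (induction rule: cells.induct)
    case (atom k)
    then have "k = []" by (auto simp: words_def)
    then show ?case using tbd_atom [of k p \<alpha>] cells.atom [of k 0 "min d p"] by auto
  qed (rule tbd_cells_tcmp)
next
  case (Suc n)
  show ?case using Suc.prems
  proof (induction rule: cells.induct)
    case (atom k)
    then obtain c k' where k: "k = c # k'" "k' \<in> words n" by (auto elim: words_Suc_cases)
    show ?case
    proof (cases c)
      case (Sgn a)
      then have "atom k' \<in> cells n d" using atom k by (auto intro: cells.atom)
      then show ?thesis
        using Suc.IH [of "atom k'" d \<alpha> p] k Sgn sgnT_cells by (auto simp: sgnT_tbd [symmetric])
    next
      case Zero
      show ?thesis
      proof (cases "wdim k \<le> p")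
        case True
        then show ?thesis using tbd_atom [of k p \<alpha>] cells.atom [of k "Suc n" "min d p"] atom by auto
      next
        case False
        let ?e = "wdim k'"
        have a: "atom k' \<in> cells n ?e" using k by (auto intro: cells.atom)
        have pe: "p \<le> ?e" "p \<le> d" using False k Zero atom by auto
        have "side \<alpha> p (tbd \<alpha> p (atom k')) \<in> cells (Suc n) p"
        proof (rule side_cells)
          show "tbd \<alpha> p (atom k') \<in> cells n p" using Suc.IH [OF a, of \<alpha> p] pe by (simp add: min_def split: if_splits)
        next
          fix j \<beta> assume "j < p"
          then have "tbd \<beta> j (atom k') \<in> cells n j"
            using Suc.IH [OF a, of \<beta> j] pe by (simp add: min_def split: if_splits)
          then have "zeroT (tbd \<beta> j (atom k')) \<in> cells (Suc n) (Suc j)"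
            by (intro zeroT_cells Suc.IH)
          then show "zeroT (tbd \<beta> j (tbd \<alpha> p (atom k'))) \<in> cells (Suc n) p"
            using \<open>j < p\<close> by (auto simp: tbd_tbd intro: cells_mono)
        qed auto
        then show ?thesis using k Zero pe by (simp add: tbd_zeroT min_def split: if_splits)
      qed
    qed
  qed (rule tbd_cells_tcmp)
qed

section \<open>The omega-category of the cube\<close>

definition same_zeros :: "letter list \<Rightarrow> letter list \<Rightarrow> bool" where
  "same_zeros = list_all2 (\<lambda>a b. a = Zero \<longleftrightarrow> b = Zero)"

lemma same_zeros_simps [simp]:
  "same_zeros [] v \<longleftrightarrow> v = []" "same_zeros w [] \<longleftrightarrow> w = []"
  "same_zeros (a # w) (b # v) \<longleftrightarrow> (a = Zero \<longleftrightarrow> b = Zero) \<and> same_zeros w v"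
  by (auto simp: same_zeros_def)

lemma same_zeros_refl [simp]: "same_zeros w w"
  by (induction w) auto

lemma same_zeros_sym: "same_zeros w v \<Longrightarrow> same_zeros v w"
  by (auto simp: same_zeros_def list_all2_conv_all_nth)

lemma same_zeros_trans: "same_zeros u v \<Longrightarrow> same_zeros v w \<Longrightarrow> same_zeros u w"
  by (auto simp: same_zeros_def list_all2_conv_all_nth)

lemma same_zeros_wdim: "same_zeros w v \<Longrightarrow> wdim w = wdim v"
proof (induction w arbitrary: v)
  case (Cons a w)
  then obtain b v' where "v = b # v'" by (cases v) auto
  then show ?case using Cons by (cases a; cases b) auto
qed auto

text \<open>The words with a given set of zeros are ordered by letting the sign that occurs in sources
  come before the one that occurs in targets, position by position; \<open>before Minus w v\<close> is this order
  and \<open>before Plus\<close> the opposite one.\<close>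

fun before :: "sign \<Rightarrow> letter list \<Rightarrow> letter list \<Rightarrow> bool" where
  "before \<beta> [] [] = True"
| "before \<beta> (Zero # w) (Zero # v) = before (opp \<beta>) w v"
| "before \<beta> (Sgn a # w) (Sgn b # v) = ((a = b \<or> a = \<beta>) \<and> before \<beta> w v)"
| "before _ _ _ = False"

lemma before_opp: "before (opp \<beta>) w v \<longleftrightarrow> before \<beta> v w"
  by (induction \<beta> v w rule: before.induct) (auto simp: neq_iff_opp)

lemma before_trans: "before \<beta> u v \<Longrightarrow> before \<beta> v w \<Longrightarrow> before \<beta> u w"
proof (induction \<beta> u v arbitrary: w rule: before.induct)
  case (2 \<beta> u v)
  then show ?case by (cases "(\<beta>, Zero # v, w)" rule: before.cases) auto
next
  case (3 \<beta> a u b v)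
  then show ?case by (cases "(\<beta>, Sgn b # v, w)" rule: before.cases) auto
qed auto

lemma before_antisym: "before \<beta> w v \<Longrightarrow> before \<beta> v w \<Longrightarrow> w = v"
  by (induction \<beta> w v rule: before.induct) auto

definition extremal :: "table \<Rightarrow> letter list set \<Rightarrow> bool" where
  "extremal x S \<longleftrightarrow> (\<forall>\<beta> w. x \<beta> w = 0 \<or> x \<beta> w = 1) \<and> (\<forall>\<beta> w. x \<beta> w = 1 \<longrightarrow> w \<in> S) \<and>
     (\<forall>\<beta>. \<forall>w \<in> S. \<exists>v. x \<beta> v = 1 \<and> same_zeros v w) \<and>
     (\<forall>\<beta> v. \<forall>w \<in> S. x \<beta> v = 1 \<longrightarrow> same_zeros v w \<longrightarrow> before \<beta> v w)"

lemma extremal_iff: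
  assumes "extremal x S"
  shows "x \<beta> w = (if w \<in> S \<and> (\<forall>v \<in> S. same_zeros w v \<longrightarrow> before \<beta> w v) then 1 else 0)"
proof -
  have "x \<beta> w = 1" if w: "w \<in> S" "\<forall>v \<in> S. same_zeros w v \<longrightarrow> before \<beta> w v"
  proof -
    obtain v where "x \<beta> v = 1" "same_zeros v w" using assms w unfolding extremal_def by blast
    moreover from this have "before \<beta> v w" "before \<beta> w v"
      using assms w by (auto simp: extremal_def same_zeros_sym)
    ultimately show ?thesis using before_antisym by metis
  qed
  moreover have "w \<in> S \<and> (\<forall>v \<in> S. same_zeros w v \<longrightarrow> before \<beta> w v)" if "x \<beta> w = 1"
    using assms that by (auto simp: extremal_def)
  ultimately show ?thesis using assms by (metis extremal_def)
qed

lemma extremal_unique: "extremal x S \<Longrightarrow> extremal y S \<Longrightarrow> x = y"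
  by (auto simp: fun_eq_iff extremal_iff)

text \<open>One common zero can be frozen to opposite ends in the two words, which puts the
  resulting faces in the wrong order. In a composite in direction p, however, the p-faces of the
  first factor come before those of the second; so above dimension p the two factors have no set of
  zeros in common.\<close>

lemma separated_faces:
  assumes "same_zeros w v" "p < wdim w"
  shows "\<exists>f g. is_face f w \<and> is_face g v \<and> same_zeros f g \<and> wdim f = p \<and> \<not> before \<beta> f g"
  using assms
proof (induction w arbitrary: v)
  case (Cons a w)
  then obtain b v' where v: "v = b # v'" "same_zeros w v'" "a = Zero \<longleftrightarrow> b = Zero" by (cases v) auto
  show ?case
  proof (cases "p < wdim w")
    case True
    then obtain f g where fg: "is_face f w" "is_face g v'" "same_zeros f g" "wdim f = p" "\<not> before \<beta> f g"
      using Cons.IH v by blast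
    \<comment> \<open>A leading zero is frozen to the same sign in both words, leaving the
      comparison to the tails.\<close>
    define s t where "s = (if a = Zero then Sgn \<beta> else a)" and "t = (if a = Zero then Sgn \<beta> else b)"
    have "s \<noteq> Zero" "t \<noteq> Zero" using v by (auto simp: s_def t_def)
    then show ?thesis
      using fg v by (intro exI [of _ "s # f"] exI [of _ "t # g"]) (cases s; cases t; auto simp: s_def t_def split: if_splits)
  next
    case False
    with Cons.prems have "a = Zero" "p = wdim w" by (cases a; simp)+
    then show ?thesis using v
      by (intro exI [of _ "Sgn (opp \<beta>) # w"] exI [of _ "Sgn \<beta> # v'"]) auto
  qed
qed auto

section \<open>A cell is determined by its shape\<close>

definition supp :: "table \<Rightarrow> letter list set" where
  "supp x = {w. \<exists>\<beta>. x \<beta> w \<noteq> 0}"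

lemma supp_tcmp: "supp (tcmp p x y) \<subseteq> supp x \<union> supp y"
proof
  fix w assume "w \<in> supp (tcmp p x y)"
  then obtain \<beta> where "tcmp p x y \<beta> w \<noteq> 0" by (auto simp: supp_def)
  then have "x \<beta> w \<noteq> 0 \<or> y \<beta> w \<noteq> 0" by (cases \<beta>) (auto simp: tcmp_def split: if_splits)
  then show "w \<in> supp x \<union> supp y" by (auto simp: supp_def)
qed

definition shape :: "table \<Rightarrow> letter list set" where
  "shape x = face_closure (supp x)"

text \<open>A weak trace of the boundary formula of chain complexes: a word on which source and target of a
  cell differ lies in the boundary of both the source and the target one dimension higher.\<close>

definition filled :: "table \<Rightarrow> bool" where
  "filled x \<longleftrightarrow> (\<forall>\<alpha> \<beta> w. x \<alpha> w \<noteq> 0 \<longrightarrow> x (opp \<alpha>) w = 0 \<longrightarrow>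
     (\<exists>v. x \<beta> v \<noteq> 0 \<and> is_face w v \<and> wdim v = Suc (wdim w)))"

lemma atom_bool: "atom k \<beta> w = 0 \<or> atom k \<beta> w = 1"
proof (induction k arbitrary: \<beta> w)
  case (Cons c k)
  show ?case
  proof (cases w)
    case w: (Cons b w')
    then show ?thesis using Cons by (cases c; cases b) auto
  qed (cases c; simp)
qed auto

lemma atom_is_face: "atom k \<beta> w \<noteq> 0 \<Longrightarrow> is_face w k"
proof (induction k arbitrary: \<beta> w)
  case (Cons c k)
  show ?case
  proof (cases w)
    case w: (Cons b w')
    then show ?thesis using Cons by (cases c; cases b) (auto split: if_splits)
  qed (use Cons in \<open>cases c; simp\<close>)
qed (auto split: if_splits)

text \<open>\<open>atom\<close> and \<open>before\<close> exchange the signs behind a zero in the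
  same way, so existence and minimality of the chosen word both follow the recursion on
  \<open>k\<close>.\<close>

lemma atom_extremal: "extremal (atom k) {w. is_face w k}"
proof -
  have "\<exists>v. atom k \<beta> v = 1 \<and> same_zeros v w" if "is_face w k" for \<beta> w
    using that
  proof (induction k arbitrary: \<beta> w)
    case (Cons c k)
    then obtain a w' where w: "w = a # w'" "c = Zero \<or> a = c" "is_face w' k" by (auto simp: is_face_Cons)
    obtain v v' where v: "atom k \<beta> v = 1" "same_zeros v w'" "atom k (opp \<beta>) v' = 1" "same_zeros v' w'"
      using Cons.IH w by metis
    show ?case
    proof (cases c)
      case Zero
      show ?thesis
      proof (cases a)
        case a: Zero
        then show ?thesis using w v Zero by (intro exI [of _ "Zero # v'"]) auto
      next
        case (Sgn s)
        then show ?thesis using w v Zero by (intro exI [of _ "Sgn \<beta> # v"]) auto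
      qed
    next
      case (Sgn s)
      then show ?thesis using w v by (intro exI [of _ "Sgn s # v"]) auto
    qed
  qed auto
  moreover have "before \<beta> v w" if "is_face w k" "atom k \<beta> v = 1" "same_zeros v w" for \<beta> v w
    using that
  proof (induction k arbitrary: \<beta> v w)
    case (Cons c k)
    then obtain a w' where w: "w = a # w'" "c = Zero \<or> a = c" "is_face w' k" by (auto simp: is_face_Cons)
    obtain b v' where v: "v = b # v'" "same_zeros v' w'" "b = Zero \<longleftrightarrow> a = Zero" using w Cons.prems by (cases v) auto
    show ?case
      using Cons.IH [of w'] w v Cons.prems by (cases c; cases a; cases b) (auto split: if_splits)
  qed (auto split: if_splits)
  moreover have "is_face w k" if "atom k \<beta> w = 1" for \<beta> w
    using atom_is_face [of k \<beta> w] that by simp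
  ultimately show ?thesis
    unfolding extremal_def using atom_bool by blast
qed

lemma shape_atom: "shape (atom k) = {w. is_face w k}"
proof -
  have "k \<in> supp (atom k)" using atom_top [of k k] by (auto simp: supp_def)
  then show ?thesis
    using atom_is_face is_face_trans unfolding shape_def face_closure_def supp_def by blast
qed

lemma atom_filled: "filled (atom k)"
proof -
  have "\<exists>v. atom k \<beta> v \<noteq> 0 \<and> is_face w v \<and> wdim v = Suc (wdim w)"
    if "atom k \<alpha> w \<noteq> 0" "atom k (opp \<alpha>) w = 0" for \<alpha> \<beta> w
    using that
  proof (induction k arbitrary: \<alpha> \<beta> w)
    case (Cons c k)
    show ?case
    proof (cases c)
      case (Sgn a)
      then obtain w' where w: "w = Sgn a # w'" "atom k \<alpha> w' \<noteq> 0" "atom k (opp \<alpha>) w' = 0"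
        using Cons.prems by (auto simp: sgnT_def split: list.splits letter.splits if_splits)
      then obtain v where "atom k \<beta> v \<noteq> 0" "is_face w' v" "wdim v = Suc (wdim w')"
        using Cons.IH by blast
      then show ?thesis using Sgn w by (intro exI [of _ "Sgn a # v"]) auto
    next
      case Zero
      show ?thesis
      proof (cases w)
        case w: (Cons b w')
        show ?thesis
        proof (cases b)
          case b: Zero
          then obtain v where "atom k (opp \<beta>) v \<noteq> 0" "is_face w' v" "wdim v = Suc (wdim w')"
            using Cons.IH [of "opp \<alpha>" w' "opp \<beta>"] Cons.prems Zero w by auto
          then show ?thesis using Zero b w by (intro exI [of _ "Zero # v"]) auto
        next
          case (Sgn s)
          with Cons.prems Zero w have s: "s = \<alpha>" "atom k \<alpha> w' \<noteq> 0" by (auto split: if_splits)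
          show ?thesis
          \<comment> \<open>The first candidate turns the leading sign into a zero. If that word is
            missing from the part of sign \<beta>, then \<beta> = \<alpha> and the tail itself
            satisfies the induction hypothesis.\<close>
          proof (cases "atom k (opp \<beta>) w' = 0")
            case False
            then show ?thesis using Zero Sgn w by (intro exI [of _ "Zero # w'"]) auto
          next
            case True
            with s have "\<beta> = \<alpha>" by (metis neq_iff_opp opp_opp)
            with True s obtain v where "atom k \<alpha> v \<noteq> 0" "is_face w' v" "wdim v = Suc (wdim w')"
              using Cons.IH by blast
            then show ?thesis using Zero Sgn w s \<open>\<beta> = \<alpha>\<close> by (intro exI [of _ "Sgn \<alpha> # v"]) auto
          qed
        qed
      qed (use Zero Cons.prems in simp)
    qed
  qed (auto split: if_splits)
  then show ?thesis by (auto simp: filled_def)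
qed

text \<open>Below p the two tables agree. In degree p the comparison of a word of one factor with a
  word of the other passes through the common boundary. Above p the factors have no set of zeros in
  common, by \<open>separated_faces\<close>; this is where closure of \<open>S\<close> and
  \<open>T\<close> under faces enters.\<close>

lemma tcmp_extremal:
  assumes x: "extremal x S" and y: "extremal y T" and comp: "tcomposable p x y"
    and S: "\<And>w f. w \<in> S \<Longrightarrow> is_face f w \<Longrightarrow> f \<in> S" and T: "\<And>w f. w \<in> T \<Longrightarrow> is_face f w \<Longrightarrow> f \<in> T"
  shows "extremal (tcmp p x y) (S \<union> T)"
proof -
  have lo: "x \<beta> w = y \<beta> w" if "wdim w < p" for \<beta> w using comp that by (auto simp: tcomposable_iff)
  have eq: "x Plus w = y Minus w" if "wdim w = p" for w using comp that by (auto simp: tcomposable_iff)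
  have x1: "w \<in> S" if "x \<beta> w = 1" for \<beta> w using x that by (auto simp: extremal_def)
  have y1: "w \<in> T" if "y \<beta> w = 1" for \<beta> w using y that by (auto simp: extremal_def)
  have x2: "\<exists>v. x \<beta> v = 1 \<and> same_zeros v w" if "w \<in> S" for \<beta> w using x that by (auto simp: extremal_def)
  have y2: "\<exists>v. y \<beta> v = 1 \<and> same_zeros v w" if "w \<in> T" for \<beta> w using y that by (auto simp: extremal_def)
  have x3: "before \<beta> v w" if "x \<beta> v = 1" "w \<in> S" "same_zeros v w" for \<beta> v w using x that by (auto simp: extremal_def)
  have y3: "before \<beta> v w" if "y \<beta> v = 1" "w \<in> T" "same_zeros v w" for \<beta> v w using y that by (auto simp: extremal_def)
  have disj: False if wv: "w \<in> S" "v \<in> T" "same_zeros w v" "p < wdim w" for w v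
  proof -
    obtain f g where fg: "is_face f w" "is_face g v" "same_zeros f g" "wdim f = p" "\<not> before Minus f g"
      using separated_faces [of w v p Minus] wv by blast
    obtain u where u: "x Plus u = 1" "same_zeros u f" using x2 S fg wv by blast
    then have "y Minus u = 1" using eq same_zeros_wdim fg by metis
    then have "before Minus u g" using y3 T fg wv u same_zeros_trans by blast
    moreover have "before Plus u f" using x3 S fg wv u by blast
    then have "before Minus f u" using before_opp [of Minus u f] by simp
    ultimately show False using fg before_trans by blast
  qed
  have bool: "x \<beta> w = 0 \<or> x \<beta> w = 1" "y \<beta> w = 0 \<or> y \<beta> w = 1" for w \<beta>
    using x y by (auto simp: extremal_def)
  have excl: "x \<beta> w = 0 \<or> y \<beta> w = 0" if "p < wdim w" for w \<beta>
    using disj [of w w] bool [of \<beta> w] x1 [of \<beta> w] y1 [of \<beta> w] that by auto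
  have cmp1: "tcmp p x y \<beta> w = 1 \<longleftrightarrow> (if wdim w < p then x \<beta> w = 1 else if wdim w = p then
      (case \<beta> of Minus \<Rightarrow> x Minus w = 1 | Plus \<Rightarrow> y Plus w = 1) else x \<beta> w = 1 \<or> y \<beta> w = 1)" for \<beta> w
    using excl [of w \<beta>] bool [of \<beta> w] by (cases \<beta>) (auto simp: tcmp_def)
  show ?thesis
    unfolding extremal_def
  proof (intro conjI allI ballI impI)
    fix \<beta> w
    show "tcmp p x y \<beta> w = 0 \<or> tcmp p x y \<beta> w = 1"
      using excl [of w \<beta>] bool [of \<beta> w] by (cases \<beta>) (auto simp: tcmp_def)
  next
    fix \<beta> w assume "tcmp p x y \<beta> w = 1"
    then show "w \<in> S \<union> T" using x1 y1 unfolding cmp1 by (auto split: if_splits sign.splits)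
  next
    fix \<beta> w assume w: "w \<in> S \<union> T"
    consider "wdim w < p" | "wdim w = p" | "p < wdim w" by linarith
    then show "\<exists>v. tcmp p x y \<beta> v = 1 \<and> same_zeros v w"
    proof cases
      case 1
      then show ?thesis using w x2 [of w \<beta>] y2 [of w \<beta>] lo same_zeros_wdim unfolding cmp1 by (metis Un_iff)
    next
      case 2
      have "\<exists>v. x Plus v = 1 \<and> same_zeros v w"
        using w x2 [of w Plus] y2 [of w Minus] eq same_zeros_wdim 2 by (metis Un_iff)
      then obtain u where u: "x Plus u = 1" "y Minus u = 1" "same_zeros u w" using eq same_zeros_wdim 2 by metis
      have "\<exists>v. x Minus v = 1 \<and> same_zeros v w" "\<exists>v. y Plus v = 1 \<and> same_zeros v w"
        using x2 [OF x1 [OF u(1)]] y2 [OF y1 [OF u(2)]] same_zeros_trans u(3) by blast+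
      then show ?thesis using 2 same_zeros_wdim unfolding cmp1 by (cases \<beta>) fastforce+
    next
      case 3
      have "\<exists>v. (x \<beta> v = 1 \<or> y \<beta> v = 1) \<and> same_zeros v w" using w x2 [of w \<beta>] y2 [of w \<beta>] by blast
      then obtain v where "x \<beta> v = 1 \<or> y \<beta> v = 1" "same_zeros v w" by blast
      then show ?thesis
        using 3 same_zeros_wdim [of v w] unfolding cmp1 by (intro exI [of _ v]) simp
    qed
  next
    fix \<beta> v w assume w: "w \<in> S \<union> T" and v: "tcmp p x y \<beta> v = 1" and s: "same_zeros v w"
    have d: "wdim v = wdim w" using s by (rule same_zeros_wdim)
    consider "wdim w < p" | "wdim w = p" | "p < wdim w" by linarith
    then show "before \<beta> v w"
    proof cases
      case 1
      then have "x \<beta> v = 1" "y \<beta> v = 1" using v d lo unfolding cmp1 by auto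
      then show ?thesis using w x3 y3 s by blast
    next
      case 2
      show ?thesis
      proof (cases \<beta>)
        case Minus
        then have v': "x Minus v = 1" using v d 2 unfolding cmp1 by auto
        \<comment> \<open>\<open>u\<close> is the word of the common boundary with the given zeros:
          it follows \<open>v\<close> in \<open>S\<close> and precedes every word of
          \<open>T\<close> with these zeros.\<close>
        obtain u where u: "x Plus u = 1" "same_zeros u v" using x2 x1 v' by blast
        then have "y Minus u = 1" using eq same_zeros_wdim d 2 by metis
        have "before Minus v u" using x3 [OF v' x1 [OF u(1)]] u same_zeros_sym by blast
        moreover have "before Minus u w" if "w \<in> T"
          using y3 [OF \<open>y Minus u = 1\<close> that] u s same_zeros_trans by blast
        ultimately show ?thesis using w x3 [OF v'] s before_trans Minus by blast
      next
        case Plus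
        then have v': "y Plus v = 1" using v d 2 unfolding cmp1 by auto
        obtain u where u: "y Minus u = 1" "same_zeros u v" using y2 y1 v' by blast
        then have "x Plus u = 1" using eq same_zeros_wdim d 2 by metis
        have "before Plus v u" using y3 [OF v' y1 [OF u(1)]] u same_zeros_sym by blast
        moreover have "before Plus u w" if "w \<in> S"
          using x3 [OF \<open>x Plus u = 1\<close> that] u s same_zeros_trans by blast
        ultimately show ?thesis using w y3 [OF v'] s before_trans Plus by blast
      qed
    next
      case 3
      then have "x \<beta> v = 1 \<or> y \<beta> v = 1" using v d unfolding cmp1 by auto
      then show ?thesis
        using w x3 [of \<beta> v w] y3 [of \<beta> v w] s disj [of v w] disj [of w v] 3 d x1 y1 same_zeros_sym by auto
    qed
  qed
qed

text \<open>Only two degrees are delicate. For a word of degree p-1 the witness has degree p, where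
  the composite has the source of \<open>x\<close> and the target of \<open>y\<close>, so one
  witness is taken from each. In degree p, if the source of \<open>x\<close> and the target of
  \<open>y\<close> differ at \<open>w\<close>, one of the two factors already has different source
  and target there.\<close>

lemma tcmp_filled:
  assumes x: "extremal x S" "filled x" and y: "extremal y T" "filled y" and comp: "tcomposable p x y"
  shows "filled (tcmp p x y)"
  unfolding filled_def
proof (intro allI impI)
  fix \<alpha> \<beta> w assume a: "tcmp p x y \<alpha> w \<noteq> 0" "tcmp p x y (opp \<alpha>) w = 0"
  have lo: "x \<beta> w = y \<beta> w" if "wdim w < p" for \<beta> w using comp that by (auto simp: tcomposable_iff)
  have eq: "x Plus w = y Minus w" if "wdim w = p" for w using comp that by (auto simp: tcomposable_iff)
  have nonneg: "x \<beta> w \<ge> 0" "y \<beta> w \<ge> 0" for \<beta> w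
    using x y unfolding extremal_def by (metis order_refl zero_le_one)+
  have fx: "\<exists>v. x \<beta> v \<noteq> 0 \<and> is_face w v \<and> wdim v = Suc (wdim w)" if "x \<gamma> w \<noteq> 0" "x (opp \<gamma>) w = 0" for \<gamma> \<beta>
    using x that unfolding filled_def by blast
  have fy: "\<exists>v. y \<beta> v \<noteq> 0 \<and> is_face w v \<and> wdim v = Suc (wdim w)" if "y \<gamma> w \<noteq> 0" "y (opp \<gamma>) w = 0" for \<gamma> \<beta>
    using y that unfolding filled_def by blast
  have hi: "tcmp p x y \<beta> v \<noteq> 0" if "p < wdim v" "x \<beta> v \<noteq> 0 \<or> y \<beta> v \<noteq> 0" for v
    using that nonneg [of \<beta> v] by (auto simp: tcmp_def)
  consider "Suc (wdim w) < p" | "Suc (wdim w) = p" | "wdim w = p" | "p < wdim w" by linarith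
  then show "\<exists>v. tcmp p x y \<beta> v \<noteq> 0 \<and> is_face w v \<and> wdim v = Suc (wdim w)"
  proof cases
    case 1
    then have "x \<alpha> w \<noteq> 0" "x (opp \<alpha>) w = 0" using a by (auto simp: tcmp_def)
    then obtain v where "x \<beta> v \<noteq> 0" "is_face w v" "wdim v = Suc (wdim w)" using fx by blast
    then show ?thesis using 1 by (intro exI [of _ v]) (simp add: tcmp_def)
  next
    case 2
    then have "x \<alpha> w \<noteq> 0" "x (opp \<alpha>) w = 0" "y \<alpha> w \<noteq> 0" "y (opp \<alpha>) w = 0"
      using a lo [of w] by (auto simp: tcmp_def)
    then obtain v u where "x Minus v \<noteq> 0" "is_face w v" "wdim v = Suc (wdim w)"
      "y Plus u \<noteq> 0" "is_face w u" "wdim u = Suc (wdim w)"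
      using fx [of \<alpha> Minus] fy [of \<alpha> Plus] by blast
    then show ?thesis using 2
      by (cases \<beta>; intro exI [of _ "case \<beta> of Minus \<Rightarrow> v | Plus \<Rightarrow> u"]) (simp_all add: tcmp_def)
  next
    case 3
    have "(\<exists>\<gamma>. x \<gamma> w \<noteq> 0 \<and> x (opp \<gamma>) w = 0) \<or> (\<exists>\<gamma>. y \<gamma> w \<noteq> 0 \<and> y (opp \<gamma>) w = 0)"
    proof (cases \<alpha>)
      case Minus
      then have "x Minus w \<noteq> 0" "y Plus w = 0" using a 3 by (auto simp: tcmp_def)
      then show ?thesis using eq [OF 3] by (metis opp.simps)
    next
      case Plus
      then have "y Plus w \<noteq> 0" "x Minus w = 0" using a 3 by (auto simp: tcmp_def)
      then show ?thesis using eq [OF 3] by (metis opp.simps)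
    qed
    then obtain v where "x \<beta> v \<noteq> 0 \<or> y \<beta> v \<noteq> 0" "is_face w v" "wdim v = Suc (wdim w)" using fx fy by blast
    then show ?thesis using hi 3 by (metis lessI)
  next
    case 4
    then have "x \<alpha> w \<noteq> 0 \<and> x (opp \<alpha>) w = 0 \<or> y \<alpha> w \<noteq> 0 \<and> y (opp \<alpha>) w = 0"
      using a nonneg [of "opp \<alpha>" w] by (auto simp: tcmp_def)
    then obtain v where "x \<beta> v \<noteq> 0 \<or> y \<beta> v \<noteq> 0" "is_face w v" "wdim v = Suc (wdim w)" using fx fy by blast
    then show ?thesis using hi 4 by (metis less_Suc_eq)
  qed
qed

text \<open>The composite forgets the common boundary in degree p. A forgotten word on which source
  and target of \<open>x\<close> differ lies below a word of degree p+1, because \<open>x\<close> is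
  filled; and above p nothing cancels, all coefficients being nonnegative.\<close>

lemma shape_tcmp:
  assumes x: "extremal x S" "filled x" and y: "extremal y T" "filled y" and comp: "tcomposable p x y"
  shows "shape (tcmp p x y) = shape x \<union> shape y"
proof -
  have lo: "x \<beta> w = y \<beta> w" if "wdim w < p" for \<beta> w using comp that by (auto simp: tcomposable_iff)
  have eq: "x Plus w = y Minus w" if "wdim w = p" for w using comp that by (auto simp: tcomposable_iff)
  have nonneg: "x \<beta> w \<ge> 0" "y \<beta> w \<ge> 0" for \<beta> w
    using x y unfolding extremal_def by (metis order_refl zero_le_one)+
  have hi: "v \<in> supp (tcmp p x y)" if "p < wdim v" "x \<beta> v \<noteq> 0 \<or> y \<beta> v \<noteq> 0" for v \<beta>
  proof -
    have "tcmp p x y \<beta> v \<noteq> 0" using that nonneg [of \<beta> v] by (auto simp: tcmp_def)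
    then show ?thesis by (auto simp: supp_def)
  qed
  have "\<exists>v \<in> supp (tcmp p x y). is_face w v" if w: "w \<in> supp x \<union> supp y" for w
  proof -
    obtain \<beta> where \<beta>: "x \<beta> w \<noteq> 0 \<or> y \<beta> w \<noteq> 0" using w by (auto simp: supp_def)
    consider "wdim w < p" | "wdim w = p" | "p < wdim w" by linarith
    then show ?thesis
    proof cases
      case 1
      then have "tcmp p x y \<beta> w \<noteq> 0" using \<beta> lo by (auto simp: tcmp_def)
      then show ?thesis using is_face_refl by (auto simp: supp_def)
    next
      case 2
      show ?thesis
      proof (cases "x Minus w \<noteq> 0 \<or> y Plus w \<noteq> 0")
        case True
        then have "tcmp p x y Minus w \<noteq> 0 \<or> tcmp p x y Plus w \<noteq> 0" using 2 by (auto simp: tcmp_def)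
        then show ?thesis using is_face_refl unfolding supp_def by blast
      next
        case False
        then have "x Plus w \<noteq> 0" "x (opp Plus) w = 0" using \<beta> eq [OF 2] by (metis opp.simps sign.exhaust)+
        then obtain v where "x Plus v \<noteq> 0" "is_face w v" "wdim v = Suc (wdim w)" using x unfolding filled_def by blast
        then show ?thesis using hi 2 by (metis lessI)
      qed
    next
      case 3
      then show ?thesis using hi \<beta> is_face_refl by blast
    qed
  qed
  with supp_tcmp [of p x y] show ?thesis
    unfolding shape_def face_closure_Un [symmetric] using face_closure_mono face_closure_subset
    by (metis subset_antisym)
qed

lemma cells_extremal: "x \<in> cells n d \<Longrightarrow> extremal x (shape x) \<and> filled x"
proof (induction rule: cells.induct)
  case (atom k)
  then show ?case by (simp add: shape_atom atom_extremal atom_filled)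
next
  case (comp x y p)
  have "f \<in> shape z" if "w \<in> shape z" "is_face f w" for f w z
    using that is_face_trans unfolding shape_def face_closure_def by blast
  then have "extremal (tcmp p x y) (shape x \<union> shape y)"
    using comp.IH comp.hyps by (intro tcmp_extremal) blast+
  then show ?case
    using comp tcmp_filled [of x "shape x" y "shape y" p] shape_tcmp [of x "shape x" y "shape y" p] by simp
qed

lemma inj_on_shape: "inj_on shape (cells n d)"
  by (rule inj_onI) (metis cells_extremal extremal_unique)

section \<open>From tables to sets of faces\<close>

definition cell_ocat :: "nat \<Rightarrow> table ocat" where
  "cell_ocat n = \<lparr>elems = cells n n, bd = tbd, cmp = tcmp\<rparr>"

lemma cell_ocat_simps [simp]:
  "elems (cell_ocat n) = cells n n" "bd (cell_ocat n) = tbd" "cmp (cell_ocat n) = tcmp"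
  by (auto simp: cell_ocat_def)

lemma composable_cell_ocat:
  "composable (cell_ocat n) p x y \<longleftrightarrow> x \<in> cells n n \<and> y \<in> cells n n \<and> tcomposable p x y"
  by (simp add: composable_def)

lemma omega_category_cell_ocat: "omega_category (cell_ocat n)"
proof
  fix x \<alpha> p assume "x \<in> elems (cell_ocat n)"
  then show "bd (cell_ocat n) \<alpha> p x \<in> elems (cell_ocat n)"
    using tbd_cells [of x n n \<alpha> p] by (auto intro: cells_mono)
next
  fix x assume "x \<in> elems (cell_ocat n)"
  then show "\<exists>p. bd (cell_ocat n) Minus p x = x \<and> bd (cell_ocat n) Plus p x = x"
    by (intro exI [of _ n]) (auto simp: cells_tbd_ge)
next
  fix p x assume "x \<in> elems (cell_ocat n)"
  show "cmp (cell_ocat n) p (bd (cell_ocat n) Minus p x) x = x"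
    "cmp (cell_ocat n) p x (bd (cell_ocat n) Plus p x) = x"
    by (auto simp: tbd_def tcmp_def fun_eq_iff split: sign.splits)
next
  fix p x y z
  assume "composable (cell_ocat n) p x y" "composable (cell_ocat n) p y z"
  then show "cmp (cell_ocat n) p (cmp (cell_ocat n) p x y) z = cmp (cell_ocat n) p x (cmp (cell_ocat n) p y z)"
    by (auto simp: tcmp_def fun_eq_iff split: sign.splits)
next
  fix m p :: nat and x y z w
  assume "m \<noteq> p"
  then show "cmp (cell_ocat n) m (cmp (cell_ocat n) p x y) (cmp (cell_ocat n) p z w) =
       cmp (cell_ocat n) p (cmp (cell_ocat n) m x z) (cmp (cell_ocat n) m y w)"
    by (auto simp: tcmp_def fun_eq_iff split: sign.splits)
qed (auto simp: composable_cell_ocat tbd_tbd tbd_cmp tbd_Plus_cmp tbd_Minus_cmp cells.comp)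

text \<open>Transport of structure along an injection: the elements of I^n have to be sets of words,
  while the axioms are checked on tables.\<close>

definition image_ocat :: "('a \<Rightarrow> 'b) \<Rightarrow> 'a ocat \<Rightarrow> 'b ocat" where
  "image_ocat h C = \<lparr>elems = h ` elems C,
     bd = \<lambda>\<alpha> n x. h (bd C \<alpha> n (inv_into (elems C) h x)),
     cmp = \<lambda>n x y. h (cmp C n (inv_into (elems C) h x) (inv_into (elems C) h y))\<rparr>"

context
  fixes h :: "'a \<Rightarrow> 'b" and C :: "'a ocat"
  assumes C: "omega_category C" and h: "inj_on h (elems C)"
begin

lemma elems_image_ocat [simp]: "elems (image_ocat h C) = h ` elems C"
  by (simp add: image_ocat_def)

lemma bd_image_ocat [simp]: "x \<in> elems C \<Longrightarrow> bd (image_ocat h C) \<alpha> n (h x) = h (bd C \<alpha> n x)"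
  using h by (simp add: image_ocat_def)

lemma cmp_image_ocat [simp]:
  "x \<in> elems C \<Longrightarrow> y \<in> elems C \<Longrightarrow> cmp (image_ocat h C) n (h x) (h y) = h (cmp C n x y)"
  using h by (simp add: image_ocat_def)

lemma composable_image_ocat [simp]:
  "x \<in> elems C \<Longrightarrow> y \<in> elems C \<Longrightarrow> composable (image_ocat h C) n (h x) (h y) \<longleftrightarrow> composable C n x y"
  using h inj_on_eq_iff [OF h] omega_category.bd_closed [OF C] by (auto simp: composable_def)

lemma composable_image_ocatE:
  assumes "composable (image_ocat h C) n x y"
  obtains x' y' where "x = h x'" "y = h y'" "x' \<in> elems C" "y' \<in> elems C" "composable C n x' y'"
proof -
  have "x \<in> h ` elems C" "y \<in> h ` elems C" using assms by (auto simp: composable_def)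
  then show ?thesis using that assms composable_image_ocat by blast
qed

lemma omega_category_image_ocat: "omega_category (image_ocat h C)"
proof -
  interpret omega_category C by (rule C)
  have el: "x \<in> elems C" "y \<in> elems C" if "composable C n x y" for n x y
    using that by (auto simp: composable_def)
  note [simp] = bd_closed cmp_closed
  show ?thesis
  proof
    fix n x y z
    assume a: "composable (image_ocat h C) n x y" "composable (image_ocat h C) n (cmp (image_ocat h C) n x y) z"
      "composable (image_ocat h C) n y z" "composable (image_ocat h C) n x (cmp (image_ocat h C) n y z)"
    then have "x \<in> h ` elems C" "y \<in> h ` elems C" "z \<in> h ` elems C" by (simp_all add: composable_def)
    then obtain x' y' z' where "x = h x'" "y = h y'" "z = h z'" "x' \<in> elems C" "y' \<in> elems C" "z' \<in> elems C"
      by blast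
    with a show "cmp (image_ocat h C) n (cmp (image_ocat h C) n x y) z = cmp (image_ocat h C) n x (cmp (image_ocat h C) n y z)"
      by (simp add: assoc)
  next
    fix m n :: nat and x y z w
    assume a: "m \<noteq> n" "composable (image_ocat h C) n x y" "composable (image_ocat h C) n z w"
      "composable (image_ocat h C) m (cmp (image_ocat h C) n x y) (cmp (image_ocat h C) n z w)"
      "composable (image_ocat h C) m x z" "composable (image_ocat h C) m y w"
      "composable (image_ocat h C) n (cmp (image_ocat h C) m x z) (cmp (image_ocat h C) m y w)"
    then have "x \<in> h ` elems C" "y \<in> h ` elems C" "z \<in> h ` elems C" "w \<in> h ` elems C"
      by (simp_all add: composable_def)
    then obtain x' y' z' w' where "x = h x'" "y = h y'" "z = h z'" "w = h w'"
      "x' \<in> elems C" "y' \<in> elems C" "z' \<in> elems C" "w' \<in> elems C"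
      by blast
    with a show "cmp (image_ocat h C) m (cmp (image_ocat h C) n x y) (cmp (image_ocat h C) n z w) =
       cmp (image_ocat h C) n (cmp (image_ocat h C) m x z) (cmp (image_ocat h C) m y w)"
      by (simp add: interchange)
  next
    fix x assume "x \<in> elems (image_ocat h C)"
    then show "\<exists>n. bd (image_ocat h C) Minus n x = x \<and> bd (image_ocat h C) Plus n x = x"
      using finite_dim by (auto, metis)
  qed (auto elim!: composable_image_ocatE
      simp: bd_bd_less bd_bd_ge cmp_source cmp_target source_cmp target_cmp bd_cmp)
qed

lemma composites_image_ocat:
  assumes "elems C = composites C G" shows "h ` elems C = composites (image_ocat h C) (h ` G)"
proof
  interpret omega_category C by (rule C)
  have "x \<in> elems C \<and> h x \<in> composites (image_ocat h C) (h ` G)" if "x \<in> composites C G" for x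
    using that
  proof induction
    case (generator x)
    then show ?case using assms by (auto intro: composites.intros)
  next
    case (composite x y n)
    then show ?case
      using composites.composite [of "h x" "image_ocat h C" "h ` G" "h y" n] cmp_closed by auto
  qed
  then show "h ` elems C \<subseteq> composites (image_ocat h C) (h ` G)" using assms by auto
  have "x \<in> h ` elems C" if "x \<in> composites (image_ocat h C) (h ` G)" for x
    using that
  proof induction
    case (generator x)
    then show ?case using assms by (auto intro: composites.intros)
  next
    case (composite x y n)
    then show ?case
      by (metis elems_image_ocat omega_category.cmp_closed omega_category_image_ocat)
  qed
  then show "composites (image_ocat h C) (h ` G) \<subseteq> h ` elems C" by auto
qed

end

lemma facets_atom: "w \<in> facets \<alpha> k \<longleftrightarrow> Suc (wdim w) = wdim k \<and> atom k \<alpha> w \<noteq> 0"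
proof (induction \<alpha> k arbitrary: w rule: facets.induct)
  case (2 \<alpha> k)
  show ?case
  proof (cases w)
    case w: (Cons b w')
    show ?thesis
    proof (cases b)
      case Zero
      then show ?thesis using 2 [of w'] w by auto
    next
      case (Sgn s)
      then show ?thesis using w atom_top [of w' k \<alpha>] by auto
    qed
  qed auto
next
  case (3 \<alpha> c k)
  show ?case
  proof (cases w)
    case w: (Cons b w')
    then show ?thesis using 3 [of w'] by (cases b) auto
  qed auto
qed (auto simp: wdim_def)

text \<open>In I^n the source and target of a face are generated by facets alone. The boundary table
  of an atom also has entries of lower degree; these add nothing to the shape, since each lies in a
  facet of either sign.\<close>

lemma atom_in_facet:
  assumes "atom k \<beta> w \<noteq> 0" "Suc (Suc (wdim w)) \<le> wdim k"
  shows "\<exists>v \<in> facets \<alpha> k. is_face w v"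
  using assms
proof (induction k arbitrary: \<alpha> \<beta> w)
  case (Cons c k)
  show ?case
  proof (cases w)
    case w: (Cons b w')
    show ?thesis
    proof (cases c)
      case (Sgn a)
      then have "b = Sgn a" "atom k \<beta> w' \<noteq> 0" "Suc (Suc (wdim w')) \<le> wdim k"
        using Cons.prems w by (cases b; auto split: if_splits)+
      then show ?thesis using Cons.IH [of \<beta> w' \<alpha>] w Sgn by auto
    next
      case Zero
      show ?thesis
      proof (cases b)
        case b: Zero
        then have "atom k (opp \<beta>) w' \<noteq> 0" "Suc (Suc (wdim w')) \<le> wdim k"
          using Cons.prems w Zero by auto
        then obtain v where "v \<in> facets (opp \<alpha>) k" "is_face w' v" using Cons.IH by blast
        then show ?thesis using w Zero b by auto
      next
        case (Sgn s)
        then have s: "s = \<beta>" "atom k \<beta> w' \<noteq> 0" "Suc (wdim w') \<le> wdim k"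
          using Cons.prems w Zero by (auto split: if_splits)
        show ?thesis
        proof (cases "\<alpha> = \<beta>")
          case True
          then show ?thesis using w Zero Sgn s atom_is_face by auto
        next
          case False
          then have \<alpha>: "opp \<alpha> = \<beta>" by (metis neq_iff_opp opp_opp)
          have "\<exists>v \<in> facets (opp \<alpha>) k. is_face w' v"
          proof (cases "Suc (wdim w') = wdim k")
            case True
            then show ?thesis using facets_atom s \<alpha> is_face_refl by blast
          next
            case False
            then show ?thesis using Cons.IH s by auto
          qed
          then show ?thesis using w Zero Sgn by auto
        qed
      qed
    qed
  qed (use Cons.prems in \<open>cases c; simp\<close>)
qed auto

lemma shape_tbd_atom:
  assumes "1 \<le> wdim k"
  shows "shape (tbd \<alpha> (wdim k - 1) (atom k)) = face_closure (facets \<alpha> k)"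
proof -
  let ?S = "supp (tbd \<alpha> (wdim k - 1) (atom k))"
  have "facets \<alpha> k \<subseteq> ?S"
  proof
    fix w assume "w \<in> facets \<alpha> k"
    then have "wdim w = wdim k - 1" "atom k \<alpha> w \<noteq> 0" by (auto simp: facets_atom)
    then show "w \<in> ?S" by (auto simp: supp_def tbd_def)
  qed
  moreover have "\<exists>v \<in> facets \<alpha> k. is_face w v" if "w \<in> ?S" for w
  proof -
    obtain \<beta> where \<beta>: "tbd \<alpha> (wdim k - 1) (atom k) \<beta> w \<noteq> 0" using \<open>w \<in> ?S\<close> by (auto simp: supp_def)
    show ?thesis
    proof (cases "wdim w = wdim k - 1")
      case True
      then show ?thesis using \<beta> assms facets_atom is_face_refl by (metis Suc_pred' less_eq_Suc_le tbd_def less_irrefl One_nat_def)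
    next
      case False
      then have "atom k \<beta> w \<noteq> 0" "Suc (Suc (wdim w)) \<le> wdim k" using \<beta> by (auto simp: tbd_def split: if_splits)
      then show ?thesis by (rule atom_in_facet)
    qed
  qed
  ultimately show ?thesis
    unfolding shape_def by (metis face_closure_mono face_closure_subset subset_antisym)
qed

definition cube_model :: "nat \<Rightarrow> letter list set ocat" where
  "cube_model n = image_ocat shape (cell_ocat n)"

lemma wdim_words: "k \<in> words n \<Longrightarrow> wdim k \<le> n"
  using wdim_le_length by (auto simp: words_def)

lemma tbd_atom_iff: "tbd Minus p (atom k) = atom k \<longleftrightarrow> wdim k \<le> p"
proof
  assume "tbd Minus p (atom k) = atom k"
  then have "tbd Minus p (atom k) Minus k = 1" by (simp add: atom_top)
  then show "wdim k \<le> p" by (simp add: tbd_def split: if_splits)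
qed (simp add: tbd_atom)

lemma cells_supp: "x \<in> cells n d \<Longrightarrow> supp x \<subseteq> words n"
proof (induction rule: cells.induct)
  case (atom k)
  then show ?case using atom_is_face is_face_length by (auto simp: supp_def words_def)
next
  case (comp x y p)
  then show ?case using supp_tcmp [of p x y] by blast
qed

lemma is_cube_model: "is_cube_ocat n (cube_model n)"
proof -
  let ?C = "cell_ocat n"
  have C: "omega_category ?C" by (rule omega_category_cell_ocat)
  have inj: "inj_on shape (elems ?C)" by (simp add: cell_ocat_def inj_on_shape)
  have atoms: "atom k \<in> elems ?C" if "k \<in> words n" for k
    using that wdim_words by (auto simp: cell_ocat_def intro: cells.atom)
  have shape_R: "shape (atom k) = R {k}" for k
    by (auto simp: shape_atom R_eq_face_closure face_closure_def)
  note [simp] = elems_image_ocat [OF C inj] bd_image_ocat [OF C inj] cmp_image_ocat [OF C inj]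
    composable_image_ocat [OF C inj]
  have gen: "elems ?C = composites ?C (atom ` words n)"
  proof (intro subset_antisym subsetI)
    fix x assume "x \<in> elems ?C"
    then have "x \<in> cells n n" by simp
    then show "x \<in> composites ?C (atom ` words n)"
    proof (induction rule: cells.induct)
      case (comp x y p)
      then show ?case using composites.composite [of x ?C "atom ` words n" y p] by (simp add: composable_cell_ocat)
    qed (auto intro: composites.intros)
  next
    fix x assume "x \<in> composites ?C (atom ` words n)"
    then show "x \<in> elems ?C"
    proof induction
      case (composite x y p)
      then show ?case using omega_category.cmp_closed [OF C] by blast
    qed (use atoms in auto)
  qed
  show ?thesis
    unfolding is_cube_ocat_def cube_model_def
  proof (intro conjI ballI allI impI)
    show "omega_category (image_ocat shape ?C)" by (rule omega_category_image_ocat [OF C inj])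
    show "elems (image_ocat shape ?C) \<subseteq> R ` Pow (words n)"
      using cells_supp by (auto simp: shape_def R_eq_face_closure)
    show "elems (image_ocat shape ?C) = composites (image_ocat shape ?C) {R {x} |x. x \<in> words n}"
    proof -
      have "{R {x} |x. x \<in> words n} = shape ` atom ` words n" by (auto simp flip: shape_R)
      then show ?thesis using composites_image_ocat [OF C inj gen] by simp
    qed
  next
    fix k assume k: "k \<in> words n"
    have "odim (image_ocat shape ?C) (shape (atom k)) = wdim k"
      unfolding odim_def
    proof (rule Least_equality)
      show "bd (image_ocat shape ?C) Minus (wdim k) (shape (atom k)) = shape (atom k) \<and>
        bd (image_ocat shape ?C) Plus (wdim k) (shape (atom k)) = shape (atom k)"
        using atoms [OF k] by (simp add: tbd_atom del: cell_ocat_simps(1))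
    next
      fix p assume "bd (image_ocat shape ?C) Minus p (shape (atom k)) = shape (atom k) \<and>
        bd (image_ocat shape ?C) Plus p (shape (atom k)) = shape (atom k)"
      then have "shape (tbd Minus p (atom k)) = shape (atom k)" using atoms [OF k] by simp
      then have "tbd Minus p (atom k) = atom k"
        using inj_onD [OF inj] atoms [OF k] omega_category.bd_closed [OF C atoms [OF k], of Minus p] by simp
      then show "wdim k \<le> p" by (simp add: tbd_atom_iff)
    qed
    then show "R {k} \<in> n_morphisms (image_ocat shape ?C) (wdim k)"
      using atoms [OF k] by (simp add: n_morphisms_def flip: shape_R)
  next
    fix k \<alpha> assume k: "k \<in> words n" "1 \<le> wdim k"
    then show "bd (image_ocat shape ?C) \<alpha> (wdim k - 1) (R {k}) = R (faces_of_dim \<alpha> (wdim k - 1) k)"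
      unfolding shape_R [symmetric] faces_of_dim_facets [OF k(2)]
      using atoms [OF k(1)] shape_tbd_atom [OF k(2)]
      by (simp add: R_eq_face_closure del: One_nat_def)
  next
    fix X Y p assume "composable (image_ocat shape ?C) p (R X) (R Y)"
    then obtain x y where xy: "R X = shape x" "R Y = shape y" "x \<in> elems ?C" "y \<in> elems ?C" "composable ?C p x y"
      using composable_image_ocatE [OF C inj] by metis
    then have "shape (tcmp p x y) = shape x \<union> shape y"
      using cells_extremal [of x n n] cells_extremal [of y n n] shape_tcmp [of x "shape x" y "shape y" p]
      by (simp add: composable_cell_ocat)
    then show "cmp (image_ocat shape ?C) p (R X) (R Y) = R (X \<union> Y)"
      using xy by (simp add: R_eq_face_closure face_closure_Un)
  qed
qed

text \<open>From here on \<open>cube n\<close> is accessible only through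
  \<open>is_cube_ocat\<close>, and tables do not return.\<close>

lemma is_cube_ocat_cube: "is_cube_ocat n (cube n)"
  unfolding cube_def by (rule someI) (rule is_cube_model)

section \<open>Functors between cubes\<close>

context omega_category
begin

lemma bd_odim_le: "x \<in> elems C \<Longrightarrow> odim C x \<le> p \<Longrightarrow> bd C \<alpha> p x = x"
proof -
  assume x: "x \<in> elems C" and p: "odim C x \<le> p"
  have "bd C Minus (odim C x) x = x \<and> bd C Plus (odim C x) x = x"
    unfolding odim_def by (rule LeastI_ex) (rule finite_dim [OF x])
  then show ?thesis using bd_bd_ge [OF x p, of \<alpha>] by metis
qed

lemma odim_le_iff:
  assumes x: "x \<in> elems C"
  shows "odim C x \<le> p \<longleftrightarrow> bd C \<alpha> p x = x"
proof
  assume eq: "bd C \<alpha> p x = x"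
  have "bd C \<beta> p x = x" for \<beta> using bd_bd_ge [OF x order_refl, of \<beta> p \<alpha>] eq by simp
  then show "odim C x \<le> p" unfolding odim_def by (intro Least_le) auto
qed (use x bd_odim_le in auto)

lemma odim_bd: "x \<in> elems C \<Longrightarrow> odim C (bd C \<alpha> p x) \<le> p"
  using odim_le_iff [of "bd C \<alpha> p x" p \<alpha>] bd_closed bd_bd_ge by simp

lemma composable_bd:
  assumes "composable C n x y" "m \<noteq> n"
  shows "composable C n (bd C \<alpha> m x) (bd C \<alpha> m y)"
proof -
  have x: "x \<in> elems C" "y \<in> elems C" and eq: "bd C Plus n x = bd C Minus n y"
    using assms by (auto simp: composable_def)
  show ?thesis
  proof (cases "n < m")
    case True
    then show ?thesis using x eq by (simp add: composable_def bd_closed bd_bd_less)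
  next
    case False
    with assms have "m < n" by simp
    then have "bd C \<alpha> m x = bd C \<alpha> m y" using x eq bd_bd_less by metis
    then show ?thesis using x False by (simp add: composable_def bd_closed bd_bd_ge)
  qed
qed

end

lemma R_singleton: "w \<in> R {k} \<longleftrightarrow> is_face w k"
  by (simp add: R_eq_face_closure)

lemma R_Un: "R (X \<union> Y) = R X \<union> R Y"
  by (simp add: R_eq_face_closure face_closure_Un)

lemma R_idem [simp]: "R (R X) = R X"
  by (simp add: R_eq_face_closure)

lemma R_UN: "R X = (\<Union>k\<in>X. R {k})"
  by (auto simp: R_eq_face_closure face_closure_def)

lemma words_face: "is_face w k \<Longrightarrow> w \<in> words n \<longleftrightarrow> k \<in> words n"
  by (auto simp: words_def is_face_length)

lemma R_subset_words: "X \<subseteq> words n \<Longrightarrow> R X \<subseteq> words n"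
  using words_face by (auto simp: R_eq_face_closure face_closure_def)

lemma replicate_words [simp]: "replicate n c \<in> words n"
  by (simp add: words_def)

lemma omega_category_cube [simp]: "omega_category (cube n)"
  using is_cube_ocat_cube [of n] by (simp add: is_cube_ocat_def)

lemma cube_elem:
  assumes "A \<in> elems (cube n)" shows "A \<subseteq> words n" "R A = A"
proof -
  obtain X where "A = R X" "X \<subseteq> words n"
    using is_cube_ocat_cube [of n] assms by (auto simp: is_cube_ocat_def)
  then show "A \<subseteq> words n" "R A = A" using R_subset_words by auto
qed

lemma cube_elem_face: "A \<in> elems (cube n) \<Longrightarrow> k \<in> A \<Longrightarrow> is_face w k \<Longrightarrow> w \<in> A"
  using cube_elem(2) [of A n] by (auto simp: R_eq_face_closure face_closure_def)

lemma cube_generator: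
  assumes "k \<in> words n" shows "R {k} \<in> elems (cube n)" "odim (cube n) (R {k}) = wdim k"
  using is_cube_ocat_cube [of n] assms by (auto simp: is_cube_ocat_def n_morphisms_def)

lemma cube_bd_generator: "k \<in> words n \<Longrightarrow> wdim k \<le> p \<Longrightarrow> bd (cube n) \<alpha> p (R {k}) = R {k}"
  by (simp add: cube_generator omega_category.bd_odim_le)

lemma cube_bd_facets:
  assumes "k \<in> words n" "1 \<le> wdim k"
  shows "bd (cube n) \<alpha> (wdim k - 1) (R {k}) = R (facets \<alpha> k)"
  using is_cube_ocat_cube [of n] assms faces_of_dim_facets [OF assms(2)] by (auto simp: is_cube_ocat_def)

lemma cube_cmp: 
  assumes "composable (cube n) p A B" shows "cmp (cube n) p A B = A \<union> B"
proof -
  have "A \<in> elems (cube n)" "B \<in> elems (cube n)" using assms by (auto simp: composable_def)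
  then have "A \<subseteq> words n" "B \<subseteq> words n" "R A = A" "R B = B" using cube_elem by auto
  moreover have "\<forall>X Y p. X \<subseteq> words n \<longrightarrow> Y \<subseteq> words n \<longrightarrow> composable (cube n) p (R X) (R Y) \<longrightarrow>
        cmp (cube n) p (R X) (R Y) = R (X \<union> Y)"
    using is_cube_ocat_cube [of n] by (simp add: is_cube_ocat_def)
  ultimately show ?thesis using assms R_Un by metis
qed

lemma cube_induct [consumes 1, case_names generator composite]:
  assumes "A \<in> elems (cube n)"
    and gen: "\<And>k. k \<in> words n \<Longrightarrow> P (R {k})"
    and comp: "\<And>A B p. P A \<Longrightarrow> P B \<Longrightarrow> composable (cube n) p A B \<Longrightarrow> P (A \<union> B)"
  shows "P A"
proof -
  have "A \<in> composites (cube n) {R {x} | x. x \<in> words n}"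
    using assms(1) is_cube_ocat_cube [of n] by (simp add: is_cube_ocat_def)
  then show ?thesis
  proof induction
    case (composite A B p)
    then show ?case using comp cube_cmp by metis
  qed (use gen in auto)
qed

lemma cube_bd_low:
  assumes "A \<in> elems (cube n)" "\<And>k. k \<in> A \<Longrightarrow> wdim k \<le> p"
  shows "bd (cube n) \<alpha> p A = A"
  using assms
proof (induction arbitrary: \<alpha> rule: cube_induct)
  case (generator k)
  then show ?case using cube_bd_generator is_face_refl by (metis R_singleton)
next
  case (composite A B q)
  then have AB: "bd (cube n) \<alpha> p A = A" "bd (cube n) \<alpha> p B = B" for \<alpha> by blast+
  show ?case
  proof (cases "q = p")
    case True
    then have "A = B" using composite.hyps AB by (metis composable_def)
    then show ?thesis using AB by simp
  next
    case False
    then show ?thesis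
      using omega_category.bd_cmp [OF omega_category_cube composite.hyps, of p \<alpha>] AB cube_cmp [OF composite.hyps]
      by simp
  qed
qed

text \<open>Composition is union, so the unit laws s_p A *_p A = A = A *_p t_p A say precisely that
  the boundaries are contained in A.\<close>

lemma cube_bd_subset:
  assumes "A \<in> elems (cube n)" shows "bd (cube n) \<alpha> p A \<subseteq> A"
proof -
  interpret omega_category "cube n" by simp
  have "composable (cube n) p (bd (cube n) Minus p A) A" "composable (cube n) p A (bd (cube n) Plus p A)"
    using assms by (auto simp: composable_def bd_closed bd_bd_ge)
  from cube_cmp [OF this(1)] cube_cmp [OF this(2)] show ?thesis
    using cmp_source [OF assms, of p] cmp_target [OF assms, of p] by (cases \<alpha>) auto
qed

text \<open>A map of words whose direct image is an omega-functor. The last condition is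
  compatibility with boundaries on generators: if the dimension drops, the image is its own source
  and target, so the images of the facets must generate all of it.\<close>

definition cube_map :: "nat \<Rightarrow> nat \<Rightarrow> (letter list \<Rightarrow> letter list) \<Rightarrow> bool" where
  "cube_map m n \<phi> \<longleftrightarrow> (\<forall>k \<in> words m. \<phi> k \<in> words n \<and> \<phi> ` R {k} = R {\<phi> k} \<and> wdim (\<phi> k) \<le> wdim k \<and>
     (\<forall>\<alpha>. 1 \<le> wdim k \<longrightarrow> R (\<phi> ` facets \<alpha> k) = (if wdim (\<phi> k) < wdim k then R {\<phi> k} else R (facets \<alpha> (\<phi> k)))))"

lemma cube_mapD:
  assumes "cube_map m n \<phi>" "k \<in> words m"
  shows "\<phi> k \<in> words n" "\<phi> ` R {k} = R {\<phi> k}" "wdim (\<phi> k) \<le> wdim k"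
    "1 \<le> wdim k \<Longrightarrow> R (\<phi> ` facets \<alpha> k) = (if wdim (\<phi> k) < wdim k then R {\<phi> k} else R (facets \<alpha> (\<phi> k)))"
  using assms by (simp_all add: cube_map_def)

lemma cube_map_image_R:
  assumes "cube_map m n \<phi>" "X \<subseteq> words m" shows "\<phi> ` R X = R (\<phi> ` X)"
proof -
  have im: "\<phi> ` R {k} = R {\<phi> k}" if "k \<in> X" for k
    using cube_mapD(2) [OF assms(1)] assms(2) that by (meson subsetD)
  have "\<phi> ` R X = (\<Union>k\<in>X. \<phi> ` R {k})" by (subst R_UN) blast
  also have "\<dots> = (\<Union>k\<in>X. R {\<phi> k})" by (simp add: im)
  also have "\<dots> = R (\<phi> ` X)" by (subst (2) R_UN) simp
  finally show ?thesis .
qed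

lemma facets_words: "k \<in> words n \<Longrightarrow> facets \<alpha> k \<subseteq> words n"
  using facets_is_face words_face by blast

text \<open>I^n prescribes only the boundaries of codimension one of a face. Lower ones are
  boundaries of its source, which is a general element; therefore the induction on dimension runs
  over all elements, with an inner induction on composites.\<close>

lemma cube_map_bd:
  assumes \<phi>: "cube_map m n \<phi>" and "A \<in> elems (cube m)"
  shows "\<phi> ` A \<in> elems (cube n) \<and> (\<forall>\<alpha> p. bd (cube n) \<alpha> p (\<phi> ` A) = \<phi> ` bd (cube m) \<alpha> p A)"
proof -
  interpret M: omega_category "cube m" by simp
  interpret N: omega_category "cube n" by simp
  have "(\<forall>k\<in>A. wdim k \<le> d) \<Longrightarrow>
    \<phi> ` A \<in> elems (cube n) \<and> (\<forall>\<alpha> p. bd (cube n) \<alpha> p (\<phi> ` A) = \<phi> ` bd (cube m) \<alpha> p A)" for d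
    using assms(2)
  proof (induction d arbitrary: A rule: less_induct)
    case (less d)
    show ?case using less.prems(2,1)
    proof (induction rule: cube_induct)
      case (generator k)
      have \<phi>k: "\<phi> k \<in> words n" "\<phi> ` R {k} = R {\<phi> k}" "wdim (\<phi> k) \<le> wdim k"
        using \<phi> generator by (auto simp: cube_map_def)
      have top: "bd (cube n) \<alpha> (wdim k - 1) (\<phi> ` R {k}) = \<phi> ` bd (cube m) \<alpha> (wdim k - 1) (R {k})"
        if k: "1 \<le> wdim k" for \<alpha>
      proof -
        have "\<phi> ` bd (cube m) \<alpha> (wdim k - 1) (R {k}) = R (\<phi> ` facets \<alpha> k)"
          using cube_bd_facets [OF generator(1) k] cube_map_image_R [OF \<phi> facets_words] generator by simp
        also have "\<dots> = (if wdim (\<phi> k) < wdim k then R {\<phi> k} else R (facets \<alpha> (\<phi> k)))"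
          using \<phi> k generator by (auto simp: cube_map_def)
        also have "\<dots> = bd (cube n) \<alpha> (wdim k - 1) (R {\<phi> k})"
          using cube_bd_facets [OF \<phi>k(1)] cube_bd_generator [OF \<phi>k(1), of "wdim k - 1" \<alpha>] \<phi>k(3) k by auto
        finally show ?thesis using \<phi>k by simp
      qed
      have "bd (cube n) \<alpha> p (\<phi> ` R {k}) = \<phi> ` bd (cube m) \<alpha> p (R {k})" for \<alpha> p
      proof -
        consider "wdim k \<le> p" | "1 \<le> wdim k" "p = wdim k - 1" | "p < wdim k - 1" by linarith
        then show ?thesis
        proof cases
          case 1
          then show ?thesis using \<phi>k generator by (simp add: cube_bd_generator)
        next
          case 2
          then show ?thesis using top by simp
        next
          case 3
          let ?E = "bd (cube m) Minus (wdim k - 1) (R {k})"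
          have E: "?E \<in> elems (cube m)" by (simp add: M.bd_closed cube_generator generator)
          have "wdim w \<le> wdim k - 1" if "w \<in> ?E" for w
          proof -
            have "w \<in> R (facets Minus k)" using that cube_bd_facets [of k m Minus] generator 3 by simp
            then show ?thesis using is_face_wdim facets_wdim unfolding R_eq_face_closure face_closure_def by fastforce
          qed
          moreover have "wdim k - 1 < d"
            using generator(2) R.base [of k "{k}"] 3 by fastforce
          ultimately have IH: "bd (cube n) \<alpha> p (\<phi> ` ?E) = \<phi> ` bd (cube m) \<alpha> p ?E"
            using less.IH [of "wdim k - 1" ?E] E by blast
          have "bd (cube n) \<alpha> p (\<phi> ` R {k}) = bd (cube n) \<alpha> p (bd (cube n) Minus (wdim k - 1) (\<phi> ` R {k}))"
            using 3 \<phi>k by (simp add: N.bd_bd_less cube_generator)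
          also have "\<dots> = bd (cube n) \<alpha> p (\<phi> ` ?E)" using top 3 by simp
          also have "\<dots> = \<phi> ` bd (cube m) \<alpha> p (R {k})" using IH 3 generator by (simp add: M.bd_bd_less cube_generator)
          finally show ?thesis .
        qed
      qed
      then show ?case using \<phi>k by (simp add: cube_generator)
    next
      case (composite A B r)
      then have IA: "\<phi> ` A \<in> elems (cube n)" "\<And>\<alpha> p. bd (cube n) \<alpha> p (\<phi> ` A) = \<phi> ` bd (cube m) \<alpha> p A"
        and IB: "\<phi> ` B \<in> elems (cube n)" "\<And>\<alpha> p. bd (cube n) \<alpha> p (\<phi> ` B) = \<phi> ` bd (cube m) \<alpha> p B"
        by blast+
      have AB: "composable (cube n) r (\<phi> ` A) (\<phi> ` B)"
        using IA IB composite.hyps by (simp add: composable_def)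
      have cmp: "cmp (cube n) r (\<phi> ` A) (\<phi> ` B) = \<phi> ` (A \<union> B)" "cmp (cube m) r A B = A \<union> B"
        using cube_cmp [OF AB] cube_cmp [OF composite.hyps] by (auto simp: image_Un)
      have "bd (cube n) \<alpha> p (\<phi> ` (A \<union> B)) = \<phi> ` bd (cube m) \<alpha> p (A \<union> B)" for \<alpha> p
      proof (cases "p = r")
        case True
        then show ?thesis
          using N.source_cmp [OF AB] N.target_cmp [OF AB] M.source_cmp [OF composite.hyps] M.target_cmp [OF composite.hyps]
            IA IB cmp by (cases \<alpha>) auto
      next
        case False
        then show ?thesis
          using N.bd_cmp [OF AB False, of \<alpha>] M.bd_cmp [OF composite.hyps False, of \<alpha>] IA IB cmp
            cube_cmp [OF N.composable_bd [OF AB False, of \<alpha>]] cube_cmp [OF M.composable_bd [OF composite.hyps False, of \<alpha>]]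
          by (auto simp: image_Un)
      qed
      then show ?case using N.cmp_closed [OF AB] cmp by simp
    qed
  qed
  moreover have "\<forall>k\<in>A. wdim k \<le> m" using cube_elem(1) [OF assms(2)] wdim_words by auto
  ultimately show ?thesis by blast
qed

lemma omega_functor_cube_map:
  assumes "cube_map m n \<phi>" shows "omega_functor (cube m) (cube n) ((`) \<phi>)"
  unfolding omega_functor_def
proof (intro conjI ballI allI impI)
  fix r A B assume AB: "composable (cube m) r A B"
  then have "composable (cube n) r (\<phi> ` A) (\<phi> ` B)"
    using cube_map_bd [OF assms] by (simp add: composable_def)
  then show "\<phi> ` cmp (cube m) r A B = cmp (cube n) r (\<phi> ` A) (\<phi> ` B)"
    using cube_cmp AB by (simp add: image_Un)
qed (use cube_map_bd [OF assms] in auto)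

section \<open>Faces, degeneracies and projections of cubes\<close>

lemma cube_map_cong:
  assumes "\<And>k. k \<in> words m \<Longrightarrow> \<phi> k = \<psi> k" shows "cube_map m n \<phi> \<longleftrightarrow> cube_map m n \<psi>"
proof -
  have "\<phi> ` X = \<psi> ` X" if "X \<subseteq> words m" for X using assms that by (intro image_cong) auto
  moreover have "R {k} \<subseteq> words m" "facets \<alpha> k \<subseteq> words m" if "k \<in> words m" for k \<alpha>
    using that words_face facets_words by (auto simp: R_singleton)
  ultimately show ?thesis using assms unfolding cube_map_def by simp
qed

lemma R_Cons_Zero: "R ((#) Zero ` X) = (\<Union>c. (#) c ` R X)"
  by (auto simp: R_eq_face_closure face_closure_def is_face_Cons)

lemma R_Cons_Sgn: "R ((#) (Sgn a) ` X) = (#) (Sgn a) ` R X"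
  by (auto simp: R_eq_face_closure face_closure_def is_face_Cons)

lemma R_empty [simp]: "R {} = {}"
  by (simp add: R_eq_face_closure face_closure_def)

lemma R_insert: "R (insert k X) = R {k} \<union> R X"
  using R_Un [of "{k}" X] by simp

lemma R_singleton_Zero: "R {Zero # k} = (\<Union>c. (#) c ` R {k})"
  using R_Cons_Zero [of "{k}"] by simp

lemma R_singleton_Sgn: "R {Sgn a # k} = (#) (Sgn a) ` R {k}"
  using R_Cons_Sgn [of a "{k}"] by simp

lemma facets_subset_R: "facets \<alpha> k \<subseteq> R {k}"
  using facets_is_face by (auto simp: R_singleton)

lemma cube_map_id: "cube_map n n (\<lambda>k. k)"
  by (simp add: cube_map_def)

lemma cube_map_Sgn:
  assumes "cube_map m n \<phi>" shows "cube_map m (Suc n) (\<lambda>k. Sgn a # \<phi> k)"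
proof -
  have "(\<lambda>k. Sgn a # \<phi> k) ` X = (#) (Sgn a) ` \<phi> ` X" for X by auto
  then show ?thesis
    using assms by (auto simp: cube_map_def R_singleton_Sgn R_Cons_Sgn)
qed

lemma facets_dim0: "wdim k = 0 \<Longrightarrow> facets \<alpha> k = {}"
  using facets_wdim by fastforce

lemma cube_map_tl:
  assumes "cube_map m n \<phi>" shows "cube_map (Suc m) n (\<lambda>k. \<phi> (tl k))"
  unfolding cube_map_def
proof (intro ballI conjI allI impI)
  fix k assume "k \<in> words (Suc m)"
  then obtain c k' where k: "k = c # k'" "k' \<in> words m" by (auto elim: words_Suc_cases)
  have \<phi>: "\<phi> k' \<in> words n" "\<phi> ` R {k'} = R {\<phi> k'}" "wdim (\<phi> k') \<le> wdim k'"
    using assms k by (auto simp: cube_map_def)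
  show "\<phi> (tl k) \<in> words n" "wdim (\<phi> (tl k)) \<le> wdim k" using \<phi> k by (cases c; simp)+
  have im: "(\<lambda>k. \<phi> (tl k)) ` X = \<phi> ` tl ` X" for X by auto
  have tl_R: "tl ` R {k} = R {k'}"
    using k by (cases c) (auto simp: R_singleton_Zero R_singleton_Sgn image_UN image_image)
  then show "(\<lambda>k. \<phi> (tl k)) ` R {k} = R {\<phi> (tl k)}" unfolding im using \<phi> k by simp
  fix \<alpha> assume "1 \<le> wdim k"
  show "R ((\<lambda>k. \<phi> (tl k)) ` facets \<alpha> k) =
      (if wdim (\<phi> (tl k)) < wdim k then R {\<phi> (tl k)} else R (facets \<alpha> (\<phi> (tl k))))"
  proof (cases c)
    \<comment> \<open>The facet with a sign in front projects onto all of \<open>k'\<close> and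
      absorbs the images of the others.\<close>
    case Zero
    have "\<phi> ` facets (opp \<alpha>) k' \<subseteq> R {\<phi> k'}" using image_mono [OF facets_subset_R, of \<phi> "opp \<alpha>" k'] \<phi>(2) by simp
    then have "R (\<phi> ` facets (opp \<alpha>) k') \<subseteq> R {\<phi> k'}"
      using is_face_trans by (fastforce simp: R_eq_face_closure face_closure_def)
    moreover have "tl ` facets \<alpha> k = insert k' (facets (opp \<alpha>) k')" using Zero k by (auto simp: image_image)
    ultimately show ?thesis
      unfolding im using \<phi>(3) k Zero by (simp add: R_insert [of _ "\<phi> ` _"] Un_absorb2)
  next
    case (Sgn a)
    have "tl ` facets \<alpha> k = facets \<alpha> k'" using Sgn k by (auto simp: image_image)
    then show ?thesis unfolding im using assms k Sgn \<open>1 \<le> wdim k\<close> by (simp add: cube_map_def)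
  qed
qed

lemma cube_map_Cons:
  assumes "cube_map m n \<phi>" shows "cube_map (Suc m) (Suc n) (\<lambda>k. hd k # \<phi> (tl k))"
  unfolding cube_map_def
proof (intro ballI conjI allI impI)
  fix k assume "k \<in> words (Suc m)"
  then obtain c k' where k: "k = c # k'" "k' \<in> words m" by (auto elim: words_Suc_cases)
  have \<phi>: "\<phi> k' \<in> words n" "\<phi> ` R {k'} = R {\<phi> k'}" "wdim (\<phi> k') \<le> wdim k'"
    using assms k by (auto simp: cube_map_def)
  let ?\<psi> = "\<lambda>k. hd k # \<phi> (tl k)"
  have im: "?\<psi> ` (#) c ` X = (#) c ` \<phi> ` X" for c X by (auto simp: image_image)
  show "?\<psi> k \<in> words (Suc n)" "wdim (?\<psi> k) \<le> wdim k" using \<phi> k by (cases c; simp)+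
  show "?\<psi> ` R {k} = R {?\<psi> k}"
  proof (cases c)
    case Zero
    then show ?thesis unfolding k(1) by (simp only: R_singleton_Zero image_UN im list.sel \<phi>(2))
  next
    case (Sgn a)
    then show ?thesis unfolding k(1) by (simp only: R_singleton_Sgn im list.sel \<phi>(2))
  qed
  fix \<alpha> assume 1: "1 \<le> wdim k"
  show "R (?\<psi> ` facets \<alpha> k) = (if wdim (?\<psi> k) < wdim k then R {?\<psi> k} else R (facets \<alpha> (?\<psi> k)))"
  proof (cases c)
    case Zero
    have "?\<psi> ` facets \<alpha> k = insert (Sgn \<alpha> # \<phi> k') ((#) Zero ` \<phi> ` facets (opp \<alpha>) k')"
      unfolding k(1) Zero facets.simps image_insert im by simp
    then have f: "R (?\<psi> ` facets \<alpha> k) = R {Sgn \<alpha> # \<phi> k'} \<union> R ((#) Zero ` \<phi> ` facets (opp \<alpha>) k')"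
      by (simp only:) (rule R_insert)
    show ?thesis
    proof (cases "wdim k' = 0")
      case True
      then have "wdim (\<phi> k') = 0" using \<phi>(3) by simp
      then show ?thesis unfolding f using True by (simp add: k(1) Zero facets_dim0)
    next
      case False
      then have "R (\<phi> ` facets (opp \<alpha>) k') = (if wdim (\<phi> k') < wdim k' then R {\<phi> k'} else R (facets (opp \<alpha>) (\<phi> k')))"
        using assms k by (simp add: cube_map_def)
      then consider "wdim (\<phi> k') < wdim k'" "R (\<phi> ` facets (opp \<alpha>) k') = R {\<phi> k'}"
        | "wdim (\<phi> k') = wdim k'" "R (\<phi> ` facets (opp \<alpha>) k') = R (facets (opp \<alpha>) (\<phi> k'))"
        using \<phi>(3) by (auto split: if_splits)
      then show ?thesis
      proof cases
        case 1
        then have "R (?\<psi> ` facets \<alpha> k) = R {Sgn \<alpha> # \<phi> k'} \<union> R {Zero # \<phi> k'}"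
          unfolding f by (simp add: R_Cons_Zero R_singleton_Zero)
        moreover have "R {Sgn \<alpha> # \<phi> k'} \<subseteq> R {Zero # \<phi> k'}"
          unfolding R_singleton_Zero R_singleton_Sgn by blast
        ultimately show ?thesis using 1 k Zero by (simp add: Un_absorb1)
      next
        case 2
        then show ?thesis unfolding f using k Zero by (simp add: R_insert [of _ "_ ` _"] R_Cons_Zero)
      qed
    qed
  next
    case (Sgn a)
    then have "R (\<phi> ` facets \<alpha> k') = (if wdim (\<phi> k') < wdim k' then R {\<phi> k'} else R (facets \<alpha> (\<phi> k')))"
      using assms k 1 by (simp add: cube_map_def)
    moreover have "?\<psi> ` facets \<alpha> k = (#) (Sgn a) ` \<phi> ` facets \<alpha> k'"
      unfolding k(1) Sgn facets.simps im ..
    ultimately show ?thesis using k Sgn by (simp add: R_Cons_Sgn R_singleton_Sgn)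
  qed
qed

lemma insert_letter_simps [simp]:
  "insert_letter (Suc 0) c k = c # k"
  "insert_letter (Suc (Suc i)) c (a # k) = a # insert_letter (Suc i) c k"
  by (auto simp: insert_letter_def)

lemma delete_letter_simps [simp]:
  "delete_letter (Suc 0) k = tl k"
  "delete_letter (Suc (Suc i)) (a # k) = a # delete_letter (Suc i) k"
  by (auto simp: delete_letter_def drop_Suc)

lemma cube_map_insert_letter:
  "i \<in> {1..Suc m} \<Longrightarrow> cube_map m (Suc m) (insert_letter i (Sgn a))"
proof (induction m arbitrary: i)
  case 0
  then show ?case using cube_map_Sgn [OF cube_map_id] by simp
next
  case (Suc m)
  show ?case
  proof (cases "i = 1")
    case True
    then show ?thesis using cube_map_Sgn [OF cube_map_id] by simp
  next
    case False
    then obtain j where j: "i = Suc (Suc j)" using Suc.prems by (cases i; cases "i - 1") auto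
    then have "cube_map (Suc m) (Suc (Suc m)) (\<lambda>k. hd k # insert_letter (Suc j) (Sgn a) (tl k))"
      using Suc by (intro cube_map_Cons) auto
    then show ?thesis by (rule cube_map_cong [THEN iffD1, rotated]) (auto simp: j elim: words_Suc_cases)
  qed
qed

lemma cube_map_delete_letter:
  "i \<in> {1..Suc m} \<Longrightarrow> cube_map (Suc m) m (delete_letter i)"
proof (induction m arbitrary: i)
  case 0
  then show ?case using cube_map_tl [OF cube_map_id] by simp
next
  case (Suc m)
  show ?case
  proof (cases "i = 1")
    case True
    then show ?thesis using cube_map_tl [OF cube_map_id] by simp
  next
    case False
    then obtain j where j: "i = Suc (Suc j)" using Suc.prems by (cases i; cases "i - 1") auto
    then have "cube_map (Suc (Suc m)) (Suc m) (\<lambda>k. hd k # delete_letter (Suc j) (tl k))"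
      using Suc by (intro cube_map_Cons) auto
    then show ?thesis by (rule cube_map_cong [THEN iffD1, rotated]) (auto simp: j elim: words_Suc_cases)
  qed
qed

text \<open>Forgetting the coordinates in which \<open>k\<close> has a sign turns \<open>k\<close>
  into the top face of a smaller cube, and every element containing \<open>k\<close> into that whole
  cube.\<close>

lemma cube_map_projection:
  "\<exists>\<phi>. cube_map (length k) (wdim k) \<phi> \<and> \<phi> k = replicate (wdim k) Zero"
proof (induction k)
  case Nil
  then show ?case using cube_map_id [of 0] by auto
next
  case (Cons c k)
  then obtain \<phi> where \<phi>: "cube_map (length k) (wdim k) \<phi>" "\<phi> k = replicate (wdim k) Zero" by blast
  show ?case
  proof (cases c)
    case Zero
    then show ?thesis using cube_map_Cons [OF \<phi>(1)] \<phi>(2) by (intro exI [of _ "\<lambda>k. hd k # \<phi> (tl k)"]) auto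
  next
    case (Sgn a)
    then show ?thesis using cube_map_tl [OF \<phi>(1)] \<phi>(2) by (intro exI [of _ "\<lambda>k. \<phi> (tl k)"]) auto
  qed
qed

section \<open>Dimension arguments by projection to the top cell\<close>

lemma R_top: "R {replicate n Zero} = words n"
  by (auto simp: R_singleton words_def)

lemma cube_elem_top: "A \<in> elems (cube n) \<Longrightarrow> replicate n Zero \<in> A \<Longrightarrow> A = words n"
  using cube_elem(1) cube_elem_face [of A n "replicate n Zero"] by (auto simp: words_def)

lemma words_elem [simp]: "words n \<in> elems (cube n)"
  using cube_generator(1) [of "replicate n Zero" n] by (simp add: R_top)

lemma odim_words: "odim (cube n) (words n) = n"
  using cube_generator(2) [of "replicate n Zero" n] by (simp add: R_top)

lemma cube_projection:
  assumes "k \<in> words n"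
  obtains \<phi> where "omega_functor (cube n) (cube (wdim k)) \<phi>"
    "\<And>A. A \<in> elems (cube n) \<Longrightarrow> k \<in> A \<Longrightarrow> \<phi> A = words (wdim k)"
proof -
  obtain \<phi> where \<phi>: "cube_map n (wdim k) \<phi>" "\<phi> k = replicate (wdim k) Zero"
    using cube_map_projection [of k] assms by (auto simp: words_def)
  have "\<phi> ` A = words (wdim k)" if "A \<in> elems (cube n)" "k \<in> A" for A
    using that \<phi> cube_map_bd [OF \<phi>(1), of A] by (metis cube_elem_top imageI)
  then show ?thesis using that omega_functor_cube_map [OF \<phi>(1)] by blast
qed

text \<open>Projecting along \<open>k\<close> sends the boundary to the whole cube of dimension
  \<open>wdim k\<close>; being a p-boundary, that cube has dimension at most p.\<close>

lemma cube_bd_wdim: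
  assumes "A \<in> elems (cube n)" "k \<in> bd (cube n) \<alpha> p A" shows "wdim k \<le> p"
proof -
  interpret omega_category "cube n" by simp
  interpret K: omega_category "cube (wdim k)" by simp
  have B: "bd (cube n) \<alpha> p A \<in> elems (cube n)" using assms bd_closed by blast
  then have "k \<in> words n" using assms cube_elem by blast
  then obtain \<phi> where \<phi>: "omega_functor (cube n) (cube (wdim k)) \<phi>"
    "\<And>A. A \<in> elems (cube n) \<Longrightarrow> k \<in> A \<Longrightarrow> \<phi> A = words (wdim k)" using cube_projection by blast
  have "words (wdim k) = bd (cube (wdim k)) \<alpha> p (\<phi> A)" "\<phi> A \<in> elems (cube (wdim k))"
    using \<phi>(2) [OF B assms(2)] \<phi>(1) assms(1) by (auto simp: omega_functor_def)
  then show ?thesis using K.odim_bd odim_words by metis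
qed

lemma exists_face: 
  assumes "p \<le> wdim k" obtains f where "is_face f k" "wdim f = p"
  using assms separated_faces [of k k p] is_face_refl same_zeros_refl by (metis le_neq_implies_less)

lemma cube_bd_distinct: "bd (cube (Suc p)) Plus p (words (Suc p)) \<noteq> bd (cube (Suc p)) Minus p (words (Suc p))"
proof
  let ?z = "replicate (Suc p) Zero"
  have bd: "bd (cube (Suc p)) \<alpha> p (words (Suc p)) = R (facets \<alpha> ?z)" for \<alpha>
    using cube_bd_facets [of ?z "Suc p" \<alpha>] R_top [of "Suc p"] by simp
  assume "bd (cube (Suc p)) Plus p (words (Suc p)) = bd (cube (Suc p)) Minus p (words (Suc p))"
  then have "Sgn Minus # replicate p Zero \<in> R (facets Plus ?z)"
    unfolding bd using R.base [of "Sgn Minus # replicate p Zero" "facets Minus ?z"] by simp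
  then obtain v where v: "v \<in> facets Plus ?z" "is_face (Sgn Minus # replicate p Zero) v"
    unfolding R_eq_face_closure face_closure_def by blast
  then have "v = Sgn Minus # replicate p Zero"
    using facets_wdim [OF v(1)] is_face_wdim_eq [OF v(2)] by simp
  then show False using v(1) by auto
qed

text \<open>A common face of dimension above p has a common face of dimension p+1. Projecting along
  it sends both factors to the whole (p+1)-cube, whose p-source and p-target would then
  coincide.\<close>

lemma cube_composable_disjoint:
  assumes AB: "composable (cube n) p A B" and k: "k \<in> A" "k \<in> B"
  shows "wdim k \<le> p"
proof (rule ccontr)
  assume "\<not> wdim k \<le> p"
  then obtain f where f: "is_face f k" "wdim f = Suc p" using exists_face by (metis not_less_eq_eq)
  have el: "A \<in> elems (cube n)" "B \<in> elems (cube n)" "bd (cube n) Plus p A = bd (cube n) Minus p B"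
    using AB by (auto simp: composable_def)
  then have fAB: "f \<in> A" "f \<in> B" using k f cube_elem_face by blast+
  then have "f \<in> words n" using el cube_elem by blast
  then obtain \<phi> where \<phi>: "omega_functor (cube n) (cube (Suc p)) \<phi>"
    "\<And>A. A \<in> elems (cube n) \<Longrightarrow> f \<in> A \<Longrightarrow> \<phi> A = words (Suc p)" using cube_projection f by metis
  have "bd (cube (Suc p)) Plus p (\<phi> A) = bd (cube (Suc p)) Minus p (\<phi> B)"
    using \<phi>(1) el by (metis omega_functor_def)
  then show False using \<phi>(2) el fAB cube_bd_distinct by metis
qed

section \<open>Cubes in an omega-category and their corners\<close>

definition pullback :: "nat \<Rightarrow> (letter list \<Rightarrow> letter list) \<Rightarrow> (letter list set \<Rightarrow> 'a) \<Rightarrow> letter list set \<Rightarrow> 'a" where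
  "pullback m \<phi> x = restrict (\<lambda>A. x (\<phi> ` A)) (elems (cube m))"

lemma cubesD:
  assumes "x \<in> cubes C n"
  shows "A \<in> elems (cube n) \<Longrightarrow> x A \<in> elems C"
    and "A \<in> elems (cube n) \<Longrightarrow> x (bd (cube n) \<alpha> p A) = bd C \<alpha> p (x A)"
    and "composable (cube n) p A B \<Longrightarrow> x (A \<union> B) = cmp C p (x A) (x B)"
    and "x \<in> extensional (elems (cube n))"
proof -
  have x: "omega_functor (cube n) C x" "x \<in> extensional (elems (cube n))" using assms by (auto simp: cubes_def)
  then show "A \<in> elems (cube n) \<Longrightarrow> x A \<in> elems C"
    "A \<in> elems (cube n) \<Longrightarrow> x (bd (cube n) \<alpha> p A) = bd C \<alpha> p (x A)"
    "x \<in> extensional (elems (cube n))" by (auto simp: omega_functor_def)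
  show "composable (cube n) p A B \<Longrightarrow> x (A \<union> B) = cmp C p (x A) (x B)"
    using x cube_cmp by (metis omega_functor_def)
qed

lemma restrict_cubes:
  assumes "\<And>A. A \<in> elems (cube n) \<Longrightarrow> h A \<in> elems C"
    and "\<And>A \<alpha> p. A \<in> elems (cube n) \<Longrightarrow> h (bd (cube n) \<alpha> p A) = bd C \<alpha> p (h A)"
    and "\<And>A B p. composable (cube n) p A B \<Longrightarrow> h (A \<union> B) = cmp C p (h A) (h B)"
  shows "restrict h (elems (cube n)) \<in> cubes C n"
proof -
  interpret omega_category "cube n" by simp
  have "cmp (cube n) p A B = A \<union> B \<and> A \<union> B \<in> elems (cube n) \<and> A \<in> elems (cube n) \<and> B \<in> elems (cube n)"
    if "composable (cube n) p A B" for p A B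
    using that cmp_closed [OF that] cube_cmp [OF that] by (simp add: composable_def)
  then show ?thesis using assms bd_closed by (auto simp: cubes_def omega_functor_def)
qed

lemma cubes_eqI:
  assumes x: "x \<in> cubes C n" and y: "y \<in> cubes C n" and eq: "\<And>k. k \<in> words n \<Longrightarrow> x (R {k}) = y (R {k})"
  shows "x = y"
proof (rule extensionalityI [OF cubesD(4) [OF x] cubesD(4) [OF y]])
  fix A assume "A \<in> elems (cube n)"
  then show "x A = y A"
    by (induction rule: cube_induct) (simp_all add: eq cubesD(3) [OF x] cubesD(3) [OF y])
qed

lemma pullback_cubes:
  assumes \<phi>: "cube_map m n \<phi>" and x: "x \<in> cubes C n" shows "pullback m \<phi> x \<in> cubes C m"
  unfolding pullback_def
proof (rule restrict_cubes)
  fix A assume A: "A \<in> elems (cube m)"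
  show "x (\<phi> ` A) \<in> elems C" using cube_map_bd [OF \<phi> A] cubesD(1) [OF x] by blast
  show "x (\<phi> ` bd (cube m) \<alpha> p A) = bd C \<alpha> p (x (\<phi> ` A))" for \<alpha> p
    using cube_map_bd [OF \<phi> A] cubesD(2) [OF x] by metis
next
  fix A B p assume AB: "composable (cube m) p A B"
  then have "composable (cube n) p (\<phi> ` A) (\<phi> ` B)"
    using cube_map_bd [OF \<phi>] by (simp add: composable_def)
  then show "x (\<phi> ` (A \<union> B)) = cmp C p (x (\<phi> ` A)) (x (\<phi> ` B))"
    using cubesD(3) [OF x] by (simp add: image_Un)
qed

lemma pullback_R:
  assumes "cube_map m n \<phi>" "k \<in> words m" shows "pullback m \<phi> x (R {k}) = x (R {\<phi> k})"
  using cube_mapD(2) [OF assms] cube_generator(1) [OF assms(2)] by (simp add: pullback_def)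

lemma face_map_pullback:
  assumes x: "x \<in> cubes C n" and i: "i \<in> {1..n}"
  shows "face_map C n i \<alpha> x = pullback (n - 1) (insert_letter i (Sgn \<alpha>)) x"
proof -
  have \<phi>: "cube_map (n - 1) n (insert_letter i (Sgn \<alpha>))"
    using cube_map_insert_letter [of i "n - 1" \<alpha>] i by simp
  show ?thesis
    unfolding face_map_def
  proof (rule the_equality)
    show p: "pullback (n - 1) (insert_letter i (Sgn \<alpha>)) x \<in> cubes C (n - 1) \<and>
      (\<forall>k\<in>words (n - 1). pullback (n - 1) (insert_letter i (Sgn \<alpha>)) x (R {k}) = x (R {insert_letter i (Sgn \<alpha>) k}))"
      using pullback_cubes [OF \<phi> x] pullback_R [OF \<phi>] by blast
    fix y assume "y \<in> cubes C (n - 1) \<and> (\<forall>k\<in>words (n - 1). y (R {k}) = x (R {insert_letter i (Sgn \<alpha>) k}))"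
    with p show "y = pullback (n - 1) (insert_letter i (Sgn \<alpha>)) x" by (intro cubes_eqI) auto
  qed
qed

lemma degen_map_pullback:
  assumes x: "x \<in> cubes C n" and i: "i \<in> {1..n + 1}"
  shows "degen_map C n i x = pullback (n + 1) (delete_letter i) x"
proof -
  have \<phi>: "cube_map (n + 1) n (delete_letter i)"
    using cube_map_delete_letter [of i n] i by simp
  show ?thesis
    unfolding degen_map_def
  proof (rule the_equality)
    show p: "pullback (n + 1) (delete_letter i) x \<in> cubes C (n + 1) \<and>
      (\<forall>k\<in>words (n + 1). pullback (n + 1) (delete_letter i) x (R {k}) = x (R {delete_letter i k}))"
      using pullback_cubes [OF \<phi> x] pullback_R [OF \<phi>] by blast
    fix y assume "y \<in> cubes C (n + 1) \<and> (\<forall>k\<in>words (n + 1). y (R {k}) = x (R {delete_letter i k}))"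
    with p show "y = pullback (n + 1) (delete_letter i) x" by (intro cubes_eqI) auto
  qed
qed

lemma face_map_cubes:
  assumes "x \<in> cubes C n" "i \<in> {1..n}" shows "face_map C n i \<alpha> x \<in> cubes C (n - 1)"
  using pullback_cubes [OF cube_map_insert_letter [of i "n - 1" \<alpha>], of x C] assms by (simp add: face_map_pullback)

lemma face_map_R:
  assumes "x \<in> cubes C n" "i \<in> {1..n}" "k \<in> words (n - 1)"
  shows "face_map C n i \<alpha> x (R {k}) = x (R {insert_letter i (Sgn \<alpha>) k})"
  using pullback_R [OF cube_map_insert_letter [of i "n - 1" \<alpha>] assms(3)] assms by (simp add: face_map_pullback)

lemma degen_map_R:
  assumes "x \<in> cubes C n" "i \<in> {1..n + 1}" "k \<in> words (n + 1)"
  shows "degen_map C n i x (R {k}) = x (R {delete_letter i k})"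
  using pullback_R [OF cube_map_delete_letter [of i n]] assms by (simp add: degen_map_pullback)

lemma degen_map_cubes:
  assumes "x \<in> cubes C n" "i \<in> {1..n + 1}" shows "degen_map C n i x \<in> cubes C (n + 1)"
  using pullback_cubes [OF cube_map_delete_letter [of i n], of x C] assms by (simp add: degen_map_pullback)

lemma odim_cube_value:
  assumes C: "omega_category C" and x: "x \<in> cubes C n" and A: "A \<in> elems (cube n)"
    and "\<And>k. k \<in> A \<Longrightarrow> wdim k \<le> p"
  shows "odim C (x A) \<le> p"
proof -
  interpret omega_category C by (rule C)
  have "bd C Minus p (x A) = x A" using cubesD(2) [OF x A, of Minus p] cube_bd_low [OF A assms(4)] by simp
  then show ?thesis using odim_le_iff cubesD(1) [OF x A] by blast
qed

lemma odim_cube_value_R: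
  assumes C: "omega_category C" and x: "x \<in> cubes C n" and k: "k \<in> words n"
  shows "odim C (x (R {k})) \<le> wdim k"
  using odim_cube_value [OF C x cube_generator(1) [OF k]] is_face_wdim by (auto simp: R_singleton)

section \<open>Corner cubes are detected on edges\<close>

definition corner_edge :: "sign \<Rightarrow> letter list \<Rightarrow> bool" where
  "corner_edge \<alpha> k \<longleftrightarrow> wdim k = 1 \<and> set k \<subseteq> {Zero, Sgn \<alpha>}"

lemma corner_edge_insert: "corner_edge \<alpha> (insert_letter i (Sgn \<alpha>) k) \<longleftrightarrow> corner_edge \<alpha> k"
proof -
  have "wdim (insert_letter i (Sgn \<alpha>) k) = wdim (take (i - 1) k @ drop (i - 1) k)"
    by (simp only: insert_letter_def wdim_append wdim_simps)
  moreover have "set (insert_letter i (Sgn \<alpha>) k) = insert (Sgn \<alpha>) (set (take (i - 1) k @ drop (i - 1) k))"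
    by (simp only: insert_letter_def set_append list.set) blast
  ultimately show ?thesis by (auto simp: corner_edge_def)
qed

lemma insert_letter_words: "i \<in> {1..Suc n} \<Longrightarrow> k \<in> words n \<Longrightarrow> insert_letter i c k \<in> words (Suc n)"
  by (auto simp: words_def insert_letter_def)

lemma corner_edge_split:
  assumes "k \<in> words (Suc (Suc m))" "corner_edge \<alpha> k"
  obtains i k' where "i \<in> {1..Suc (Suc m)}" "k' \<in> words (Suc m)" "k = insert_letter i (Sgn \<alpha>) k'"
proof -
  obtain a b r where k: "k = a # b # r" "r \<in> words m" using assms(1) by (auto elim!: words_Suc_cases)
  show ?thesis
  proof (cases "a = Zero")
    case True
    then have "b = Sgn \<alpha>" using assms k by (cases b) (auto simp: corner_edge_def)
    then show ?thesis using that [of "Suc (Suc 0)" "a # r"] k by simp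
  next
    case False
    then have "a = Sgn \<alpha>" using assms k by (auto simp: corner_edge_def)
    then show ?thesis using that [of "Suc 0" "b # r"] k by simp
  qed
qed

text \<open>Iterated faces of sign \<alpha> lead down to the edges at the corner, and a 1-cube whose
  value has dimension 0 is degenerate. Conversely a degenerate cube is constant in some direction,
  so its corner edge in that direction has a value of dimension 0.\<close>

lemma corner_cubes_iff:
  assumes C: "omega_category C" and x: "x \<in> cubes C n"
  shows "x \<in> corner_cubes C \<alpha> n \<longleftrightarrow> (\<forall>k \<in> words n. corner_edge \<alpha> k \<longrightarrow> odim C (x (R {k})) \<noteq> 0)"
proof
  assume edges: "\<forall>k \<in> words n. corner_edge \<alpha> k \<longrightarrow> odim C (x (R {k})) \<noteq> 0"
  have "\<not> degenerate C m y" if "iterated_face C \<alpha> n x m y" for m y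
  proof
    have y: "y \<in> cubes C m \<and> (\<forall>k \<in> words m. corner_edge \<alpha> k \<longrightarrow> odim C (y (R {k})) \<noteq> 0)"
      using that
    proof induction
      case (step m y i)
      have "odim C (face_map C m i \<alpha> y (R {k})) \<noteq> 0" if "k \<in> words (m - 1)" "corner_edge \<alpha> k" for k
        using step insert_letter_words [of i "m - 1" k "Sgn \<alpha>"] that
        by (auto simp: face_map_R corner_edge_insert)
      then show ?case using step face_map_cubes by blast
    qed (use x edges in auto)
    assume "degenerate C m y"
    then obtain i z where i: "i \<in> {1..m}" and z: "z \<in> cubes C (m - 1)" and yz: "y = degen_map C (m - 1) i z"
      by (auto simp: degenerate_def)
    \<comment> \<open>\<open>?r\<close> is the corner itself and \<open>?k\<close> the edge through
      it in the degenerate direction.\<close>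
    let ?r = "replicate (m - 1) (Sgn \<alpha>)"
    let ?k = "insert_letter i Zero ?r"
    have r: "wdim ?r = 0" by (induction "m - 1") (auto simp: wdim_def)
    have k: "?k \<in> words m" using insert_letter_words [of i "m - 1" ?r Zero] i by simp
    have "wdim ?k = Suc (wdim (take (i - 1) ?r @ drop (i - 1) ?r))"
      by (simp only: insert_letter_def wdim_append wdim_simps)
    then have "corner_edge \<alpha> ?k"
      using r unfolding corner_edge_def insert_letter_def append_take_drop_id by auto
    then have "odim C (y (R {?k})) \<noteq> 0" using y k by blast
    moreover have "delete_letter i ?k = ?r"
      using i by (auto simp: delete_letter_def insert_letter_def min_def simp flip: replicate_add) 
    then have "y (R {?k}) = z (R {?r})" using degen_map_R [OF z, of i ?k] i k yz by simp
    ultimately show False using odim_cube_value_R [OF C z, of ?r] r by simp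
  qed
  then show "x \<in> corner_cubes C \<alpha> n" using x by (auto simp: corner_cubes_def)
next
  assume corner: "x \<in> corner_cubes C \<alpha> n"
  have "odim C (y (R {k})) \<noteq> 0" if "iterated_face C \<alpha> n x m y" "y \<in> cubes C m" "k \<in> words m" "corner_edge \<alpha> k" for m y k
    using that
  proof (induction m arbitrary: y k)
    case 0
    then show ?case by (auto simp: corner_edge_def words_def)
  next
    case (Suc m)
    show ?case
    proof (cases m)
      case 0
      show ?thesis
      proof
        assume "odim C (y (R {k})) = 0"
        moreover have k: "k = [Zero]" using Suc.prems 0 by (cases k; cases "hd k") (auto simp: corner_edge_def words_def)
        ultimately have u: "bd C \<beta> 0 (y (R {[Zero]})) = y (R {[Zero]})" for \<beta>
          using omega_category.bd_odim_le [OF C] cubesD(1) [OF Suc.prems(2) cube_generator(1) [OF Suc.prems(3)]] by simp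
        \<comment> \<open>Both ends of an edge of dimension 0 equal its value, so \<open>y\<close>
          is the degeneracy of its end.\<close>
        have Sgn: "y (R {[Sgn \<beta>]}) = y (R {[Zero]})" for \<beta>
        proof -
          have "bd (cube 1) \<beta> 0 (R {[Zero]}) = R {[Sgn \<beta>]}"
            using cube_bd_facets [of "[Zero]" 1 \<beta>] by (simp add: words_def)
          then show ?thesis
            using u [of \<beta>] cubesD(2) [OF Suc.prems(2), of "R {[Zero]}" \<beta> 0] cube_generator(1) [of "[Zero]" 1] 0
            by (simp add: words_def)
        qed
        let ?z = "face_map C 1 1 \<alpha> y"
        have y: "y \<in> cubes C 1" using Suc.prems 0 by simp
        have z: "?z \<in> cubes C 0" using face_map_cubes [OF y, of 1 \<alpha>] by simp
        have "y = degen_map C 0 1 ?z"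
        proof (rule cubes_eqI [OF y])
          show "degen_map C 0 1 ?z \<in> cubes C 1" using degen_map_cubes [OF z, of 1] by simp
          fix w assume w: "w \<in> words 1"
          then obtain c where c: "w = [c]" by (auto simp: words_def length_Suc_conv)
          have "degen_map C 0 1 ?z (R {w}) = ?z (R {[]})" using degen_map_R [OF z, of 1 w] w c by simp
          also have "\<dots> = y (R {[Sgn \<alpha>]})" using face_map_R [OF y, of 1 "[]" \<alpha>] by simp
          also have "\<dots> = y (R {w})" using Sgn c by (cases c) auto
          finally show "y (R {w}) = degen_map C 0 1 ?z (R {w})" by simp
        qed
        then have "degenerate C (Suc m) y" using z 0 by (auto simp: degenerate_def)
        then show False using corner Suc.prems by (auto simp: corner_cubes_def)
      qed
    next
      case m: (Suc m')
      obtain i k' where i: "i \<in> {1..Suc m}" "k' \<in> words m" "k = insert_letter i (Sgn \<alpha>) k'"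
        using corner_edge_split [of k m' \<alpha>] Suc.prems m by auto
      have "odim C (face_map C (Suc m) i \<alpha> y (R {k'})) \<noteq> 0"
        using Suc.IH [of "face_map C (Suc m) i \<alpha> y" k'] iterated_face.step [OF Suc.prems(1) i(1)]
          face_map_cubes [OF Suc.prems(2) i(1)] i Suc.prems(4) by (simp add: corner_edge_insert)
      then show ?thesis using face_map_R [OF Suc.prems(2) i(1)] i by simp
    qed
  qed
  then show "\<forall>k \<in> words n. corner_edge \<alpha> k \<longrightarrow> odim C (x (R {k})) \<noteq> 0"
    using x iterated_face.refl by blast
qed

lemma corner_cubes_subset: "x \<in> corner_cubes C \<alpha> n \<Longrightarrow> x \<in> cubes C n"
  by (simp add: corner_cubes_def)

text \<open>With the letters ordered -, 0, + this is the maximum for \<open>Minus\<close> and the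
  minimum for \<open>Plus\<close>. What matters is that \<open>Sgn \<alpha>\<close> is neutral,
  which makes both faces of sign \<alpha> in the first two directions copies of the cube, and that
  \<open>Sgn (opp \<alpha>)\<close> is absorbing.\<close>

fun merge :: "sign \<Rightarrow> letter \<Rightarrow> letter \<Rightarrow> letter" where
  "merge \<alpha> (Sgn a) b = (if a = \<alpha> then b else Sgn a)"
| "merge \<alpha> Zero b = (if b = Sgn (opp \<alpha>) then b else Zero)"

fun connection :: "sign \<Rightarrow> letter list \<Rightarrow> letter list" where
  "connection \<alpha> (a # b # k) = merge \<alpha> a b # k"
| "connection \<alpha> k = k"

lemma R_absorb:
  assumes "k \<in> X" "X \<subseteq> R {k}" shows "R X = R {k}"
proof -
  have "R X \<subseteq> R (R {k})" using assms(2) unfolding R_eq_face_closure by (rule face_closure_mono)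
  moreover have "R {k} \<subseteq> R X" using assms(1) unfolding R_eq_face_closure by (intro face_closure_mono) simp
  ultimately show ?thesis by simp
qed

lemma cube_map_connection: "cube_map (Suc (Suc m)) (Suc m) (connection \<alpha>)"
  unfolding cube_map_def
proof (intro ballI conjI allI impI)
  fix k assume "k \<in> words (Suc (Suc m))"
  then obtain a b r where k: "k = a # b # r" "r \<in> words m" by (auto elim!: words_Suc_cases)
  show "connection \<alpha> k \<in> words (Suc m)" using k by simp
  show "wdim (connection \<alpha> k) \<le> wdim k" using k by (cases a; cases b) auto
  have opp_cases: "c = \<alpha> \<or> c = opp \<alpha>" for c using neq_iff_opp by blast
  show "connection \<alpha> ` R {k} = R {connection \<alpha> k}"
  proof (intro subset_antisym subsetI)
    fix w assume "w \<in> connection \<alpha> ` R {k}"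
    then obtain a' b' r' where w: "w = merge \<alpha> a' b' # r'" "a = Zero \<or> a' = a" "b = Zero \<or> b' = b" "is_face r' r"
      unfolding k by (auto simp: R_singleton is_face_Cons)
    then have "merge \<alpha> a b = Zero \<or> merge \<alpha> a' b' = merge \<alpha> a b"
      by (cases a; cases b; cases a'; cases b'; auto simp: neq_iff_opp)
    then show "w \<in> R {connection \<alpha> k}" using w by (simp add: k R_singleton)
  next
    fix w assume "w \<in> R {connection \<alpha> k}"
    then obtain c r' where w: "w = c # r'" "merge \<alpha> a b = Zero \<or> c = merge \<alpha> a b" "is_face r' r"
      by (auto simp: k R_singleton is_face_Cons)
    have "\<exists>a' b'. c = merge \<alpha> a' b' \<and> (a = Zero \<or> a' = a) \<and> (b = Zero \<or> b' = b)"
    proof (cases "c = merge \<alpha> a b")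
      case False
      then have m: "merge \<alpha> a b = Zero" using w by simp
      then consider "a = Zero" "b \<noteq> Sgn (opp \<alpha>)" | "a = Sgn \<alpha>" "b = Zero"
        by (cases a) (auto split: if_splits)
      then show ?thesis
      proof cases
        case 1
        then have "c = merge \<alpha> c b'" if "b' = Sgn \<alpha>" for b' using that opp_neq by (cases c) auto
        with 1 show ?thesis using opp_cases by (metis letter.exhaust)
      next
        case 2
        then have "c = merge \<alpha> a c" by simp
        with 2 show ?thesis by blast
      qed
    qed auto
    then obtain a' b' where "c = merge \<alpha> a' b'" "a = Zero \<or> a' = a" "b = Zero \<or> b' = b" by blast
    then have "w = connection \<alpha> (a' # b' # r')" "a' # b' # r' \<in> R {k}" using w by (auto simp: k R_singleton)
    then show "w \<in> connection \<alpha> ` R {k}" by blast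
  qed
  have facets_R: "c # f \<in> R {c # r}" if "f \<in> facets \<beta> r" for c f \<beta>
    using facets_is_face [OF that] by (simp add: R_singleton)
  fix \<beta> assume "1 \<le> wdim k"
  show "R (connection \<alpha> ` facets \<beta> k) =
      (if wdim (connection \<alpha> k) < wdim k then R {connection \<alpha> k} else R (facets \<beta> (connection \<alpha> k)))"
  proof (cases a)
    case a: (Sgn s)
    show ?thesis
    proof (cases b)
      case (Sgn t)
      then show ?thesis by (simp add: k a image_image)
    next
      case b: Zero
      show ?thesis
      proof (cases "s = \<alpha>")
        case True
        then show ?thesis by (simp add: k a b image_image)
      next
        case False
        have "R (insert (Sgn s # r) ((#) (Sgn s) ` facets (opp \<beta>) r)) = R {Sgn s # r}"
          by (rule R_absorb) (use facets_R in \<open>auto simp: R_singleton\<close>)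
        then show ?thesis using False by (simp add: k a b image_image)
      qed
    qed
  next
    case a: Zero
    show ?thesis
    proof (cases b)
      case b: (Sgn t)
      show ?thesis
      proof (cases "t = \<alpha>")
        case True
        then show ?thesis by (simp add: k a b image_image)
      next
        case False
        then have t: "t = opp \<alpha>" by (simp add: neq_iff_opp)
        have "R (insert (Sgn t # r) ((#) (Sgn t) ` facets (opp \<beta>) r)) = R {Sgn t # r}"
          by (rule R_absorb) (use facets_R in \<open>auto simp: R_singleton\<close>)
        moreover have "merge \<alpha> (Sgn \<beta>) (Sgn t) = Sgn t" using opp_cases [of \<beta>] t by auto
        ultimately show ?thesis using t by (simp add: k a b image_image)
      qed
    next
      case b: Zero
      \<comment> \<open>The two facets with a new sign in the first or second place carry \<beta>
        and \<open>opp \<beta>\<close> there. One of these is \<alpha>, which is neutral, so that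
        facet maps onto \<open>Zero # r\<close>.\<close>
      have "R (connection \<alpha> ` facets \<beta> k) = R {Zero # r}"
      proof (rule R_absorb)
        show "Zero # r \<in> connection \<alpha> ` facets \<beta> k" "connection \<alpha> ` facets \<beta> k \<subseteq> R {Zero # r}"
          using opp_cases [of \<beta>] facets_R
          by (auto simp: k a b image_image image_iff R_singleton facets_is_face)
      qed
      then show ?thesis by (simp add: k a b)
    qed
  qed
qed

section \<open>Filling\<close>

text \<open>If one factor is an identity in direction p, it is a p-boundary of the other, and the
  composition law follows from the unit laws and compatibility with boundaries.\<close>

lemma restrict_cubes_nonidentity:
  assumes C: "omega_category C"
    and h: "\<And>A. A \<in> elems (cube n) \<Longrightarrow> h A \<in> elems C"
    and bd: "\<And>A \<alpha> p. A \<in> elems (cube n) \<Longrightarrow> h (bd (cube n) \<alpha> p A) = bd C \<alpha> p (h A)"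
    and cmp: "\<And>A B p. composable (cube n) p A B \<Longrightarrow> bd (cube n) Plus p A \<noteq> A \<Longrightarrow>
      bd (cube n) Plus p B \<noteq> B \<Longrightarrow> h (A \<union> B) = cmp C p (h A) (h B)"
  shows "restrict h (elems (cube n)) \<in> cubes C n"
proof (rule restrict_cubes [OF h bd])
  interpret C: omega_category C by (rule C)
  interpret I: omega_category "cube n" by simp
  fix A B p assume AB: "composable (cube n) p A B"
  then have el: "A \<in> elems (cube n)" "B \<in> elems (cube n)" "bd (cube n) Plus p A = bd (cube n) Minus p B"
    by (auto simp: composable_def)
  consider "bd (cube n) Plus p A = A" | "bd (cube n) Plus p B = B" | "bd (cube n) Plus p A \<noteq> A" "bd (cube n) Plus p B \<noteq> B"
    by blast
  then show "h (A \<union> B) = cmp C p (h A) (h B)"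
  proof cases
    case 1
    then have A: "bd (cube n) Minus p B = A" using el by simp
    then have "A \<union> B = B" using I.cmp_source [OF el(2), of p] cube_cmp [OF AB] by simp
    moreover have "h A = bd C Minus p (h B)" using bd [OF el(2), of Minus p] A by simp
    ultimately show ?thesis using C.cmp_source h el by simp
  next
    case 2
    then have B: "bd (cube n) Plus p A = B" using el I.odim_le_iff by metis
    then have "A \<union> B = A" using I.cmp_target [OF el(1), of p] cube_cmp [OF AB] by simp
    moreover have "h B = bd C Plus p (h A)" using bd [OF el(1), of Plus p] B by simp
    ultimately show ?thesis using C.cmp_target h el by simp
  next
    case 3
    then show ?thesis using cmp AB by blast
  qed
qed auto

text \<open>If one factor were the whole cube, all faces of the other would be common to both, hence
  of dimension at most p, making the other an identity. And the top face, if it lies in the union,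
  lies in one of the factors. So the value on the whole cube can be changed without affecting these
  composites.\<close>

lemma cube_nonid:
  assumes AB: "composable (cube n) p A B"
    and nonid: "bd (cube n) Plus p A \<noteq> A" "bd (cube n) Plus p B \<noteq> B"
  shows "p < n" "A \<noteq> words n" "B \<noteq> words n" "A \<union> B \<noteq> words n"
proof -
  interpret omega_category "cube n" by simp
  have el: "A \<in> elems (cube n)" "B \<in> elems (cube n)" using AB by (auto simp: composable_def)
  show "p < n"
  proof (rule ccontr)
    assume "\<not> p < n"
    then have "wdim k \<le> p" if "k \<in> A" for k using cube_elem(1) [OF el(1)] that wdim_words by fastforce
    then show False using cube_bd_low [OF el(1)] nonid by blast
  qed
  have disj: "wdim k \<le> p" if "k \<in> A" "k \<in> B" for k using cube_composable_disjoint [OF AB that] .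
  show A: "A \<noteq> words n"
    using cube_elem(1) [OF el(2)] disj cube_bd_low [OF el(2)] nonid by blast
  show B: "B \<noteq> words n"
    using cube_elem(1) [OF el(1)] disj cube_bd_low [OF el(1)] nonid by blast
  show "A \<union> B \<noteq> words n"
  proof
    assume "A \<union> B = words n"
    then have "replicate n Zero \<in> A \<or> replicate n Zero \<in> B" by (metis UnE replicate_words)
    then show False using A B cube_elem_top el by blast
  qed
qed

lemma cube_bd_words: "bd (cube n) \<alpha> p (words n) = words n \<longleftrightarrow> n \<le> p"
  using omega_category.odim_le_iff [OF omega_category_cube words_elem] odim_words by metis

lemma cube_bd_proper: "A \<in> elems (cube n) \<Longrightarrow> A \<noteq> words n \<Longrightarrow> bd (cube n) \<alpha> p A \<noteq> words n"
  using cube_bd_subset cube_elem(1) by blast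

definition parallel :: "'a ocat \<Rightarrow> nat \<Rightarrow> 'a \<Rightarrow> 'a \<Rightarrow> bool" where
  "parallel C n v w \<longleftrightarrow> (\<forall>\<alpha>. \<forall>p < n. bd C \<alpha> p v = bd C \<alpha> p w)"

definition refill :: "nat \<Rightarrow> (letter list set \<Rightarrow> 'a) \<Rightarrow> 'a \<Rightarrow> letter list set \<Rightarrow> 'a" where
  "refill n y w = restrict (\<lambda>A. if A = words n then w else y A) (elems (cube n))"

text \<open>Composites without identity factor do not involve the interior, so only its boundaries
  have to be checked; below n they agree by parallelism.\<close>

lemma refill_cubes:
  assumes C: "omega_category C" and y: "y \<in> cubes C n"
    and w: "w \<in> elems C" "odim C w \<le> n" "parallel C n (y (words n)) w"
  shows "refill n y w \<in> cubes C n"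
  unfolding refill_def
proof (rule restrict_cubes_nonidentity [OF C])
  interpret C: omega_category C by (rule C)
  fix A assume A: "A \<in> elems (cube n)"
  show "(if A = words n then w else y A) \<in> elems C" using w cubesD(1) [OF y] A by simp
  fix \<alpha> p
  show "(if bd (cube n) \<alpha> p A = words n then w else y (bd (cube n) \<alpha> p A)) = bd C \<alpha> p (if A = words n then w else y A)"
  proof (cases "A = words n")
    case False
    then show ?thesis using cube_bd_proper [OF A] cubesD(2) [OF y A] by simp
  next
    case True
    show ?thesis
    proof (cases "n \<le> p")
      case le: True
      then show ?thesis using True cube_bd_words w C.bd_odim_le [of w p] by simp
    next
      case False
      then show ?thesis using True cube_bd_words w(3) cubesD(2) [OF y A] by (simp add: parallel_def)
    qed
  qed
next
  fix A B p assume AB: "composable (cube n) p A B" "bd (cube n) Plus p A \<noteq> A" "bd (cube n) Plus p B \<noteq> B"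
  show "(if A \<union> B = words n then w else y (A \<union> B)) =
      cmp C p (if A = words n then w else y A) (if B = words n then w else y B)"
    using cube_nonid [OF AB] cubesD(3) [OF y AB(1)] by simp
qed

text \<open>Degenerate along the connection, with the interior replaced by \<open>u\<close> and one of the two faces
  that the connection maps to the top cell replaced by the other end of \<open>u\<close>.\<close>

definition filler :: "sign \<Rightarrow> nat \<Rightarrow> (letter list set \<Rightarrow> 'a) \<Rightarrow> 'a \<Rightarrow> 'a \<Rightarrow> letter list set \<Rightarrow> 'a" where
  "filler \<alpha> m y u v = restrict (\<lambda>A. if A = words (Suc (Suc m)) then u
     else if Zero # Sgn \<alpha> # replicate m Zero \<in> A then v
     else y (connection \<alpha> ` A)) (elems (cube (Suc (Suc m))))"

text \<open>The delicate composites have the altered face \<open>?w\<close> in one factor. The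
  connection maps that factor onto the whole n-cube, so the image of the other factor consists of
  faces common to both images, of dimension at most p. Its value is then an identity in direction p,
  and the unit law applies to the new value of \<open>?w\<close>.\<close>

lemma filler_cubes:
  fixes \<alpha> m
  defines "n \<equiv> Suc m"
  assumes C: "omega_category C" and y: "y \<in> cubes C n"
    and u: "u \<in> elems C" "odim C u \<le> Suc n" "bd C \<alpha> n u = y (words n)"
  shows "filler \<alpha> m y u (bd C (opp \<alpha>) n u) \<in> cubes C (Suc n)"
proof -
  interpret C: omega_category C by (rule C)
  interpret I: omega_category "cube (Suc n)" by simp
  let ?v = "bd C (opp \<alpha>) n u" and ?g = "(`) (connection \<alpha>)"
  \<comment> \<open>The faces of sign \<alpha> in directions 2 and 1. By the alternation of signs
    \<open>?w1\<close> lies in the boundary of sign \<alpha> and \<open>?w\<close> in that of sign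
    \<open>opp \<alpha>\<close>, which dictates the ends of \<open>u\<close> placed there.\<close>
  let ?w = "Zero # Sgn \<alpha> # replicate m Zero" and ?w1 = "Sgn \<alpha> # replicate n Zero"
  have g: "cube_map (Suc n) n (connection \<alpha>)" unfolding n_def by (rule cube_map_connection)
  have wd: "wdim ?w = n" by (simp add: n_def)
  have gel: "?g A \<in> elems (cube n)" and gbd: "?g (bd (cube (Suc n)) \<beta> p A) = bd (cube n) \<beta> p (?g A)"
    if "A \<in> elems (cube (Suc n))" for A \<beta> p
    using cube_map_bd [OF g that] by auto
  have gtop: "?g A = words n" if "A \<in> elems (cube (Suc n))" "k \<in> A" "connection \<alpha> k = replicate n Zero" for A k
    using cube_elem_top [OF gel [OF that(1)]] that(2,3) by (metis imageI)
  have gw: "connection \<alpha> ?w = replicate n Zero" "connection \<alpha> ?w1 = replicate n Zero" by (auto simp: n_def)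
  have v_ge: "bd C \<beta> p ?v = ?v" if "n \<le> p" for \<beta> p using that u by (simp add: C.bd_bd_ge)
  have v_lt: "bd C \<beta> p ?v = bd C \<beta> p (y (words n))" "bd C \<beta> p u = bd C \<beta> p (y (words n))" if "p < n" for \<beta> p
    using that u(1) C.bd_bd_less by (auto simp flip: u(3))
  have v: "?v \<in> elems C" using u C.bd_closed by blast
  let ?h = "\<lambda>A. if A = words (Suc n) then u else if ?w \<in> A then ?v else y (?g A)"
  have low: "wdim k \<le> n" if "A \<in> elems (cube (Suc n))" "A \<noteq> words (Suc n)" "k \<in> A" for A k
  proof -
    have k: "k \<in> words (Suc n)" using that cube_elem(1) by blast
    then have "k \<noteq> replicate (Suc n) Zero" using that cube_elem_top by blast
    then have "wdim k \<noteq> Suc n" using k wdim_eq_length [of k] by (auto simp: words_def)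
    then show ?thesis using wdim_words [OF k] by simp
  qed
  have "restrict ?h (elems (cube (Suc n))) \<in> cubes C (Suc n)"
  proof (rule restrict_cubes_nonidentity [OF C])
    fix A assume A: "A \<in> elems (cube (Suc n))"
    show "?h A \<in> elems C" using u v cubesD(1) [OF y gel [OF A]] by simp
    fix \<beta> p
    \<comment> \<open>Boundaries below n contain neither of the two altered faces, so only the
      connection is seen there.\<close>
    have h_bd: "?h (bd (cube (Suc n)) \<beta> p B) = bd C \<beta> p (y (?g B))" if "B \<in> elems (cube (Suc n))" "p < n" for B p
    proof -
      have "?w \<notin> bd (cube (Suc n)) \<beta> p B" using cube_bd_wdim [OF that(1), of ?w \<beta> p] wd that(2) by auto
      moreover have "bd (cube (Suc n)) \<beta> p B \<noteq> words (Suc n)"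
        using cube_bd_wdim [OF that(1), of "replicate (Suc n) Zero" \<beta> p] that(2) by auto
      ultimately show ?thesis using gbd [OF that(1)] cubesD(2) [OF y gel [OF that(1)]] by simp
    qed
    show "?h (bd (cube (Suc n)) \<beta> p A) = bd C \<beta> p (?h A)"
    proof (cases "A = words (Suc n)")
      case False
      show ?thesis
      proof (cases "p < n")
        case True
        show ?thesis
        proof (cases "?w \<in> A")
          case w: True
          then have "?g A = words n" using gtop A gw by blast
          then show ?thesis using h_bd [OF A True] v_lt True False w by simp
        qed (use h_bd [OF A True] False in simp)
      next
        case p: False
        then have "bd (cube (Suc n)) \<beta> p A = A" using cube_bd_low [OF A] low [OF A False] by (meson not_less order_trans)
        moreover have "bd C \<beta> p (y (?g A)) = y (?g A)"
          using cubesD(2) [OF y gel [OF A], of \<beta> p] gbd [OF A, of \<beta> p] calculation by simp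
        ultimately show ?thesis using False v_ge p by auto
      qed
    next
      case A: True
      have "?w \<in> words (Suc n)" by (simp add: n_def)
      then have gA: "?g A = words n" unfolding A by (rule gtop [OF words_elem _ gw(1)])
      consider "p < n" | "p = n" | "Suc n \<le> p" by linarith
      then show ?thesis
      proof cases
        case 1
        then show ?thesis using h_bd [of A p] A gA v_lt by simp
      next
        case 3
        then show ?thesis using A cube_bd_words C.bd_odim_le [OF u(1), of p \<beta>] u(2) by simp
      next
        case 2
        let ?B = "bd (cube (Suc n)) \<beta> n (words (Suc n))"
        let ?z = "replicate (Suc n) Zero"
        have B: "?B = R (facets \<beta> ?z)"
          using cube_bd_facets [of ?z "Suc n" \<beta>] R_top [of "Suc n"] by simp
        have Bel: "?B \<in> elems (cube (Suc n))" by (simp add: I.bd_closed)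
        have Bne: "?B \<noteq> words (Suc n)" using cube_bd_words [of "Suc n" \<beta> n] by simp
        have mem: "k \<in> ?B \<longleftrightarrow> k \<in> facets \<beta> ?z" if "wdim k = n" for k
        proof
          assume "k \<in> ?B"
          then obtain f where f: "f \<in> facets \<beta> ?z" "is_face k f" unfolding B R_eq_face_closure face_closure_def by blast
          then show "k \<in> facets \<beta> ?z" using facets_wdim [OF f(1)] is_face_wdim_eq [OF f(2)] that by simp
        next
          assume "k \<in> facets \<beta> ?z" then show "k \<in> ?B" unfolding B by (rule R.base)
        qed
        show ?thesis
        proof (cases "\<beta> = \<alpha>")
          case True
          then have "?w \<notin> ?B" "?w1 \<in> ?B"
            using mem [of ?w] mem [of ?w1] wd by (auto simp: n_def image_iff)
          then show ?thesis using True 2 A Bne gtop [OF Bel, of ?w1] gw u by simp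
        next
          case False
          then have \<beta>: "\<beta> = opp \<alpha>" by (simp add: neq_iff_opp)
          then have "?w \<in> ?B" using mem [of ?w] wd by (auto simp: n_def)
          then show ?thesis using \<beta> 2 A Bne by simp
        qed
      qed
    qed
  next
    fix A B p assume AB: "composable (cube (Suc n)) p A B" "bd (cube (Suc n)) Plus p A \<noteq> A" "bd (cube (Suc n)) Plus p B \<noteq> B"
    have el: "A \<in> elems (cube (Suc n))" "B \<in> elems (cube (Suc n))" "bd (cube (Suc n)) Plus p A = bd (cube (Suc n)) Minus p B"
      using AB by (auto simp: composable_def)
    have ne: "A \<noteq> words (Suc n)" "B \<noteq> words (Suc n)" "A \<union> B \<noteq> words (Suc n)"
      using cube_nonid [OF AB] by auto
    have p: "p < n"
    proof (rule ccontr)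
      assume "\<not> p < n"
      then have "wdim k \<le> p" if "k \<in> A" for k using low [OF el(1) ne(1) that] by simp
      then show False using cube_bd_low [OF el(1)] AB(2) by blast
    qed
    have gAB: "composable (cube n) p (?g A) (?g B)" unfolding composable_def using gel gbd el by metis
    have yAB: "y (?g (A \<union> B)) = cmp C p (y (?g A)) (y (?g B))" using cubesD(3) [OF y gAB] by (simp add: image_Un)
    have bdy: "bd C \<beta> p (y (?g X)) = y (bd (cube n) \<beta> p (?g X))" if "X \<in> elems (cube (Suc n))" for X \<beta>
      using cubesD(2) [OF y gel [OF that]] by simp
    show "?h (A \<union> B) = cmp C p (?h A) (?h B)"
    proof (cases "?w \<in> A \<or> ?w \<in> B")
      case False
      then show ?thesis using ne yAB by simp
    next
      case w: True
      have excl: "\<not> (?w \<in> A \<and> ?w \<in> B)" using cube_composable_disjoint [OF AB(1), of ?w] wd p by auto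
      have id: "bd (cube n) \<beta> p X = X"
        if "X \<in> elems (cube n)" "\<And>k. k \<in> X \<Longrightarrow> k \<in> ?g A \<and> k \<in> ?g B" for X \<beta>
        using cube_bd_low [OF that(1)] cube_composable_disjoint [OF gAB] that(2) by blast
      show ?thesis
      proof (cases "?w \<in> A")
        case A: True
        then have gA: "?g A = words n" using gtop el gw by blast
        then have "bd (cube n) Minus p (?g B) = ?g B" using id [OF gel [OF el(2)]] cube_elem(1) [OF gel [OF el(2)]] by blast
        then have "y (?g B) = bd C Plus p (y (words n))"
          using gAB gA bdy [OF el(1), of Plus] by (simp add: composable_def)
        also have "\<dots> = bd C Plus p ?v" using v_lt p by simp
        finally show ?thesis using A excl ne C.cmp_target [OF v, of p] by simp
      next
        case False
        then have B: "?w \<in> B" using w by blast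
        then have gB: "?g B = words n" using gtop el gw by blast
        then have "bd (cube n) Plus p (?g A) = ?g A" using id [OF gel [OF el(1)]] cube_elem(1) [OF gel [OF el(1)]] by blast
        then have "y (?g A) = bd C Minus p (y (words n))"
          using gAB gB bdy [OF el(2), of Minus] by (simp add: composable_def)
        also have "\<dots> = bd C Minus p ?v" using v_lt p by simp
        finally show ?thesis using False B ne C.cmp_source [OF v, of p] by simp
      qed
    qed
  qed
  then show ?thesis unfolding filler_def n_def .
qed

lemma filler_R:
  assumes "k \<in> words (Suc (Suc m))"
  shows "filler \<alpha> m y u v (R {k}) = (if k = replicate (Suc (Suc m)) Zero then u
    else if k = Zero # Sgn \<alpha> # replicate m Zero then v else y (R {connection \<alpha> k}))"
proof -
  let ?z = "replicate (Suc (Suc m)) Zero" and ?w = "Zero # Sgn \<alpha> # replicate m Zero"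
  have "R {k} = words (Suc (Suc m)) \<longleftrightarrow> k = ?z"
  proof
    assume "R {k} = words (Suc (Suc m))"
    then have "is_face ?z k" by (metis R_singleton replicate_words)
    moreover have "wdim k \<le> wdim ?z" using wdim_words [OF assms] by (simp only: wdim_replicate)
    ultimately show "k = ?z" using is_face_wdim is_face_wdim_eq by (metis le_antisym)
  qed (simp only: R_top)
  moreover have "?w \<in> R {k} \<longleftrightarrow> k = ?w" if "k \<noteq> ?z"
  proof
    assume "?w \<in> R {k}"
    then have f: "is_face ?w k" by (simp only: R_singleton)
    have "wdim k \<noteq> Suc (Suc m)" using that wdim_eq_length [of k] assms by (auto simp: words_def)
    then have "wdim k \<le> wdim ?w" using wdim_words [OF assms] by simp
    then show "k = ?w" using f is_face_wdim is_face_wdim_eq by (metis le_antisym)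
  qed (simp add: R_singleton)
  ultimately show ?thesis
    using cube_generator(1) [OF assms] cube_mapD(2) [OF cube_map_connection assms, of \<alpha>]
    by (simp add: filler_def)
qed

lemma refill_R:
  assumes "k \<in> words n"
  shows "refill n y w (R {k}) = (if k = replicate n Zero then w else y (R {k}))"
proof -
  have "R {k} = words n \<longleftrightarrow> k = replicate n Zero"
  proof
    assume "R {k} = words n"
    then have "is_face (replicate n Zero) k" by (metis R_singleton replicate_words)
    moreover have "wdim k \<le> wdim (replicate n Zero)" using wdim_words [OF assms] by (simp only: wdim_replicate)
    ultimately show "k = replicate n Zero" using is_face_wdim is_face_wdim_eq by (metis le_antisym)
  qed (simp only: R_top)
  then show ?thesis using cube_generator(1) [OF assms] by (simp add: refill_def)
qed

lemma corner_edge_connection: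
  assumes "k \<in> words (Suc (Suc m))" "corner_edge \<alpha> k" shows "corner_edge \<alpha> (connection \<alpha> k)"
proof -
  obtain a b r where k: "k = a # b # r" using assms(1) by (auto elim!: words_Suc_cases)
  then have "a = Zero \<or> a = Sgn \<alpha>" "b = Zero \<or> b = Sgn \<alpha>" using assms(2) by (auto simp: corner_edge_def)
  then show ?thesis using assms(2) k by (auto simp: corner_edge_def)
qed

text \<open>The neutral sign makes the connection send corner edges to corner edges. The only
  altered face that can be an edge is the one of direction 2, for n = 1, and its new value has
  dimension 1.\<close>

lemma filler_corner:
  fixes \<alpha> m
  defines "n \<equiv> Suc m"
  assumes C: "omega_category C" and y: "y \<in> corner_cubes C \<alpha> n"
    and u: "u \<in> elems C" "odim C u \<le> Suc n" "bd C \<alpha> n u = y (words n)"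
    and v: "odim C (bd C (opp \<alpha>) n u) = n"
  shows "filler \<alpha> m y u (bd C (opp \<alpha>) n u) \<in> corner_cubes C \<alpha> (Suc n)"
proof -
  have yc: "y \<in> cubes C n" using y by (rule corner_cubes_subset)
  have f: "filler \<alpha> m y u (bd C (opp \<alpha>) n u) \<in> cubes C (Suc n)"
    using filler_cubes [OF C, of y m u \<alpha>] yc u by (simp add: n_def)
  show ?thesis
    unfolding corner_cubes_iff [OF C f]
  proof (intro ballI impI)
    fix k assume k: "k \<in> words (Suc n)" "corner_edge \<alpha> k"
    have "k \<noteq> replicate (Suc (Suc m)) Zero" using k(2) wdim_replicate [of "Suc (Suc m)"] by (auto simp: corner_edge_def)
    moreover have "odim C (y (R {connection \<alpha> k})) \<noteq> 0"
      using y [unfolded corner_cubes_iff [OF C yc]] corner_edge_connection [of k m \<alpha>] k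
        cube_mapD(1) [OF cube_map_connection, of k m \<alpha>] by (simp add: n_def)
    ultimately show "odim C (filler \<alpha> m y u (bd C (opp \<alpha>) n u) (R {k})) \<noteq> 0"
      using k v by (simp add: n_def filler_R)
  qed
qed

lemma refill_corner:
  assumes C: "omega_category C" and y: "y \<in> corner_cubes C \<alpha> n" and "0 < n"
    and w: "w \<in> elems C" "odim C w = n" "parallel C n (y (words n)) w"
  shows "refill n y w \<in> corner_cubes C \<alpha> n"
proof -
  have yc: "y \<in> cubes C n" using y by (rule corner_cubes_subset)
  have f: "refill n y w \<in> cubes C n" using refill_cubes [OF C yc w(1)] w by simp
  show ?thesis
    unfolding corner_cubes_iff [OF C f]
  proof (intro ballI impI)
    fix k assume k: "k \<in> words n" "corner_edge \<alpha> k"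
    then have "odim C (y (R {k})) \<noteq> 0" using y [unfolded corner_cubes_iff [OF C yc]] by blast
    then show "odim C (refill n y w (R {k})) \<noteq> 0" using w \<open>0 < n\<close> by (simp add: refill_R [OF k(1)])
  qed
qed

text \<open>Faces of index 3 or more contain neither altered face. They depend on \<open>y\<close>
  alone and cancel when two fillers of the same \<open>y\<close> are subtracted.\<close>

lemma filler_faces:
  fixes \<alpha> m
  defines "n \<equiv> Suc m"
  assumes C: "omega_category C" and y: "y \<in> cubes C n"
    and u: "u \<in> elems C" "odim C u \<le> Suc n" "bd C \<alpha> n u = y (words n)"
  shows "face_map C (Suc n) 1 \<alpha> (filler \<alpha> m y u (bd C (opp \<alpha>) n u)) = y"
    and "face_map C (Suc n) 2 \<alpha> (filler \<alpha> m y u (bd C (opp \<alpha>) n u)) = refill n y (bd C (opp \<alpha>) n u)"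
    and "\<And>i k. i \<in> {3..Suc n} \<Longrightarrow> k \<in> words n \<Longrightarrow>
      face_map C (Suc n) i \<alpha> (filler \<alpha> m y u (bd C (opp \<alpha>) n u)) (R {k}) = y (R {connection \<alpha> (insert_letter i (Sgn \<alpha>) k)})"
proof -
  interpret C: omega_category C by (rule C)
  let ?v = "bd C (opp \<alpha>) n u"
  have f: "filler \<alpha> m y u ?v \<in> cubes C (Suc n)"
    using filler_cubes [OF C, of y m u \<alpha>] y u by (simp add: n_def)
  have face: "face_map C (Suc n) i \<alpha> (filler \<alpha> m y u ?v) (R {k}) =
     (if insert_letter i (Sgn \<alpha>) k = Zero # Sgn \<alpha> # replicate m Zero then ?v
      else y (R {connection \<alpha> (insert_letter i (Sgn \<alpha>) k)}))"
    if "i \<in> {1..Suc n}" "k \<in> words n" for i k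
  proof -
    have "Sgn \<alpha> \<in> set (insert_letter i (Sgn \<alpha>) k)" by (simp add: insert_letter_def)
    then have "insert_letter i (Sgn \<alpha>) k \<noteq> replicate (Suc (Suc m)) Zero" by (metis in_set_replicate letter.distinct(1))
    then show ?thesis
      using face_map_R [OF f that(1), of k \<alpha>] insert_letter_words [OF that, of "Sgn \<alpha>"] that
      by (simp add: n_def filler_R)
  qed
  have par: "parallel C n (y (words n)) ?v"
    using u C.bd_bd_less [OF u(1)] unfolding parallel_def u(3) [symmetric] by simp
  have ref: "refill n y ?v \<in> cubes C n"
    by (rule refill_cubes [OF C y C.bd_closed [OF u(1)] C.odim_bd [OF u(1)] par])
  show "face_map C (Suc n) 1 \<alpha> (filler \<alpha> m y u ?v) = y"
  proof (rule cubes_eqI [OF _ y])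
    show "face_map C (Suc n) 1 \<alpha> (filler \<alpha> m y u ?v) \<in> cubes C n" using face_map_cubes [OF f, of 1] by simp
    fix k assume k: "k \<in> words n"
    then obtain c r where "k = c # r" unfolding n_def by (auto elim: words_Suc_cases)
    then show "face_map C (Suc n) 1 \<alpha> (filler \<alpha> m y u ?v) (R {k}) = y (R {k})" using face [of 1 k] k by simp
  qed
  show "face_map C (Suc n) 2 \<alpha> (filler \<alpha> m y u ?v) = refill n y ?v"
  proof (rule cubes_eqI [OF _ ref])
    show "face_map C (Suc n) 2 \<alpha> (filler \<alpha> m y u ?v) \<in> cubes C n" using face_map_cubes [OF f, of 2] by (simp add: n_def)
    fix k assume k: "k \<in> words n"
    then obtain c r where c: "k = c # r" unfolding n_def by (auto elim: words_Suc_cases)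
    have "insert_letter 2 (Sgn \<alpha>) k = c # Sgn \<alpha> # r" by (simp add: c insert_letter_def)
    moreover have "merge \<alpha> c (Sgn \<alpha>) = c" by (cases c) auto
    ultimately show "face_map C (Suc n) 2 \<alpha> (filler \<alpha> m y u ?v) (R {k}) = refill n y ?v (R {k})"
      using face [of 2 k] k c by (auto simp: refill_R [OF k [unfolded c], unfolded n_def] n_def)
  qed
  show "face_map C (Suc n) i \<alpha> (filler \<alpha> m y u ?v) (R {k}) = y (R {connection \<alpha> (insert_letter i (Sgn \<alpha>) k)})"
    if i: "i \<in> {3..Suc n}" and k: "k \<in> words n" for i k
  proof -
    obtain j where j: "i = Suc (Suc (Suc j))" using i by (cases i; cases "i - 1"; cases "i - 2") auto
    obtain m' where m: "m = Suc m'" using i by (cases m) (auto simp: n_def)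
    then obtain a b r where r: "k = a # b # r" using k unfolding n_def by (auto elim!: words_Suc_cases)
    have "Sgn \<alpha> \<in> set (insert_letter (Suc j) (Sgn \<alpha>) r)" by (simp add: insert_letter_def)
    then have "insert_letter (Suc j) (Sgn \<alpha>) r \<noteq> replicate m Zero" by (metis in_set_replicate letter.distinct(1))
    then show ?thesis using face [of i k] i k by (simp add: j r)
  qed
qed

section \<open>Homology\<close>

lemma corner_boundary_diff: "corner_boundary C \<alpha> n (a - b) = corner_boundary C \<alpha> n a - corner_boundary C \<alpha> n b"
  by (simp add: corner_boundary_def frag_extend_diff)

lemma corner_boundaries_zero: "0 \<in> corner_boundaries C \<alpha> n"
  unfolding corner_boundaries_def by (rule image_eqI [of _ _ 0]) (auto simp: corner_boundary_def corner_chain_group_def)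

lemma corner_boundaries_diff:
  assumes "a \<in> corner_boundaries C \<alpha> n" "b \<in> corner_boundaries C \<alpha> n"
  shows "a - b \<in> corner_boundaries C \<alpha> n"
proof -
  obtain a' b' where ab: "a = corner_boundary C \<alpha> (n + 1) a'" "b = corner_boundary C \<alpha> (n + 1) b'"
    "Poly_Mapping.keys a' \<subseteq> corner_cubes C \<alpha> (n + 1)" "Poly_Mapping.keys b' \<subseteq> corner_cubes C \<alpha> (n + 1)"
    using assms by (auto simp: corner_boundaries_def corner_chain_group_def)
  then have "Poly_Mapping.keys (a' - b') \<subseteq> corner_cubes C \<alpha> (n + 1)" using keys_diff [of a' b'] by blast
  then show ?thesis
    unfolding corner_boundaries_def
    by (intro image_eqI [of _ _ "a' - b'"]) (auto simp: ab corner_boundary_diff corner_chain_group_def)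
qed

lemma corner_boundaries_minus: "a \<in> corner_boundaries C \<alpha> n \<Longrightarrow> - a \<in> corner_boundaries C \<alpha> n"
  using corner_boundaries_diff [OF corner_boundaries_zero] by fastforce

lemma corner_boundaries_add:
  "a \<in> corner_boundaries C \<alpha> n \<Longrightarrow> b \<in> corner_boundaries C \<alpha> n \<Longrightarrow> a + b \<in> corner_boundaries C \<alpha> n"
  using corner_boundaries_diff [of a C \<alpha> n "- b"] corner_boundaries_minus by fastforce

section \<open>Homotopic interiors give homologous cubes\<close>

lemma refill_refill: "refill n (refill n y v) w = refill n y w"
  by (auto simp: refill_def)

lemma refill_id: "y \<in> cubes C n \<Longrightarrow> refill n y (y (words n)) = y"
  using cubesD(4) [of y C n] by (auto simp: refill_def extensional_def fun_eq_iff)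

lemma refill_words [simp]: "refill n y w (words n) = w"
  by (simp add: refill_def)

lemma filler_boundary:
  fixes \<alpha> m
  defines "n \<equiv> Suc m"
  assumes C: "omega_category C" and y: "y \<in> corner_cubes C \<alpha> n" and top: "odim C (y (words n)) = n"
    and u: "u \<in> elems C" "odim C u \<le> Suc n" "bd C \<alpha> n u = y (words n)"
    and v: "odim C (bd C (opp \<alpha>) n u) = n"
  shows "frag_of y - frag_of (refill n y (bd C (opp \<alpha>) n u)) \<in> corner_boundaries C \<alpha> n"
proof -
  interpret C: omega_category C by (rule C)
  let ?v = "bd C (opp \<alpha>) n u" and ?x = "y (words n)"
  \<comment> \<open>\<open>?Z\<close> is the plain connection: \<open>?x\<close> is the value it
    already has on the interior and on the face of direction 2.\<close>
  let ?Y = "filler \<alpha> m y u ?v" and ?Z = "filler \<alpha> m y ?x ?x"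
  have yc: "y \<in> cubes C n" using y by (rule corner_cubes_subset)
  have u0: "?x \<in> elems C" "odim C ?x \<le> Suc n" "bd C \<beta> n ?x = ?x" for \<beta>
    using cubesD(1) [OF yc words_elem] top C.bd_odim_le by auto
  note F = filler_faces [OF C, of y m u \<alpha>, folded n_def, OF yc u]
  note F0 = filler_faces [OF C, of y m ?x \<alpha>, folded n_def, OF yc u0, unfolded u0 refill_id [OF yc]]
  have Y: "?Y \<in> corner_cubes C \<alpha> (Suc n)"
    by (rule filler_corner [OF C, of y \<alpha> m u, folded n_def, OF y u v])
  have Y0: "?Z \<in> corner_cubes C \<alpha> (Suc n)"
  proof -
    have "odim C (bd C (opp \<alpha>) n ?x) = n" using u0(3) top by simp
    then show ?thesis using filler_corner [OF C, of y \<alpha> m ?x, folded n_def, OF y u0] unfolding u0(3) by blast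
  qed
  let ?term = "\<lambda>Y i. frag_cmul ((- 1) ^ (i + 1)) (frag_of (face_map C (Suc n) i \<alpha> Y))"
  have same: "face_map C (Suc n) i \<alpha> ?Y = face_map C (Suc n) i \<alpha> ?Z" if i: "i \<in> {1..Suc n}" "i \<noteq> 2" for i
  proof (cases "i = 1")
    case True
    then show ?thesis using F(1) F0(1) by simp
  next
    case False
    then have i3: "i \<in> {3..Suc n}" using i by auto
    have "face_map C (Suc n) i \<alpha> ?Y \<in> cubes C n" "face_map C (Suc n) i \<alpha> ?Z \<in> cubes C n"
      using face_map_cubes [OF corner_cubes_subset [OF Y] i(1), of \<alpha>]
        face_map_cubes [OF corner_cubes_subset [OF Y0] i(1), of \<alpha>] by simp_all
    then show ?thesis
    proof (rule cubes_eqI)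
      fix k assume "k \<in> words n"
      then show "face_map C (Suc n) i \<alpha> ?Y (R {k}) = face_map C (Suc n) i \<alpha> ?Z (R {k})"
        by (simp only: F(3) [OF i3] F0(3) [OF i3])
    qed
  qed
  have "corner_boundary C \<alpha> (Suc n) (frag_of ?Y - frag_of ?Z) = (\<Sum>i = 1..Suc n. ?term ?Y i - ?term ?Z i)"
    by (simp add: corner_boundary_diff) (simp add: corner_boundary_def sum_subtractf)
  \<comment> \<open>Only the face of direction 2 differs. Its coefficient is -1, hence the order of
    the terms in the result.\<close>
  also have "\<dots> = (\<Sum>i\<in>{2}. ?term ?Y i - ?term ?Z i)"
  proof (rule sum.mono_neutral_right)
    show "\<forall>i\<in>{1..Suc n} - {2}. ?term ?Y i - ?term ?Z i = 0" using same by auto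
  qed (auto simp: n_def)
  also have "\<dots> = frag_of y - frag_of (refill n y ?v)"
    using F(2) F0(2) by simp
  finally have eq: "frag_of y - frag_of (refill n y ?v) = corner_boundary C \<alpha> (n + 1) (frag_of ?Y - frag_of ?Z)"
    by simp
  have "Poly_Mapping.keys (frag_of ?Y - frag_of ?Z) \<subseteq> corner_cubes C \<alpha> (n + 1)"
    using keys_diff [of "frag_of ?Y" "frag_of ?Z"] Y Y0 by (auto simp: keys_frag_of)
  then show ?thesis
    unfolding eq corner_boundaries_def corner_chain_group_def by (intro imageI) simp
qed

text \<open>Refilling defines a linear map \<open>F\<close> on chains of n-morphisms. Modulo
  boundaries it identifies s_n u with t_n u for each generator u, so it sends the difference of the
  two interiors to a boundary. Where refilling is impossible \<open>F\<close> is 0; as s_n u and t_n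
  u are parallel to each other, this affects both or neither.\<close>

lemma refill_homotopic:
  assumes D: "omega_category D" "dim_regular D" and y: "y \<in> corner_cubes D \<alpha> n" and "0 < n"
    and hom: "homotopic_morphisms D n (y (words n)) w" and par: "parallel D n (y (words n)) w"
  shows "frag_of y - frag_of (refill n y w) \<in> corner_boundaries D \<alpha> n"
proof -
  interpret D: omega_category D by (rule D)
  obtain m where m: "n = Suc m" using \<open>0 < n\<close> by (cases n) auto
  let ?B = "corner_boundaries D \<alpha> n"
  let ?v = "y (words n)"
  define F where "F = (\<lambda>v. if v \<in> n_morphisms D n \<and> parallel D n ?v v then frag_of (refill n y v) else 0)"
  have yc: "y \<in> cubes D n" using y by (rule corner_cubes_subset)
  have step: "F (bd D \<alpha> n u) - F (bd D (opp \<alpha>) n u) \<in> ?B" if u: "u \<in> n_morphisms D (n + 1)" for u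
  proof -
    let ?s = "bd D \<alpha> n u" and ?t = "bd D (opp \<alpha>) n u"
    have u': "u \<in> elems D" "odim D u = Suc n" using u by (auto simp: n_morphisms_def)
    \<comment> \<open>By the standing assumption both ends of \<open>u\<close> have dimension
      exactly n, as a filler inside the corner complex requires.\<close>
    have st: "?s \<in> n_morphisms D n" "?t \<in> n_morphisms D n" using D(2) u by (auto simp: dim_regular_def)
    then have st': "?s \<in> elems D" "odim D ?s = n" "?t \<in> elems D" "odim D ?t = n" by (auto simp: n_morphisms_def)
    have bd: "bd D \<beta> p ?s = bd D \<beta> p ?t" if "p < n" for \<beta> p
      using that D.bd_bd_less [OF u'(1)] by simp
    show ?thesis
    proof (cases "parallel D n ?v ?s")
      case True
      then have t: "parallel D n ?v ?t" using bd by (simp add: parallel_def)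
      have ys: "refill n y ?s \<in> corner_cubes D \<alpha> n"
        using refill_corner [OF D(1) y \<open>0 < n\<close>] st' True by blast
      \<comment> \<open>The filler is attached to the cube already refilled with \<open>?s\<close>;
        refilling that with \<open>?t\<close> amounts to refilling \<open>y\<close>.\<close>
      have "frag_of (refill n y ?s) - frag_of (refill n (refill n y ?s) ?t) \<in> ?B"
        by (rule filler_boundary [OF D(1), of "refill n y ?s" \<alpha> m u, folded m, OF ys]) (simp_all only: refill_words st' u' order_refl)
      then show ?thesis using True t st by (simp add: F_def refill_refill)
    next
      case False
      then have "\<not> parallel D n ?v ?t" using bd by (simp add: parallel_def)
      with False show ?thesis by (simp add: F_def corner_boundaries_zero)
    qed
  qed
  have step': "F (bd D Minus n u) - F (bd D Plus n u) \<in> ?B" if "u \<in> n_morphisms D (n + 1)" for u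
  proof (cases \<alpha>)
    case Minus
    then show ?thesis using step [OF that] by simp
  next
    case Plus
    then show ?thesis using corner_boundaries_minus [OF step [OF that]] by simp
  qed
  obtain z where z: "Poly_Mapping.keys z \<subseteq> n_morphisms D (n + 1)"
    "frag_extend (\<lambda>u. frag_of (bd D Minus n u)) z - frag_extend (\<lambda>u. frag_of (bd D Plus n u)) z = frag_of ?v - frag_of w"
    using hom \<open>0 < n\<close> by (auto simp: homotopic_morphisms_def)
  have "frag_extend F (frag_extend (\<lambda>u. frag_of (bd D Minus n u)) z - frag_extend (\<lambda>u. frag_of (bd D Plus n u)) z) \<in> ?B"
    using z(1)
  proof (induction z rule: frag_induction)
    case zero
    show ?case by (simp add: corner_boundaries_zero)
  next
    case (one u)
    then show ?case using step' by (simp add: frag_extend_diff)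
  next
    case (diff a b)
    from corner_boundaries_diff [OF this] show ?case
      by (simp add: frag_extend_diff frag_extend_add algebra_simps)
  qed
  moreover have "w \<in> n_morphisms D n" "?v \<in> n_morphisms D n" using hom by (auto simp: homotopic_morphisms_def)
  ultimately show ?thesis
    unfolding z(2) using par by (simp add: frag_extend_diff F_def refill_id [OF yc] parallel_def)
qed

section \<open>Induced maps on chains\<close>

lemma compose_cubes:
  assumes f: "omega_functor C D f" and x: "x \<in> cubes C n"
  shows "compose (elems (cube n)) f x \<in> cubes D n"
  unfolding compose_def
proof (rule restrict_cubes)
  fix A assume A: "A \<in> elems (cube n)"
  show "f (x A) \<in> elems D" using cubesD(1) [OF x A] f by (auto simp: omega_functor_def)
  show "f (x (bd (cube n) \<alpha> p A)) = bd D \<alpha> p (f (x A))" for \<alpha> p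
    using cubesD(1,2) [OF x A] f by (auto simp: omega_functor_def)
next
  fix A B p assume AB: "composable (cube n) p A B"
  then have "composable C p (x A) (x B)"
    using cubesD(1,2) [OF x] unfolding composable_def by metis
  then show "f (x (A \<union> B)) = cmp D p (f (x A)) (f (x B))"
    using cubesD(3) [OF x AB] f by (auto simp: omega_functor_def)
qed

text \<open>The corner edges have values of dimension exactly 1, and non 1-contracting functors
  preserve this dimension.\<close>

lemma compose_corner_cubes:
  assumes C: "omega_category C" and D: "omega_category D"
    and f: "omega_functor C D f" "non_1_contracting C D f" and x: "x \<in> corner_cubes C \<alpha> n"
  shows "compose (elems (cube n)) f x \<in> corner_cubes D \<alpha> n"
proof -
  have xc: "x \<in> cubes C n" using x by (rule corner_cubes_subset)
  show ?thesis
    unfolding corner_cubes_iff [OF D compose_cubes [OF f(1) xc]]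
  proof (intro ballI impI)
    fix k assume k: "k \<in> words n" "corner_edge \<alpha> k"
    have "odim C (x (R {k})) \<noteq> 0" using x k corner_cubes_iff [OF C xc] by blast
    moreover have "odim C (x (R {k})) \<le> 1"
      using odim_cube_value_R [OF C xc k(1)] k(2) by (simp add: corner_edge_def)
    ultimately have "x (R {k}) \<in> n_morphisms C 1"
      using cubesD(1) [OF xc cube_generator(1) [OF k(1)]] by (simp add: n_morphisms_def)
    then have "odim D (f (x (R {k}))) = 1" using f(2) by (auto simp: non_1_contracting_def n_morphisms_def)
    then show "odim D (compose (elems (cube n)) f x (R {k})) \<noteq> 0"
      using cube_generator(1) [OF k(1)] by (simp add: compose_def)
  qed
qed

lemma face_map_compose:
  assumes f: "omega_functor C D f" and x: "x \<in> cubes C n" and i: "i \<in> {1..n}"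
  shows "face_map D n i \<alpha> (compose (elems (cube n)) f x) = compose (elems (cube (n - 1))) f (face_map C n i \<alpha> x)"
proof (rule cubes_eqI)
  show "face_map D n i \<alpha> (compose (elems (cube n)) f x) \<in> cubes D (n - 1)"
    by (rule face_map_cubes [OF compose_cubes [OF f x] i])
  show "compose (elems (cube (n - 1))) f (face_map C n i \<alpha> x) \<in> cubes D (n - 1)"
    by (rule compose_cubes [OF f face_map_cubes [OF x i]])
  fix k assume k: "k \<in> words (n - 1)"
  have "insert_letter i (Sgn \<alpha>) k \<in> words n" using insert_letter_words [of i "n - 1" k] i k by simp
  then show "face_map D n i \<alpha> (compose (elems (cube n)) f x) (R {k}) =
      compose (elems (cube (n - 1))) f (face_map C n i \<alpha> x) (R {k})"
    using face_map_R [OF compose_cubes [OF f x] i k, of \<alpha>] face_map_R [OF x i k, of \<alpha>]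
      cube_generator(1) k by (simp add: compose_def)
qed

lemma chain_map_diff: "chain_map n f (a - b) = chain_map n f a - chain_map n f b"
  by (simp add: chain_map_def frag_extend_diff)

lemma chain_map_add: "chain_map n f (a + b) = chain_map n f a + chain_map n f b"
  by (simp add: chain_map_def frag_extend_add)

lemma chain_map_closed:
  assumes "omega_category C" "omega_category D" "omega_functor C D f" "non_1_contracting C D f"
    and "Poly_Mapping.keys c \<subseteq> corner_cubes C \<alpha> n"
  shows "Poly_Mapping.keys (chain_map n f c) \<subseteq> corner_cubes D \<alpha> n"
  using keys_frag_extend [of "\<lambda>x. frag_of (compose (elems (cube n)) f x)" c] compose_corner_cubes [OF assms(1-4)] assms(5)
  unfolding chain_map_def keys_frag_of by blast

lemma corner_boundary_chain_map:
  assumes f: "omega_functor C D f" and c: "Poly_Mapping.keys c \<subseteq> corner_cubes C \<alpha> n"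
  shows "corner_boundary D \<alpha> n (chain_map n f c) = chain_map (n - 1) f (corner_boundary C \<alpha> n c)"
  using c
proof (induction c rule: frag_induction)
  case (one x)
  then have x: "x \<in> cubes C n" by (rule corner_cubes_subset)
  have "corner_boundary D \<alpha> n (chain_map n f (frag_of x)) =
      (\<Sum>i = 1..n. frag_cmul ((- 1) ^ (i + 1)) (frag_of (face_map D n i \<alpha> (compose (elems (cube n)) f x))))"
    by (simp add: corner_boundary_def chain_map_def)
  also have "\<dots> = (\<Sum>i = 1..n. frag_cmul ((- 1) ^ (i + 1)) (frag_of (compose (elems (cube (n - 1))) f (face_map C n i \<alpha> x))))"
    using face_map_compose [OF f x] by (intro sum.cong) auto
  also have "\<dots> = chain_map (n - 1) f (corner_boundary C \<alpha> n (frag_of x))"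
    by (simp add: corner_boundary_def chain_map_def frag_extend_sum frag_extend_cmul)
  finally show ?case .
qed (simp_all add: corner_boundary_def chain_map_def frag_extend_diff)

text \<open>The two composed cubes agree off the interior. They differ there only when p = n and the
  interior has dimension n; the images are then parallel, because the functors agree on the lower
  boundaries.\<close>

lemma compose_homotopic:
  assumes C: "omega_category C" and D: "omega_category D" "dim_regular D"
    and f: "omega_functor C D f" "non_1_contracting C D f" and g: "omega_functor C D g"
    and eq: "\<And>x. x \<in> elems C \<Longrightarrow> odim C x < n \<Longrightarrow> f x = g x"
    and hom: "\<And>x. x \<in> n_morphisms C n \<Longrightarrow> homotopic_morphisms D n (f x) (g x)"
    and p: "p \<le> n" and x: "x \<in> corner_cubes C \<alpha> p"
  shows "frag_of (compose (elems (cube p)) f x) - frag_of (compose (elems (cube p)) g x) \<in> corner_boundaries D \<alpha> p"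
proof -
  interpret C: omega_category C by (rule C)
  interpret D: omega_category D by (rule D)
  let ?f = "compose (elems (cube p)) f x" and ?g = "compose (elems (cube p)) g x"
  have xc: "x \<in> cubes C p" using x by (rule corner_cubes_subset)
  have el: "x A \<in> elems C" if "A \<in> elems (cube p)" for A using cubesD(1) [OF xc that] .
  have proper: "f (x A) = g (x A)" if A: "A \<in> elems (cube p)" "A \<noteq> words p" for A
  proof -
    have "k \<in> words p \<and> k \<noteq> replicate p Zero" if "k \<in> A" for k
      using that A cube_elem_top cube_elem(1) by blast
    then have "wdim k \<noteq> p \<and> wdim k \<le> p" if "k \<in> A" for k
      using that wdim_eq_length [of k] wdim_words [of k p] by (auto simp: words_def)
    then have k: "wdim k < p" if "k \<in> A" for k using that by (simp add: le_neq_implies_less)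
    show ?thesis
    proof (cases p)
      case 0
      \<comment> \<open>An element of the 0-cube other than the whole cube would be empty, and no
        element is.\<close>
      have "A = {}" using k 0 by auto
      moreover have "A \<noteq> {}" using A(1)
        by (induction rule: cube_induct) (use is_face_refl in \<open>auto simp: R_singleton\<close>, metis R_singleton empty_iff is_face_refl)
      ultimately show ?thesis by simp
    next
      case (Suc q)
      then have "odim C (x A) \<le> q" using odim_cube_value [OF C xc A(1), of q] k by fastforce
      then show ?thesis using eq [OF el [OF A(1)]] Suc p by simp
    qed
  qed
  let ?v = "x (words p)"
  show ?thesis
  proof (cases "f ?v = g ?v")
    case True
    then have "?f = ?g" using proper by (auto simp: compose_def fun_eq_iff)
    then show ?thesis by (simp add: corner_boundaries_zero)
  next
    case False
    have "odim C ?v \<le> p" using odim_cube_value [OF C xc words_elem] wdim_words by blast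
    moreover have "\<not> odim C ?v < n" using False eq el [OF words_elem] by blast
    ultimately have pn: "p = n" "?v \<in> n_morphisms C n" using p el [OF words_elem] by (auto simp: n_morphisms_def)
    have h: "homotopic_morphisms D n (f ?v) (g ?v)" using hom pn by blast
    \<comment> \<open>For n = 0 homotopic means equal, so distinct values force n > 0.\<close>
    then have "0 < n" using False by (auto simp: homotopic_morphisms_def split: if_splits)
    have fv: "?f (words p) = f ?v" by (simp add: compose_def)
    have par: "parallel D n (f ?v) (g ?v)"
      unfolding parallel_def
    proof (intro allI impI)
      fix \<beta> q assume q: "q < n"
      have v: "?v \<in> elems C" by (rule el) simp
      have "odim C (bd C \<beta> q ?v) < n" using C.odim_bd [OF v, of \<beta> q] q by simp
      then show "bd D \<beta> q (f ?v) = bd D \<beta> q (g ?v)"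
        using eq [OF C.bd_closed [OF v]] f(1) g v by (auto simp: omega_functor_def)
    qed
    have "refill n ?f (g ?v) = ?g"
      using proper pn(1) by (auto simp: refill_def compose_def fun_eq_iff)
    moreover have "?f \<in> corner_cubes D \<alpha> n" using compose_corner_cubes [OF C D(1) f x] pn by simp
    ultimately show ?thesis
      using refill_homotopic [OF D, of ?f \<alpha> n "g ?v"] h par fv pn(1) \<open>0 < n\<close> by simp
  qed
qed

lemma chain_map_homotopic:
  assumes "\<And>x. x \<in> corner_cubes C \<alpha> p \<Longrightarrow>
      frag_of (compose (elems (cube p)) f x) - frag_of (compose (elems (cube p)) g x) \<in> corner_boundaries D \<alpha> p"
    and c: "Poly_Mapping.keys c \<subseteq> corner_cubes C \<alpha> p"
  shows "chain_map p f c - chain_map p g c \<in> corner_boundaries D \<alpha> p"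
  using c
proof (induction c rule: frag_induction)
  case (diff a b)
  from corner_boundaries_diff [OF this] show ?case by (simp add: chain_map_diff algebra_simps)
qed (use assms(1) in \<open>simp_all add: chain_map_def corner_boundaries_zero\<close>)

section \<open>Homology classes as cosets of boundaries\<close>

lemma corner_cycles_iff:
  "c \<in> corner_cycles C \<alpha> n \<longleftrightarrow> Poly_Mapping.keys c \<subseteq> corner_cubes C \<alpha> n \<and> corner_boundary C \<alpha> n c = 0"
  by (simp add: corner_cycles_def corner_chain_group_def)

lemma carrier_corner_cycle_group: "carrier (corner_cycle_group C \<alpha> n) = corner_cycles C \<alpha> n"
proof -
  interpret group "corner_chain_group C \<alpha> n" by (simp add: corner_chain_group_def)
  have "subgroup (corner_cycles C \<alpha> n) (corner_chain_group C \<alpha> n)"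
  proof
    fix a b assume ab: "a \<in> corner_cycles C \<alpha> n" "b \<in> corner_cycles C \<alpha> n"
    then show "a \<otimes>\<^bsub>corner_chain_group C \<alpha> n\<^esub> b \<in> corner_cycles C \<alpha> n"
      using keys_add [of a b]
      by (auto simp: corner_cycles_iff corner_chain_group_def corner_boundary_def frag_extend_add)
    have "Poly_Mapping.keys a \<subseteq> corner_cubes C \<alpha> n" using ab by (simp add: corner_cycles_iff)
    then show "inv\<^bsub>corner_chain_group C \<alpha> n\<^esub> a \<in> corner_cycles C \<alpha> n"
      using ab by (simp add: corner_cycles_iff corner_chain_group_def corner_boundary_def frag_extend_minus)
  qed (auto simp: corner_cycles_iff corner_chain_group_def corner_boundary_def)
  then show ?thesis
    unfolding corner_cycle_group_def by (rule subgroup.carrier_subgroup_generated_subgroup)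
qed

lemma mult_corner_cycle_group [simp]: "a \<otimes>\<^bsub>corner_cycle_group C \<alpha> n\<^esub> b = a + b"
  by (simp add: corner_cycle_group_def corner_chain_group_def)

definition boundary_coset :: "'a ocat \<Rightarrow> sign \<Rightarrow> nat \<Rightarrow> ((letter list set \<Rightarrow> 'a) \<Rightarrow>\<^sub>0 int) \<Rightarrow> ((letter list set \<Rightarrow> 'a) \<Rightarrow>\<^sub>0 int) set" where
  "boundary_coset C \<alpha> n c = {b + c | b. b \<in> corner_boundaries C \<alpha> n}"

lemma r_coset_corner_boundaries:
  "corner_boundaries C \<alpha> n #>\<^bsub>corner_cycle_group C \<alpha> n\<^esub> c = boundary_coset C \<alpha> n c"
  by (auto simp: r_coset_def boundary_coset_def)

lemma boundary_coset_eq: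
  assumes "c - d \<in> corner_boundaries C \<alpha> n" shows "boundary_coset C \<alpha> n c = boundary_coset C \<alpha> n d"
proof -
  have sub: "boundary_coset C \<alpha> n c \<subseteq> boundary_coset C \<alpha> n d" if "c - d \<in> corner_boundaries C \<alpha> n" for c d
  proof
    fix e assume "e \<in> boundary_coset C \<alpha> n c"
    then obtain b where "b \<in> corner_boundaries C \<alpha> n" "e = b + c" by (auto simp: boundary_coset_def)
    then have "b + (c - d) \<in> corner_boundaries C \<alpha> n" "e = (b + (c - d)) + d"
      using corner_boundaries_add that by auto
    then show "e \<in> boundary_coset C \<alpha> n d" unfolding boundary_coset_def by blast
  qed
  show ?thesis using sub [OF assms] sub [of d c] corner_boundaries_minus [OF assms] by simp
qed

lemma carrier_corner_homology: "carrier (corner_homology C \<alpha> n) = boundary_coset C \<alpha> n ` corner_cycles C \<alpha> n"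
  by (auto simp: corner_homology_def FactGroup_def RCOSETS_def carrier_corner_cycle_group r_coset_corner_boundaries)

lemma mult_corner_homology:
  "boundary_coset C \<alpha> n c \<otimes>\<^bsub>corner_homology C \<alpha> n\<^esub> boundary_coset C \<alpha> n d = boundary_coset C \<alpha> n (c + d)"
proof -
  have "boundary_coset C \<alpha> n c \<otimes>\<^bsub>corner_homology C \<alpha> n\<^esub> boundary_coset C \<alpha> n d =
      {a + b | a b. a \<in> boundary_coset C \<alpha> n c \<and> b \<in> boundary_coset C \<alpha> n d}"
    by (auto simp: corner_homology_def FactGroup_def set_mult_def)
  also have "\<dots> = boundary_coset C \<alpha> n (c + d)"
  proof (intro subset_antisym subsetI)
    fix e assume "e \<in> {a + b | a b. a \<in> boundary_coset C \<alpha> n c \<and> b \<in> boundary_coset C \<alpha> n d}"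
    then obtain a b where "a \<in> corner_boundaries C \<alpha> n" "b \<in> corner_boundaries C \<alpha> n" "e = (a + c) + (b + d)"
      by (auto simp: boundary_coset_def)
    then have "a + b \<in> corner_boundaries C \<alpha> n" "e = (a + b) + (c + d)" using corner_boundaries_add by (auto simp: algebra_simps)
    then show "e \<in> boundary_coset C \<alpha> n (c + d)" unfolding boundary_coset_def by blast
  next
    fix e assume "e \<in> boundary_coset C \<alpha> n (c + d)"
    then obtain a where a: "a \<in> corner_boundaries C \<alpha> n" "e = (a + c) + (0 + d)"
      by (auto simp: boundary_coset_def algebra_simps)
    then have "a + c \<in> boundary_coset C \<alpha> n c" "0 + d \<in> boundary_coset C \<alpha> n d"
      using corner_boundaries_zero unfolding boundary_coset_def by blast+
    then show "e \<in> {a + b | a b. a \<in> boundary_coset C \<alpha> n c \<and> b \<in> boundary_coset C \<alpha> n d}" using a by blast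
  qed
  finally show ?thesis .
qed

text \<open>Representatives of one class differ by boundaries, and so do their images, since the
  chain map commutes with the differentials. All cosets in the union therefore coincide.\<close>

lemma corner_homology_map_coset:
  assumes f: "omega_category C" "omega_category D" "omega_functor C D f" "non_1_contracting C D f"
  shows "corner_homology_map D \<alpha> n f (boundary_coset C \<alpha> n c) = boundary_coset D \<alpha> n (chain_map n f c)"
proof -
  have "boundary_coset D \<alpha> n (chain_map n f (b + c)) = boundary_coset D \<alpha> n (chain_map n f c)"
    if b: "b \<in> corner_boundaries C \<alpha> n" for b
  proof (rule boundary_coset_eq)
    obtain e where e: "b = corner_boundary C \<alpha> (n + 1) e" "Poly_Mapping.keys e \<subseteq> corner_cubes C \<alpha> (n + 1)"
      using b by (auto simp: corner_boundaries_def corner_chain_group_def)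
    then have "chain_map n f b = corner_boundary D \<alpha> (n + 1) (chain_map (n + 1) f e)"
      using corner_boundary_chain_map [OF f(3) e(2)] by simp
    moreover have "Poly_Mapping.keys (chain_map (n + 1) f e) \<subseteq> corner_cubes D \<alpha> (n + 1)"
      using chain_map_closed [OF f e(2)] .
    ultimately have "chain_map n f b \<in> corner_boundaries D \<alpha> n"
      by (auto simp: corner_boundaries_def corner_chain_group_def)
    then show "chain_map n f (b + c) - chain_map n f c \<in> corner_boundaries D \<alpha> n"
      by (simp add: chain_map_add)
  qed
  moreover have "corner_homology_map D \<alpha> n f (boundary_coset C \<alpha> n c) =
      (\<Union>b\<in>corner_boundaries C \<alpha> n. boundary_coset D \<alpha> n (chain_map n f (b + c)))"
    by (auto simp: corner_homology_map_def r_coset_corner_boundaries boundary_coset_def [of C])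
  ultimately show ?thesis using corner_boundaries_zero by force
qed

lemma corner_homology_map_hom:
  assumes f: "omega_category C" "omega_category D" "omega_functor C D f" "non_1_contracting C D f"
  shows "corner_homology_map D \<alpha> n f \<in> hom (corner_homology C \<alpha> n) (corner_homology D \<alpha> n)"
proof (rule homI)
  have cyc: "chain_map n f c \<in> corner_cycles D \<alpha> n" if "c \<in> corner_cycles C \<alpha> n" for c
    using that chain_map_closed [OF f, of c \<alpha> n] corner_boundary_chain_map [OF f(3), of c \<alpha> n]
    by (simp add: corner_cycles_iff) (simp add: chain_map_def)
  fix h assume "h \<in> carrier (corner_homology C \<alpha> n)"
  then show "corner_homology_map D \<alpha> n f h \<in> carrier (corner_homology D \<alpha> n)"
    using cyc by (auto simp: carrier_corner_homology corner_homology_map_coset [OF f])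
next
  fix h h' assume "h \<in> carrier (corner_homology C \<alpha> n)" "h' \<in> carrier (corner_homology C \<alpha> n)"
  then show "corner_homology_map D \<alpha> n f (h \<otimes>\<^bsub>corner_homology C \<alpha> n\<^esub> h') =
      corner_homology_map D \<alpha> n f h \<otimes>\<^bsub>corner_homology D \<alpha> n\<^esub> corner_homology_map D \<alpha> n f h'"
    by (auto simp: carrier_corner_homology mult_corner_homology corner_homology_map_coset [OF f] chain_map_add)
qed

theorem theorem8p7:
  fixes C :: "'a ocat" and D :: "'b ocat" and f g :: "'a \<Rightarrow> 'b" and n :: nat
  assumes "omega_category C" and "omega_category D"
    and "dim_regular C" and "dim_regular D"
    and "omega_functor C D f" and "non_1_contracting C D f"
    and "omega_functor C D g" and "non_1_contracting C D g"
    and "\<And>x. x \<in> elems C \<Longrightarrow> odim C x < n \<Longrightarrow> f x = g x"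
    and "\<And>x. x \<in> n_morphisms C n \<Longrightarrow> homotopic_morphisms D n (f x) (g x)"
  shows "\<forall>p \<le> n. \<forall>\<alpha>.
    corner_homology_map D \<alpha> p f \<in> hom (corner_homology C \<alpha> p) (corner_homology D \<alpha> p) \<and>
    corner_homology_map D \<alpha> p g \<in> hom (corner_homology C \<alpha> p) (corner_homology D \<alpha> p) \<and>
    (\<forall>h \<in> carrier (corner_homology C \<alpha> p).
       corner_homology_map D \<alpha> p f h = corner_homology_map D \<alpha> p g h)"
proof (intro allI impI conjI ballI)
  fix p \<alpha> assume p: "p \<le> n"
  show "corner_homology_map D \<alpha> p f \<in> hom (corner_homology C \<alpha> p) (corner_homology D \<alpha> p)"
    "corner_homology_map D \<alpha> p g \<in> hom (corner_homology C \<alpha> p) (corner_homology D \<alpha> p)"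
    using assms(1,2,5-8) corner_homology_map_hom by blast+
  fix h assume "h \<in> carrier (corner_homology C \<alpha> p)"
  then obtain c where c: "h = boundary_coset C \<alpha> p c" "Poly_Mapping.keys c \<subseteq> corner_cubes C \<alpha> p"
    by (auto simp: carrier_corner_homology corner_cycles_iff)
  have "chain_map p f c - chain_map p g c \<in> corner_boundaries D \<alpha> p"
    using c(2) compose_homotopic [OF assms(1,2,4-7,9,10) p] by (intro chain_map_homotopic)
  then show "corner_homology_map D \<alpha> p f h = corner_homology_map D \<alpha> p g h"
    using corner_homology_map_coset [OF assms(1,2)] assms(5-8) c boundary_coset_eq by metis
qed

end
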